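(* Let $\vec u$ be the solution of $-E\vec u''(x)+A(x)\vec u(x)=\vec f(x)$, $x\in(0,1)$, with $\vec u(0)$ and $\vec u(1)$ given, and let $\vec U$ be the solution of the finite difference scheme $-E\delta^2\vec U(x_j)+A(x_j)\vec U(x_j)=\vec f(x_j)$, $1\le j\le N-1$, $\vec U(0)=\vec u(0)$, $\vec U(1)=\vec u(1)$, on the piecewise uniform Shishkin mesh $\{x_j\}_{j=0}^N$ with transition parameters $\tau_1,\dots,\tau_n$ described in the context. Then there exists a constant $C$, independent of $N$ and of $\varepsilon_1,\dots,\varepsilon_n$, such that $$\|\vec U-\vec u\|\le C (N^{-1}\ln N)^2,$$ where $\|\vec U-\vec u\|=\max_{1\le i\le n}\max_{0\le j\le N}|U_i(x_j)-u_i(x_j)|$.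
   Context: Problem data: $n\ge 1$, an $n\times n$ matrix function $A=(a_{ij})$ on $[0,1]$, $\vec f:[0,1]\to\mathbb R^n$, and boundary values $\vec u(0),\vec u(1)\in\mathbb R^n$ are fixed; $A$ and $\vec f$ are as many times continuously differentiable on $[0,1]$ as required. For all $x\in[0,1]$ and $1\le i\le n$: $a_{ii}(x)>\sum_{j\ne i}|a_{ij}(x)|$ and $a_{ij}(x)\le 0$ for $i\ne j$. The number $\alpha$ is fixed with $0<\alpha<\min_{x\in[0,1],\,1\le i\le n}\sum_{j=1}^n a_{ij}(x)$. The singular perturbation parameters satisfy $0<\varepsilon_1<\dots<\varepsilon_n\le 1$ and $\max_i\sqrt{\varepsilon_i}\le\sqrt\alpha/4$, and $E=\mathrm{diag}(\varepsilon_1,\dots,\varepsilon_n)$. The constant $C$ may depend on $n,A,\vec f,\alpha,\vec u(0),\vec u(1)$ only. Mesh: set $\tau_n=\min\{\tfrac14,2\sqrt{\varepsilon_n/\alpha}\,\ln N\}$ and, for $i=n-1,\dots,1$, $\tau_i=\min\{\tfrac{\tau_{i+1}}2,2\sqrt{\varepsilon_i/\alpha}\,\ln N\}$. On $(\tau_n,1-\tau_n]$ a uniform mesh with $N/2$ intervals is placed; on each of $(\tau_i,\tau_{i+1}]$ and $(1-\tau_{i+1},1-\tau_i]$, $i=1,\dots,n-1$, a uniform mesh with $N/2^{n-i+2}$ intervals; on each of $[0,\tau_1]$ and $(1-\tau_1,1]$ a uniform mesh with $N/2^{n+1}$ intervals. $N>1$ is any integer for which all these numbers are positive integers. The mesh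 points are $0=x_0<x_1<\dots<x_N=1$. Difference operators: $h_j=x_j-x_{j-1}$, $\overline h_j=(h_j+h_{j+1})/2$, $D^+\vec U(x_j)=(\vec U(x_{j+1})-\vec U(x_j))/h_{j+1}$, $D^-\vec U(x_j)=(\vec U(x_j)-\vec U(x_{j-1}))/h_j$, $\delta^2\vec U(x_j)=(D^+\vec U(x_j)-D^-\vec U(x_j))/\overline h_j$. *)

theory Defs
  imports "HOL-Analysis.Analysis"
begin

text \<open>
  Vectors in \<open>\<real>\<^sup>n\<close> and \<open>n \<times> n\<close> matrices are functions on \<open>nat\<close> (resp. pairs of naturals) that are
  only ever consulted on the indices \<open>1, \<dots>, n\<close>; the order of the indices matters for the mesh.
  Vector and matrix functions on \<open>[0,1]\<close> take the component indices first.
\<close>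

definition Cm_unit :: "nat \<Rightarrow> (real \<Rightarrow> real) \<Rightarrow> bool" where
  "Cm_unit m g \<longleftrightarrow> (\<exists>D :: nat \<Rightarrow> real \<Rightarrow> real.
     (\<forall>x\<in>{0..1}. D 0 x = g x) \<and>
     (\<forall>k<m. \<forall>x\<in>{0..1}. (D k has_real_derivative D (Suc k) x) (at x within {0..1})) \<and>
     (\<forall>k\<le>m. continuous_on {0..1} (D k)))"

text \<open>Classical solutions of \<open>- E u'' + A u = f\<close> on \<open>(0,1)\<close>, continuous up to the boundary.\<close>

definition bvp_solution ::
  "nat \<Rightarrow> (nat \<Rightarrow> real) \<Rightarrow> (nat \<Rightarrow> nat \<Rightarrow> real \<Rightarrow> real) \<Rightarrow> (nat \<Rightarrow> real \<Rightarrow> real) \<Rightarrow>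
   (nat \<Rightarrow> real) \<Rightarrow> (nat \<Rightarrow> real) \<Rightarrow> (nat \<Rightarrow> real \<Rightarrow> real) \<Rightarrow> bool" where
  "bvp_solution n \<epsilon> A f g0 g1 u \<longleftrightarrow>
     (\<forall>i\<in>{1..n}. continuous_on {0..1} (u i) \<and> u i 0 = g0 i \<and> u i 1 = g1 i \<and>
       (\<exists>u' u'' :: real \<Rightarrow> real. \<forall>x\<in>{0<..<1}.
          (u i has_real_derivative u' x) (at x) \<and>
          (u' has_real_derivative u'' x) (at x) \<and>
          - \<epsilon> i * u'' x + (\<Sum>k=1..n. A i k x * u k x) = f i x))"

definition admissible_N :: "nat \<Rightarrow> nat \<Rightarrow> bool" where
  "admissible_N n N \<longleftrightarrow> 1 < N \<and> 2 dvd N \<and> (\<forall>i\<in>{1..<n}. 2 ^ (n - i + 2) dvd N) \<and> 2 ^ (n + 1) dvd N"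

text \<open>Only the values at \<open>i = 1, \<dots>, n\<close> are meaningful.\<close>

function trans_point :: "nat \<Rightarrow> (nat \<Rightarrow> real) \<Rightarrow> real \<Rightarrow> nat \<Rightarrow> nat \<Rightarrow> real" where
  "trans_point n \<epsilon> \<alpha> N i =
     (if i < n
      then min (trans_point n \<epsilon> \<alpha> N (i + 1) / 2) (2 * sqrt (\<epsilon> i / \<alpha>) * ln (real N))
      else min (1 / 4) (2 * sqrt (\<epsilon> n / \<alpha>) * ln (real N)))"
  by pat_completeness auto
termination by (relation "Wellfounded.measure (\<lambda>(n, _, _, _, i). n - i)") auto

declare trans_point.simps [simp del]

text \<open>The points of the uniform mesh with \<open>M\<close> intervals that lie in \<open>(a,b]\<close>, in increasing order.\<close>

definition uniform_points :: "real \<Rightarrow> real \<Rightarrow> nat \<Rightarrow> real list" where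
  "uniform_points a b M = map (\<lambda>k. a + real k * ((b - a) / real M)) [1..<M + 1]"

definition shishkin_points :: "nat \<Rightarrow> (nat \<Rightarrow> real) \<Rightarrow> real \<Rightarrow> nat \<Rightarrow> real list" where
  "shishkin_points n \<epsilon> \<alpha> N =
     (let \<tau> = trans_point n \<epsilon> \<alpha> N in
        [0]
      @ uniform_points 0 (\<tau> 1) (N div 2 ^ (n + 1))
      @ concat (map (\<lambda>i. uniform_points (\<tau> i) (\<tau> (i + 1)) (N div 2 ^ (n - i + 2))) [1..<n])
      @ uniform_points (\<tau> n) (1 - \<tau> n) (N div 2)
      @ concat (map (\<lambda>i. uniform_points (1 - \<tau> (i + 1)) (1 - \<tau> i) (N div 2 ^ (n - i + 2)))
                    (rev [1..<n]))
      @ uniform_points (1 - \<tau> 1) 1 (N div 2 ^ (n + 1)))"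

definition shishkin_mesh :: "nat \<Rightarrow> (nat \<Rightarrow> real) \<Rightarrow> real \<Rightarrow> nat \<Rightarrow> nat \<Rightarrow> real" where
  "shishkin_mesh n \<epsilon> \<alpha> N j = shishkin_points n \<epsilon> \<alpha> N ! j"

lemma length_shishkin_points:
  assumes "n \<ge> 1" and "admissible_N n N"
  shows "length (shishkin_points n \<epsilon> \<alpha> N) = N + 1"
proof -
  obtain q where q: "N = 2 ^ (n + 1) * q"
    using assms(2) unfolding admissible_N_def by (auto elim: dvdE)
  have layer: "N div 2 ^ (n - i + 2) = 2 ^ (i - 1) * q" if "i \<in> {1..<n}" for i
  proof -
    from that have "n + 1 = (n - i + 2) + (i - 1)" by auto
    then have "N = 2 ^ (n - i + 2) * (2 ^ (i - 1) * q)"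
      unfolding q by (metis mult.assoc power_add)
    then show ?thesis by simp
  qed
  have pow2sum: "(\<Sum>i<k. 2 ^ i) = (2 ^ k - 1 :: nat)" for k :: nat
    by (induction k) simp_all
  have "(\<Sum>i=1..<n. N div 2 ^ (n - i + 2)) = (\<Sum>i=1..<n. 2 ^ (i - 1) * q)"
    using layer by (intro sum.cong) auto
  also have "\<dots> = (2 ^ (n - 1) - 1) * q"
  proof -
    have "(\<Sum>i=1..<n. 2 ^ (i - 1) * q) = (\<Sum>i<n - 1. 2 ^ i * q)"
      by (rule sum.reindex_bij_witness[of _ "\<lambda>i. i + 1" "\<lambda>i. i - 1"]) auto
    also have "\<dots> = (\<Sum>i<n - 1. 2 ^ i) * q" by (simp add: sum_distrib_right)
    also have "(\<Sum>i<n - 1. 2 ^ i) = (2 ^ (n - 1) - 1 :: nat)"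
      by (rule pow2sum)
    finally show ?thesis .
  qed
  finally have s: "(\<Sum>i=1..<n. N div 2 ^ (n - i + 2)) = (2 ^ (n - 1) - 1) * q" .
  have l: "sum_list (map (\<lambda>i. N div 2 ^ (n - i + 2)) [1..<n]) = (2 ^ (n - 1) - 1) * q"
    using s by (simp add: interv_sum_list_conv_sum_set_nat)
  have l': "sum_list (map (\<lambda>i. N div 2 ^ (n - i + 2)) (rev [1..<n])) = (2 ^ (n - 1) - 1) * q"
    using l by (metis rev_map sum_list_rev)
  have p: "2 ^ n = 2 * (2 ^ (n - 1) :: nat)"
    using assms(1) by (metis One_nat_def Suc_pred' power_Suc less_eq_Suc_le)
  obtain r :: nat where r: "2 ^ (n - 1) = Suc r"
    using not0_implies_Suc[of "2 ^ (n - 1)"] by auto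
  have e: "N div 2 ^ (n + 1) = q" using q by simp
  have h: "N div 2 = 2 ^ n * q" using q by simp
  have len: "length (uniform_points a b M) = M" for a b M
    by (simp add: uniform_points_def)
  have "length (shishkin_points n \<epsilon> \<alpha> N) =
      1 + N div 2 ^ (n + 1) + sum_list (map (\<lambda>i. N div 2 ^ (n - i + 2)) [1..<n]) + N div 2
        + sum_list (map (\<lambda>i. N div 2 ^ (n - i + 2)) (rev [1..<n])) + N div 2 ^ (n + 1)"
    unfolding shishkin_points_def Let_def length_append length_concat map_map comp_def len
    by simp
  also have "\<dots> = N + 1"
    unfolding l l' e h using q p r by (simp add: algebra_simps)
  finally show ?thesis .
qed

text \<open>Difference operators at the point \<open>x j\<close> of a mesh \<open>x\<close>, for a scalar mesh function \<open>V\<close>.\<close>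

definition forward_diff :: "(nat \<Rightarrow> real) \<Rightarrow> (nat \<Rightarrow> real) \<Rightarrow> nat \<Rightarrow> real" where
  "forward_diff x V j = (V (j + 1) - V j) / (x (j + 1) - x j)"

definition backward_diff :: "(nat \<Rightarrow> real) \<Rightarrow> (nat \<Rightarrow> real) \<Rightarrow> nat \<Rightarrow> real" where
  "backward_diff x V j = (V j - V (j - 1)) / (x j - x (j - 1))"

definition second_diff :: "(nat \<Rightarrow> real) \<Rightarrow> (nat \<Rightarrow> real) \<Rightarrow> nat \<Rightarrow> real" where
  "second_diff x V j =
     (forward_diff x V j - backward_diff x V j) / (((x j - x (j - 1)) + (x (j + 1) - x j)) / 2)"

text \<open>Here \<open>U i j\<close> stands for the value \<open>U\<^sub>i(x\<^sub>j)\<close> of a vector mesh function.\<close>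

definition scheme_solution ::
  "nat \<Rightarrow> (nat \<Rightarrow> real) \<Rightarrow> (nat \<Rightarrow> nat \<Rightarrow> real \<Rightarrow> real) \<Rightarrow> (nat \<Rightarrow> real \<Rightarrow> real) \<Rightarrow>
   (nat \<Rightarrow> real) \<Rightarrow> (nat \<Rightarrow> real) \<Rightarrow> nat \<Rightarrow> (nat \<Rightarrow> real) \<Rightarrow> (nat \<Rightarrow> nat \<Rightarrow> real) \<Rightarrow> bool" where
  "scheme_solution n \<epsilon> A f g0 g1 N x U \<longleftrightarrow>
     (\<forall>i\<in>{1..n}. U i 0 = g0 i \<and> U i N = g1 i \<and>
       (\<forall>j\<in>{1..N - 1}.
          - \<epsilon> i * second_diff x (U i) j + (\<Sum>k=1..n. A i k (x j) * U k j) = f i (x j)))"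

end

(*
  Only u, u' and u'' have to be bounded pointwise, since g = eps_i u_i'' = (A u - f)_i gives two more
  derivatives for free. Both u' and u'' solve systems with the operator -E d^2/dx^2 + A, and a
  comparison argument with the layer functions B_m(x) = exp(-x s_m) + exp(-(1-x) s_m),
  s_m = sqrt(alpha / eps_m), yields |u_i'| <= C (1 + sum_{m>=i} B_m / sqrt eps_m) and
  |u_i''| <= C (1 + sum_{m>=i} B_m / eps_m).

  On a mesh interval every layer is either resolved, h <= C sqrt(eps_m) ln N / N, or negligible,
  B_m <= C / N^2. At a node where the mesh is locally uniform, the second difference of a function
  with nonnegative fourth derivative dominates its second derivative; comparing eps_i u_i with a
  majorant of its fourth derivative bounds the truncation error by C (ln N / N)^2. At the remaining
  nodes, at most 2n + 1 in number, the error may be larger by the factor sqrt(eps_i) / h, which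
  is absorbed by the kink of a discrete exponential. As the coupling is strictly diagonally
  dominant, scalar discrete comparison in each equation suffices.
*)
theory Submission
  imports Defs
begin

section \<open>Comparison principle and layer functions\<close>

text \<open>The obstacle is that fast layers act on slower components: for m < i,
  \<open>B m / \<epsilon> m\<close> does not occur in the bound for \<open>u i''\<close>, but it
  does occur in the bound for \<open>\<epsilon> i * u i''''\<close>. Where the mesh does not resolve
  layer m, the Taylor remainder, h^2 times the maximum of the fourth derivative, is useless:
  \<open>B m\<close> is only of order N^-2, while h^2 / \<open>\<epsilon> m\<close> has no bound.
  The majorant therefore keeps \<open>B m\<close> as a function instead of estimating it by a
  number. Since \<open>\<epsilon> m * B m'' = \<alpha> * B m\<close>, a function with fourth
  derivative \<open>B m / \<epsilon> m\<close> can be chosen with second derivative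
  \<open>B m / \<alpha>\<close>, which is negligible, and the truncation error is measured by this
  second derivative. In the same way \<open>B m / sqrt (\<epsilon> m)\<close> in the third
  derivative is integrated exactly at nodes where the mesh width changes. Hence \<open>u\<close> is
  never split into a regular part and layer parts. The third derivative comes from a Landau type
  interpolation between \<open>\<epsilon> i * u i''\<close> and
  \<open>\<epsilon> i * u i''''\<close>, not from another comparison argument.\<close>

lemma second_derivative_nonneg_at_min:
  fixes z z' :: "real \<Rightarrow> real"
  assumes "a < x" "x < b"
    and z: "\<And>y. a < y \<Longrightarrow> y < b \<Longrightarrow> (z has_real_derivative z' y) (at y)"
    and z': "(z' has_real_derivative D) (at x)"
    and min: "\<And>y. a < y \<Longrightarrow> y < b \<Longrightarrow> z x \<le> z y"
  shows "0 \<le> D"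
proof (rule ccontr)
  assume "\<not> 0 \<le> D"
  then have "D < 0" by simp
  have z'0: "z' x = 0"
  proof (rule DERIV_local_min[OF z])
    show "0 < min (x - a) (b - x)" using assms(1,2) by simp
    show "\<forall>y. \<bar>x - y\<bar> < min (x - a) (b - x) \<longrightarrow> z x \<le> z y" using min by (auto simp: abs_if split: if_splits)
  qed (use assms in auto)
  obtain d where d: "0 < d" "\<And>h. 0 < h \<Longrightarrow> h < d \<Longrightarrow> z' (x + h) < z' x"
    using DERIV_neg_dec_right[OF z' \<open>D < 0\<close>] by blast
  define h where "h = min (d / 2) ((b - x) / 2)"
  have h: "0 < h" "h < d" "x + h < b" using d(1) assms(2) by (auto simp: h_def min_def field_simps)
  obtain y where y: "x < y" "y < x + h" "z (x + h) - z x = (x + h - x) * z' y"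
    using MVT2[of x "x + h" z z'] z h assms(1) by auto
  have "z' y < 0" using d(2)[of "y - x"] y h z'0 by simp
  then have "h * z' y < 0" using h(1) by (simp add: mult_pos_neg)
  then have "z (x + h) < z x" using y(3) by simp
  then show False using min[of "x + h"] h assms(1) by simp
qed

text \<open>At the component k and the point t of the least value over all components and all
  points, the nonpositive off-diagonal entries allow every \<open>z l t\<close> to be replaced by
  \<open>z k t\<close>. The row then collapses to the positive row sum times a negative number,
  while the second derivative term has the sign of a minimum.\<close>

lemma system_comparison:
  fixes A :: "nat \<Rightarrow> nat \<Rightarrow> real \<Rightarrow> real" and z z' z'' :: "nat \<Rightarrow> real \<Rightarrow> real"
  assumes eps: "\<And>i. i \<in> {1..n} \<Longrightarrow> 0 \<le> \<epsilon> i"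
    and offdiag: "\<And>i k x. i \<in> {1..n} \<Longrightarrow> k \<in> {1..n} \<Longrightarrow> i \<noteq> k \<Longrightarrow> x \<in> {0<..<1} \<Longrightarrow> A i k x \<le> 0"
    and rowsum: "\<And>i x. i \<in> {1..n} \<Longrightarrow> x \<in> {0<..<1} \<Longrightarrow> 0 < (\<Sum>k=1..n. A i k x)"
    and cont: "\<And>i. i \<in> {1..n} \<Longrightarrow> continuous_on {0..1} (z i)"
    and bdry: "\<And>i. i \<in> {1..n} \<Longrightarrow> 0 \<le> z i 0" "\<And>i. i \<in> {1..n} \<Longrightarrow> 0 \<le> z i 1"
    and z': "\<And>i x. i \<in> {1..n} \<Longrightarrow> x \<in> {0<..<1} \<Longrightarrow> (z i has_real_derivative z' i x) (at x)"
    and z'': "\<And>i x. i \<in> {1..n} \<Longrightarrow> x \<in> {0<..<1} \<Longrightarrow> (z' i has_real_derivative z'' i x) (at x)"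
    and L: "\<And>i x. i \<in> {1..n} \<Longrightarrow> x \<in> {0<..<1} \<Longrightarrow>
      0 \<le> - \<epsilon> i * z'' i x + (\<Sum>k=1..n. A i k x * z k x)"
    and ix: "i \<in> {1..n}" "x \<in> {0..1}"
  shows "0 \<le> z i x"
proof (rule ccontr)
  assume neg: "\<not> 0 \<le> z i x"
  have "\<exists>y\<in>{0..1}. \<forall>t\<in>{0..1}. z k y \<le> z k t" if "k \<in> {1..n}" for k
    using continuous_attains_inf[OF _ _ cont[OF that]] by auto
  then obtain y where y: "\<And>k. k \<in> {1..n} \<Longrightarrow> y k \<in> {0..1}"
    "\<And>k t. k \<in> {1..n} \<Longrightarrow> t \<in> {0..1} \<Longrightarrow> z k (y k) \<le> z k t" by metis
  obtain k where k: "k \<in> {1..n}" "\<And>l. l \<in> {1..n} \<Longrightarrow> z k (y k) \<le> z l (y l)"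
    using ex_is_arg_min_if_finite[of "{1..n}" "\<lambda>k. z k (y k)"] ix(1)
    by (auto simp: is_arg_min_linorder)
  define t where "t = y k"
  have min: "z k t \<le> z l s" if "l \<in> {1..n}" "s \<in> {0..1}" for l s
    using k(2)[OF that(1)] y(2)[OF that] by (simp add: t_def)
  have zneg: "z k t < 0" using min[OF ix] neg by simp
  have "t \<in> {0..1}" using y(1) k(1) by (simp add: t_def)
  moreover have "t \<noteq> 0" "t \<noteq> 1" using zneg bdry[OF k(1)] by auto
  ultimately have t: "t \<in> {0<..<1}" by auto
  have "0 \<le> z'' k t"
    by (rule second_derivative_nonneg_at_min[of 0 t 1 "z k" "z' k"]) (use t z' z'' k(1) min in auto)
  then have 1: "- \<epsilon> k * z'' k t \<le> 0" using eps[OF k(1)] by simp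
  have "(\<Sum>l=1..n. A k l t * z l t) \<le> (\<Sum>l=1..n. A k l t * z k t)"
  proof (rule sum_mono)
    fix l assume l: "l \<in> {1..n}"
    show "A k l t * z l t \<le> A k l t * z k t"
    proof (cases "l = k")
      case False
      then show ?thesis using offdiag[OF k(1) l _ t] min[OF l, of t] t by (intro mult_left_mono_neg) auto
    qed simp
  qed
  also have "\<dots> = (\<Sum>l=1..n. A k l t) * z k t" by (simp add: sum_distrib_right)
  also have "\<dots> < 0" using rowsum[OF k(1) t] zneg by (simp add: mult_pos_neg)
  finally show False using L[OF k(1) t] 1 by simp
qed

lemma system_bound:
  fixes A :: "nat \<Rightarrow> nat \<Rightarrow> real \<Rightarrow> real" and z z' z'' \<psi> \<psi>' \<psi>'' :: "nat \<Rightarrow> real \<Rightarrow> real"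
  assumes eps: "\<And>i. i \<in> {1..n} \<Longrightarrow> 0 \<le> \<epsilon> i"
    and offdiag: "\<And>i k x. i \<in> {1..n} \<Longrightarrow> k \<in> {1..n} \<Longrightarrow> i \<noteq> k \<Longrightarrow> x \<in> {0<..<1} \<Longrightarrow> A i k x \<le> 0"
    and rowsum: "\<And>i x. i \<in> {1..n} \<Longrightarrow> x \<in> {0<..<1} \<Longrightarrow> 0 < (\<Sum>k=1..n. A i k x)"
    and contz: "\<And>i. i \<in> {1..n} \<Longrightarrow> continuous_on {0..1} (z i)"
    and z': "\<And>i x. i \<in> {1..n} \<Longrightarrow> x \<in> {0<..<1} \<Longrightarrow> (z i has_real_derivative z' i x) (at x)"
    and z'': "\<And>i x. i \<in> {1..n} \<Longrightarrow> x \<in> {0<..<1} \<Longrightarrow> (z' i has_real_derivative z'' i x) (at x)"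
    and contp: "\<And>i. i \<in> {1..n} \<Longrightarrow> continuous_on {0..1} (\<psi> i)"
    and p': "\<And>i x. i \<in> {1..n} \<Longrightarrow> x \<in> {0<..<1} \<Longrightarrow> (\<psi> i has_real_derivative \<psi>' i x) (at x)"
    and p'': "\<And>i x. i \<in> {1..n} \<Longrightarrow> x \<in> {0<..<1} \<Longrightarrow> (\<psi>' i has_real_derivative \<psi>'' i x) (at x)"
    and bdry: "\<And>i. i \<in> {1..n} \<Longrightarrow> \<bar>z i 0\<bar> \<le> \<psi> i 0" "\<And>i. i \<in> {1..n} \<Longrightarrow> \<bar>z i 1\<bar> \<le> \<psi> i 1"
    and L: "\<And>i x. i \<in> {1..n} \<Longrightarrow> x \<in> {0<..<1} \<Longrightarrow>
      \<bar>- \<epsilon> i * z'' i x + (\<Sum>k=1..n. A i k x * z k x)\<bar>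
        \<le> - \<epsilon> i * \<psi>'' i x + (\<Sum>k=1..n. A i k x * \<psi> k x)"
    and ix: "i \<in> {1..n}" "x \<in> {0..1}"
  shows "\<bar>z i x\<bar> \<le> \<psi> i x"
proof -
  have "0 \<le> \<psi> i x + c * z i x" if c: "c = 1 \<or> c = -1" for c :: real
  proof (rule system_comparison[OF _ _ _ _ _ _ _ _ _ ix, where z = "\<lambda>i x. \<psi> i x + c * z i x" and z' = "\<lambda>i x. \<psi>' i x + c * z' i x"
        and z'' = "\<lambda>i x. \<psi>'' i x + c * z'' i x" and \<epsilon> = \<epsilon> and A = A])
    fix i x assume ix: "i \<in> {1..n}" "x \<in> {0<..<(1::real)}"
    have "(\<Sum>k=1..n. A i k x * (\<psi> k x + c * z k x)) = (\<Sum>k=1..n. A i k x * \<psi> k x) + c * (\<Sum>k=1..n. A i k x * z k x)"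
      by (simp add: sum_distrib_left sum.distrib algebra_simps)
    then have "- \<epsilon> i * (\<psi>'' i x + c * z'' i x) + (\<Sum>k=1..n. A i k x * (\<psi> k x + c * z k x))
      = (- \<epsilon> i * \<psi>'' i x + (\<Sum>k=1..n. A i k x * \<psi> k x)) + c * (- \<epsilon> i * z'' i x + (\<Sum>k=1..n. A i k x * z k x))"
      by (simp add: algebra_simps)
    then show "0 \<le> - \<epsilon> i * (\<psi>'' i x + c * z'' i x) + (\<Sum>k=1..n. A i k x * (\<psi> k x + c * z k x))"
      using L[OF ix] c by (auto simp: abs_le_iff)
  next
    fix i assume i: "i \<in> {1..n}"
    show "0 \<le> \<psi> i 0 + c * z i 0" "0 \<le> \<psi> i 1 + c * z i 1" using bdry[OF i] c by auto
  next
    fix i x assume ix: "i \<in> {1..n}" "x \<in> {0<..<(1::real)}"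
    then show "0 < (\<Sum>k=1..n. A i k x)" by (rule rowsum)
  qed (auto intro!: continuous_intros derivative_eq_intros contz contp z' z'' p' p'' offdiag eps)
  from this[of 1] this[of "-1"] show ?thesis by (simp add: abs_le_iff)
qed

text \<open>The decay rate is chosen so that \<open>e * B'' = \<alpha> * B\<close>. The diffusion
  term of an equation with parameter at most \<open>e\<close> thus costs at most
  \<open>\<alpha> * B\<close>, which row sums above \<open>\<alpha>\<close> can pay for.\<close>

definition layer :: "real \<Rightarrow> real \<Rightarrow> real \<Rightarrow> real" where
  "layer \<alpha> e x = exp (- (x * sqrt (\<alpha> / e))) + exp (- ((1 - x) * sqrt (\<alpha> / e)))"

definition layer' :: "real \<Rightarrow> real \<Rightarrow> real \<Rightarrow> real" where
  "layer' \<alpha> e x = sqrt (\<alpha> / e) * (exp (- ((1 - x) * sqrt (\<alpha> / e))) - exp (- (x * sqrt (\<alpha> / e))))"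

lemma layer_nonneg: "0 \<le> layer \<alpha> e x"
  by (simp add: layer_def)

lemma layer_le_2:
  assumes "0 \<le> \<alpha>" "0 \<le> e" "x \<in> {0..1}"
  shows "layer \<alpha> e x \<le> 2"
proof -
  have "exp (- (x * sqrt (\<alpha> / e))) \<le> 1" "exp (- ((1 - x) * sqrt (\<alpha> / e))) \<le> 1"
    using assms by auto
  then show ?thesis unfolding layer_def by linarith
qed

lemma layer_endpoints: "1 \<le> layer \<alpha> e 0" "1 \<le> layer \<alpha> e 1"
  by (simp_all add: layer_def)

lemma layer_symmetric: "layer \<alpha> e (1 - x) = layer \<alpha> e x"
  by (simp add: layer_def)

lemma layer_mono:
  assumes "0 \<le> \<alpha>" "0 < e" "e \<le> e'" "x \<in> {0..1}"
  shows "layer \<alpha> e x \<le> layer \<alpha> e' x"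
proof -
  have "sqrt (\<alpha> / e') \<le> sqrt (\<alpha> / e)" using assms by (simp add: frac_le)
  then show ?thesis unfolding layer_def using assms(4)
    by (intro add_mono) (auto intro!: mult_left_mono)
qed

text \<open>A Harnack type inequality: a shift changes the exponent of either exponential by at most
  the shift times the decay rate. Shifts of order \<open>sqrt e\<close> therefore cost only a
  bounded factor.\<close>

lemma layer_shift_le:
  assumes "0 \<le> \<alpha>" "0 \<le> e"
  shows "layer \<alpha> e y \<le> exp (\<bar>y - x\<bar> * sqrt (\<alpha> / e)) * layer \<alpha> e x"
proof -
  let ?s = "sqrt (\<alpha> / e)"
  have s: "0 \<le> ?s" using assms by simp
  have 1: "- (y * ?s) \<le> \<bar>y - x\<bar> * ?s - x * ?s"
    using mult_right_mono[OF _ s, of "x - y" "\<bar>y - x\<bar>"] by (simp add: algebra_simps)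
  have 2: "- ((1 - y) * ?s) \<le> \<bar>y - x\<bar> * ?s - (1 - x) * ?s"
    using mult_right_mono[OF _ s, of "y - x" "\<bar>y - x\<bar>"] by (simp add: algebra_simps)
  show ?thesis unfolding layer_def distrib_left exp_add[symmetric]
    using 1 2 by (intro add_mono) simp_all
qed

lemma continuous_on_layer: "continuous_on S (layer \<alpha> e)"
  unfolding layer_def by (intro continuous_intros)

lemma has_derivative_layer: "(layer \<alpha> e has_real_derivative layer' \<alpha> e x) (at x)"
  unfolding layer_def layer'_def by (auto intro!: derivative_eq_intros simp: algebra_simps)

lemma has_derivative_layer':
  assumes "0 \<le> \<alpha>" "0 \<le> e"
  shows "(layer' \<alpha> e has_real_derivative \<alpha> / e * layer \<alpha> e x) (at x)"
proof -
  define s where "s = sqrt (\<alpha> / e)"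
  have s: "\<alpha> / e = s * s" using assms by (simp add: s_def)
  show ?thesis
    unfolding layer_def layer'_def s_def[symmetric]
    unfolding s
    by (auto intro!: derivative_eq_intros simp: algebra_simps)
qed

text \<open>Geometrically growing weights let the weight of one layer dominate the sum of the
  weights of all faster ones. The sum starts at 1 because layers are numbered from 1.\<close>

lemma sum_powers_le:
  fixes \<mu> :: real
  assumes "1 < \<mu>"
  shows "(\<mu> - 1) * (\<Sum>m=1..<i. \<mu> ^ m) \<le> \<mu> ^ i"
proof (induction i)
  case (Suc i)
  show ?case
  proof (cases "i = 0")
    case True
    then show ?thesis using assms by simp
  next
    case False
    then have "(\<Sum>m=1..<Suc i. \<mu> ^ m) = (\<Sum>m=1..<i. \<mu> ^ m) + \<mu> ^ i" by simp
    then have "(\<mu> - 1) * (\<Sum>m=1..<Suc i. \<mu> ^ m) \<le> \<mu> ^ i + (\<mu> - 1) * \<mu> ^ i"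
      using Suc by (simp add: distrib_left)
    then show ?thesis by (simp add: algebra_simps)
  qed
qed simp

section \<open>A barrier for coupled layers\<close>

definition ordered_params :: "nat \<Rightarrow> (nat \<Rightarrow> real) \<Rightarrow> bool" where
  "ordered_params n \<epsilon> \<longleftrightarrow>
     (\<forall>i\<in>{1..n}. 0 < \<epsilon> i \<and> \<epsilon> i \<le> 1) \<and> (\<forall>i\<in>{1..n}. \<forall>k\<in>{1..n}. i \<le> k \<longrightarrow> \<epsilon> i \<le> \<epsilon> k)"

text \<open>\<open>\<beta>\<close> is the slack between the row sums and \<open>\<alpha>\<close>.
  The part \<open>\<alpha>\<close> of a row sum is spent on the second derivative of a layer
  function, so that only \<open>\<beta>\<close> is left to dominate a source.\<close>

locale coupled_coefficients =
  fixes n :: nat and A :: "nat \<Rightarrow> nat \<Rightarrow> real \<Rightarrow> real" and \<alpha> \<beta> b :: real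
  assumes alpha: "0 < \<alpha>" and beta: "0 < \<beta>" and b: "0 \<le> b"
    and offdiag: "\<And>i k x. i \<in> {1..n} \<Longrightarrow> k \<in> {1..n} \<Longrightarrow> i \<noteq> k \<Longrightarrow> x \<in> {0..1} \<Longrightarrow> A i k x \<le> 0"
    and rowsum: "\<And>i x. i \<in> {1..n} \<Longrightarrow> x \<in> {0..1} \<Longrightarrow> \<alpha> + \<beta> \<le> (\<Sum>k=1..n. A i k x)"
    and diag: "\<And>i x. i \<in> {1..n} \<Longrightarrow> x \<in> {0..1} \<Longrightarrow> A i i x \<le> b"
begin

text \<open>Where a barrier coefficient is negative, its second derivative term yields the gain
  \<open>lam * \<alpha> = b + 1\<close> (times \<open>mu ^ m * w m\<close>), one more than the loss
  \<open>b\<close> that the off-diagonal entries can cause. The size of \<open>mu\<close> then keeps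
  the sum of all negative coefficients, also after multiplication by \<open>b\<close>, below half of
  what the layer of the component itself provides.\<close>

definition lam :: real where "lam = (b + 1) / \<alpha>"
definition mu :: real where "mu = 3 + 2 * lam + 2 * lam * b / \<beta>"
definition barrier_const :: real where "barrier_const = (1 + 1 / \<alpha> + 2 / \<beta>) * mu ^ n"

lemma lam_pos: "0 < lam" using alpha b by (simp add: lam_def)

lemma mu_ge_3: "3 \<le> mu" using alpha beta b lam_pos by (simp add: mu_def)

lemma barrier_const_pos: "0 < barrier_const"
  using mu_ge_3 alpha beta by (simp add: barrier_const_def add_pos_pos)

lemma lower_powers: "lam * b * (\<Sum>m=1..<i. mu ^ m) \<le> \<beta> / 2 * mu ^ i"
  "lam * (\<Sum>m=1..<i. mu ^ m) \<le> mu ^ i / 2"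
proof -
  let ?S = "\<Sum>m=1..<i. mu ^ m"
  have S0: "0 \<le> ?S" using mu_ge_3 by (intro sum_nonneg) simp
  have S: "(mu - 1) * ?S \<le> mu ^ i" using sum_powers_le mu_ge_3 by simp
  have "2 * lam * b / \<beta> * ?S \<le> (mu - 1) * ?S"
    using lam_pos by (intro mult_right_mono S0) (simp add: mu_def)
  then have "2 * lam * b / \<beta> * ?S \<le> mu ^ i" using S by linarith
  then show "lam * b * ?S \<le> \<beta> / 2 * mu ^ i" using beta by (simp add: field_simps)
  have "2 * lam * ?S \<le> (mu - 1) * ?S"
    using lam_pos b beta by (intro mult_right_mono S0) (simp add: mu_def)
  then show "lam * ?S \<le> mu ^ i / 2" using S by linarith
qed

text \<open>A fast exponential \<open>B m\<close> acts on a slower component \<open>i > m\<close> as a source that the positive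
  function \<open>B m\<close> cannot absorb, because \<open>\<epsilon> i * (B m)''\<close> is too large. Its coefficient is therefore
  taken negative there, and positivity is restored by the larger coefficient of \<open>B i\<close>.\<close>

definition barrier_coeff :: "(nat \<Rightarrow> real) \<Rightarrow> (nat \<Rightarrow> real) \<Rightarrow> nat \<Rightarrow> nat \<Rightarrow> real" where
  "barrier_coeff \<epsilon> w i m = (if i \<le> m then mu ^ m * w m else - (lam * mu ^ m * w m * \<epsilon> m / \<epsilon> i))"

definition barrier :: "(nat \<Rightarrow> real) \<Rightarrow> (nat \<Rightarrow> real) \<Rightarrow> nat \<Rightarrow> real \<Rightarrow> real" where
  "barrier \<epsilon> w i x = 1 + (\<Sum>m=1..n. barrier_coeff \<epsilon> w i m * layer \<alpha> (\<epsilon> m) x)"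

text \<open>Two choices of weights occur: \<open>w m = 1 / sqrt (\<epsilon> m)\<close> for the first
  and \<open>w m = 1 / \<epsilon> m\<close> for the second derivative. For both,
  \<open>w m * \<epsilon> m\<close> is nondecreasing in m, which is what makes the negative
  coefficients comparable with \<open>w i\<close>.\<close>

context
  fixes \<epsilon> w :: "nat \<Rightarrow> real"
  assumes params: "ordered_params n \<epsilon>"
    and w: "\<And>m. m \<in> {1..n} \<Longrightarrow> 1 \<le> w m"
    and w_eps: "\<And>i k. i \<in> {1..n} \<Longrightarrow> k \<in> {1..n} \<Longrightarrow> i \<le> k \<Longrightarrow> w i * \<epsilon> i \<le> w k * \<epsilon> k"
begin

lemma eps_pos: "i \<in> {1..n} \<Longrightarrow> 0 < \<epsilon> i"
  and eps_mono: "i \<in> {1..n} \<Longrightarrow> k \<in> {1..n} \<Longrightarrow> i \<le> k \<Longrightarrow> \<epsilon> i \<le> \<epsilon> k"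
  using params by (auto simp: ordered_params_def)

lemma sum_split_at: "i \<in> {1..n} \<Longrightarrow>
    (\<Sum>m=1..n. h m) = (\<Sum>m=1..<i. h m) + h i + (\<Sum>m=Suc i..n. h m)" for h :: "nat \<Rightarrow> real"
proof -
  assume i: "i \<in> {1..n}"
  have "{1..n} = {1..<i} \<union> {i..n}" using i by auto
  then have "(\<Sum>m=1..n. h m) = (\<Sum>m=1..<i. h m) + (\<Sum>m=i..n. h m)"
    by (simp add: sum.union_disjoint ivl_disj_int)
  also have "(\<Sum>m=i..n. h m) = h i + (\<Sum>m=Suc i..n. h m)" using i by (intro sum.atLeast_Suc_atMost) auto
  finally show ?thesis by simp
qed

lemma coeff_fast:
  assumes m: "m \<in> {1..n}" and i: "i \<in> {1..n}" and im: "m < i"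
  shows "lam * mu ^ m * w m * \<epsilon> m / \<epsilon> i \<le> lam * mu ^ m * w i"
proof -
  have "w m * \<epsilon> m / \<epsilon> i \<le> w i" using w_eps[OF m i] im eps_pos[OF i] by (simp add: field_simps)
  then have "lam * mu ^ m * (w m * \<epsilon> m / \<epsilon> i) \<le> lam * mu ^ m * w i"
    using lam_pos mu_ge_3 by (intro mult_left_mono) auto
  then show ?thesis by (simp add: mult.assoc)
qed

text \<open>For m < i, \<open>B m \<le> B i\<close> and the choice of \<open>mu\<close> bound all
  negative terms by half of \<open>mu ^ i * w i * B i\<close>; the other half still exceeds
  \<open>w i * B i\<close> because \<open>mu ^ i \<ge> 2\<close>. The terms with m > i are
  nonnegative. The estimate is needed at the end points, where \<open>B i \<ge> 1\<close> and the
  derivatives are as large as \<open>w i\<close>.\<close>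

lemma barrier_lower:
  assumes i: "i \<in> {1..n}" and x: "x \<in> {0..1}"
  shows "w i * layer \<alpha> (\<epsilon> i) x \<le> barrier \<epsilon> w i x"
proof -
  let ?B = "\<lambda>m. layer \<alpha> (\<epsilon> m) x"
  have nn: "0 \<le> ?B m" for m by (rule layer_nonneg)
  have "- (lam * mu ^ m * w i * ?B i) \<le> barrier_coeff \<epsilon> w i m * ?B m" if m: "m \<in> {1..<i}" for m
  proof -
    have m': "m \<in> {1..n}" using m i by auto
    have "lam * mu ^ m * w m * \<epsilon> m / \<epsilon> i * ?B m \<le> lam * mu ^ m * w i * ?B i"
      using coeff_fast[OF m' i] m layer_mono[of \<alpha> "\<epsilon> m" "\<epsilon> i" x] alpha eps_pos[OF m'] eps_mono[OF m' i] x w[OF i]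
        lam_pos mu_ge_3 nn by (intro mult_mono) auto
    then show ?thesis using m by (simp add: barrier_coeff_def)
  qed
  then have "(\<Sum>m=1..<i. - (lam * mu ^ m * w i * ?B i)) \<le> (\<Sum>m=1..<i. barrier_coeff \<epsilon> w i m * ?B m)"
    by (rule sum_mono)
  moreover have "(\<Sum>m=1..<i. - (lam * mu ^ m * w i * ?B i)) = - (lam * (\<Sum>m=1..<i. mu ^ m) * (w i * ?B i))"
    by (simp add: sum_negf sum_distrib_left sum_distrib_right mult.assoc)
  moreover have "lam * (\<Sum>m=1..<i. mu ^ m) * (w i * ?B i) \<le> mu ^ i * (w i * ?B i) / 2"
    using mult_right_mono[OF lower_powers(2), of "w i * ?B i" i] w[OF i] nn by simp
  moreover have "0 \<le> (\<Sum>m=Suc i..n. barrier_coeff \<epsilon> w i m * ?B m)"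
  proof (rule sum_nonneg)
    fix m assume m: "m \<in> {Suc i..n}"
    then have "m \<in> {1..n}" by auto
    from w[OF this] show "0 \<le> barrier_coeff \<epsilon> w i m * ?B m"
      using m mu_ge_3 nn by (simp add: barrier_coeff_def)
  qed
  moreover have "barrier_coeff \<epsilon> w i i * ?B i = mu ^ i * (w i * ?B i)" by (simp add: barrier_coeff_def)
  ultimately have "mu ^ i * (w i * ?B i) / 2 \<le> barrier \<epsilon> w i x - 1"
    unfolding barrier_def sum_split_at[OF i] by linarith
  moreover have "2 \<le> mu ^ i"
  proof -
    have "2 \<le> mu" using mu_ge_3 by simp
    also have "mu \<le> mu ^ i" using mu_ge_3 i by (intro self_le_power) auto
    finally show ?thesis .
  qed
  then have "1 * (w i * ?B i) \<le> mu ^ i / 2 * (w i * ?B i)"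
    using w[OF i] nn by (intro mult_right_mono) auto
  ultimately show ?thesis by linarith
qed

lemma barrier_upper:
  assumes i: "i \<in> {1..n}"
  shows "barrier \<epsilon> w i x \<le> mu ^ n * (1 + (\<Sum>m=i..n. w m * layer \<alpha> (\<epsilon> m) x))"
proof -
  let ?B = "\<lambda>m. layer \<alpha> (\<epsilon> m) x"
  have nn: "0 \<le> ?B m" for m by (rule layer_nonneg)
  have "barrier_coeff \<epsilon> w i m * ?B m \<le> (if i \<le> m then mu ^ n * (w m * ?B m) else 0)"
    if m: "m \<in> {1..n}" for m
  proof (cases "i \<le> m")
    case True
    have "mu ^ m * (w m * ?B m) \<le> mu ^ n * (w m * ?B m)"
      using mu_ge_3 m w[OF m] nn by (intro mult_right_mono power_increasing) auto
    then show ?thesis using True by (simp add: barrier_coeff_def)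
  next
    case False
    have "0 \<le> lam * mu ^ m * w m * \<epsilon> m / \<epsilon> i * ?B m"
      using w[OF m] eps_pos[OF m] eps_pos[OF i] nn lam_pos mu_ge_3 by simp
    then show ?thesis using False by (simp add: barrier_coeff_def)
  qed
  then have "(\<Sum>m=1..n. barrier_coeff \<epsilon> w i m * ?B m) \<le> (\<Sum>m=1..n. if i \<le> m then mu ^ n * (w m * ?B m) else 0)"
    by (rule sum_mono)
  also have "\<dots> = (\<Sum>m\<in>{m\<in>{1..n}. i \<le> m}. mu ^ n * (w m * ?B m))" by (simp only: sum.inter_filter finite_atLeastAtMost)
  also have "{m\<in>{1..n}. i \<le> m} = {i..n}" using i by auto
  also have "(\<Sum>m\<in>{i..n}. mu ^ n * (w m * ?B m)) = mu ^ n * (\<Sum>m=i..n. w m * ?B m)"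
    by (simp add: sum_distrib_left)
  finally have "(\<Sum>m=1..n. barrier_coeff \<epsilon> w i m * ?B m) \<le> mu ^ n * (\<Sum>m=i..n. w m * ?B m)" .
  moreover have "1 \<le> mu ^ n" using mu_ge_3 by (intro one_le_power) simp
  ultimately show ?thesis unfolding barrier_def distrib_left by linarith
qed

text \<open>Replacing every coefficient of column m by \<open>mu ^ m * w m\<close> only lowers the
  sum: the coefficients that differ belong to rows k > m, are negative and meet entries
  \<open>A i k x \<le> 0\<close>. What remains is a row sum, at least
  \<open>\<alpha> + \<beta>\<close>, and since \<open>\<epsilon> i \<le> \<epsilon> m\<close> the
  second derivative consumes at most \<open>\<alpha>\<close>.\<close>

lemma barrier_supersolution_coeff_slow:
  assumes i: "i \<in> {1..n}" and m: "m \<in> {1..n}" and im: "i \<le> m" and x: "x \<in> {0..1}"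
  shows "\<beta> * mu ^ m * w m \<le> (\<Sum>k=1..n. A i k x * barrier_coeff \<epsilon> w k m) - \<epsilon> i * barrier_coeff \<epsilon> w i m * (\<alpha> / \<epsilon> m)"
proof -
  have wm: "0 \<le> mu ^ m * w m" using w[OF m] mu_ge_3 by simp
  have "(\<Sum>k=1..n. A i k x * (mu ^ m * w m)) \<le> (\<Sum>k=1..n. A i k x * barrier_coeff \<epsilon> w k m)"
  proof (rule sum_mono)
    fix k assume k: "k \<in> {1..n}"
    show "A i k x * (mu ^ m * w m) \<le> A i k x * barrier_coeff \<epsilon> w k m"
    proof (cases "k \<le> m")
      case False
      have "A i k x \<le> 0" using offdiag[OF i k _ x] False im by auto
      moreover have "barrier_coeff \<epsilon> w k m \<le> 0"
        using False w[OF m] eps_pos[OF m] eps_pos[OF k] lam_pos mu_ge_3 by (simp add: barrier_coeff_def)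
      ultimately show ?thesis using wm by (intro mult_left_mono_neg) auto
    qed (simp add: barrier_coeff_def)
  qed
  moreover have "(\<Sum>k=1..n. A i k x * (mu ^ m * w m)) = (\<Sum>k=1..n. A i k x) * (mu ^ m * w m)"
    by (simp add: sum_distrib_right)
  moreover have "(\<alpha> + \<beta>) * (mu ^ m * w m) \<le> (\<Sum>k=1..n. A i k x) * (mu ^ m * w m)"
    using rowsum[OF i x] wm by (intro mult_right_mono) auto
  moreover have "\<epsilon> i * barrier_coeff \<epsilon> w i m * (\<alpha> / \<epsilon> m) \<le> \<alpha> * (mu ^ m * w m)"
  proof -
    have "\<epsilon> i / \<epsilon> m \<le> 1" using eps_mono[OF i m im] eps_pos[OF m] by simp
    then have "\<epsilon> i / \<epsilon> m * (\<alpha> * (mu ^ m * w m)) \<le> 1 * (\<alpha> * (mu ^ m * w m))"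
      using wm alpha by (intro mult_right_mono) auto
    then show ?thesis using im by (simp add: barrier_coeff_def mult_ac)
  qed
  ultimately show ?thesis by (simp add: algebra_simps)
qed

text \<open>For a layer faster than the component, the negative coefficient turns the large second
  derivative into a gain of \<open>b + 1\<close> units of \<open>mu ^ m * w m\<close>. The
  off-diagonal entries lose at most \<open>b\<close> of them. The diagonal entry times the negative
  coefficient is the deficit on the left, to be paid by the layer of component i itself.\<close>

lemma barrier_supersolution_coeff_fast:
  assumes i: "i \<in> {1..n}" and m: "m \<in> {1..n}" and im: "m < i" and x: "x \<in> {0..1}"
  shows "mu ^ m * w m - lam * b * mu ^ m * w i
     \<le> (\<Sum>k=1..n. A i k x * barrier_coeff \<epsilon> w k m) - \<epsilon> i * barrier_coeff \<epsilon> w i m * (\<alpha> / \<epsilon> m)"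
proof -
  let ?c = "mu ^ m * w m"
  have wm: "0 \<le> ?c" using w[OF m] mu_ge_3 by simp
  have ei: "0 < \<epsilon> i" "0 < \<epsilon> m" using eps_pos i m by auto
  have rest: "(\<Sum>k\<in>{1..n}-{i}. A i k x * ?c) \<le> (\<Sum>k\<in>{1..n}-{i}. A i k x * barrier_coeff \<epsilon> w k m)"
  proof (rule sum_mono)
    fix k assume k: "k \<in> {1..n}-{i}"
    then have Ak: "A i k x \<le> 0" using offdiag[OF i _ _ x] by auto
    have "barrier_coeff \<epsilon> w k m \<le> ?c"
    proof (cases "k \<le> m")
      case False
      then have "barrier_coeff \<epsilon> w k m \<le> 0"
        using k w[OF m] eps_pos[OF m] eps_pos[of k] lam_pos mu_ge_3 by (simp add: barrier_coeff_def)
      then show ?thesis using wm by simp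
    qed (simp add: barrier_coeff_def)
    then show "A i k x * ?c \<le> A i k x * barrier_coeff \<epsilon> w k m" using Ak by (intro mult_left_mono_neg)
  qed
  have "(\<Sum>k=1..n. A i k x) = A i i x + (\<Sum>k\<in>{1..n}-{i}. A i k x)" using i by (intro sum.remove) auto
  \<comment> \<open>The row sum is positive and the diagonal entry at most \<open>b\<close>, so the
    off-diagonal part is at least \<open>- b\<close>.\<close>
  then have off: "- b \<le> (\<Sum>k\<in>{1..n}-{i}. A i k x)"
    using rowsum[OF i x] diag[OF i x] alpha beta by linarith
  have "- b * ?c \<le> (\<Sum>k\<in>{1..n}-{i}. A i k x) * ?c" using mult_right_mono[OF off wm] .
  also have "\<dots> = (\<Sum>k\<in>{1..n}-{i}. A i k x * ?c)" by (simp add: sum_distrib_right)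
  finally have 1: "- b * ?c \<le> (\<Sum>k\<in>{1..n}-{i}. A i k x * barrier_coeff \<epsilon> w k m)" using rest by linarith
  have bi: "barrier_coeff \<epsilon> w i m = - (lam * ?c * \<epsilon> m / \<epsilon> i)" using im by (simp add: barrier_coeff_def mult_ac)
  have 2: "- (lam * b * mu ^ m * w i) \<le> A i i x * barrier_coeff \<epsilon> w i m"
  proof -
    have p: "0 \<le> lam * ?c * \<epsilon> m / \<epsilon> i" using ei wm lam_pos by simp
    have "A i i x * (lam * ?c * \<epsilon> m / \<epsilon> i) \<le> b * (lam * ?c * \<epsilon> m / \<epsilon> i)"
      using diag[OF i x] p by (rule mult_right_mono)
    also have "\<dots> \<le> b * (lam * mu ^ m * w i)"
      using coeff_fast[OF m i im] b by (intro mult_left_mono) (auto simp: mult_ac)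
    finally show ?thesis unfolding bi by (simp add: mult_ac)
  qed
  have 3: "\<epsilon> i * barrier_coeff \<epsilon> w i m * (\<alpha> / \<epsilon> m) = - (b + 1) * ?c"
    unfolding bi lam_def using ei alpha by (simp add: field_simps)
  have "(\<Sum>k=1..n. A i k x * barrier_coeff \<epsilon> w k m)
      = A i i x * barrier_coeff \<epsilon> w i m + (\<Sum>k\<in>{1..n}-{i}. A i k x * barrier_coeff \<epsilon> w k m)"
    using i by (intro sum.remove) auto
  then show ?thesis using 1 2 unfolding 3 by (simp add: algebra_simps)
qed

text \<open>With the terms sorted by layers, column m contributes \<open>Q m * B m\<close>. A slow
  column has the surplus \<open>\<beta> * mu ^ m * w m\<close>: one half of it covers the term with
  \<open>\<kappa>\<close>, the other half of column i absorbs the deficits of all fast columns,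
  since \<open>B m \<le> B i\<close> there. For the fast columns \<open>\<kappa> \<le> 1\<close>
  suffices because of their gain \<open>mu ^ m * w m\<close>. The constant 1 in the barrier
  contributes the row sum, hence the \<open>\<alpha>\<close> on the left.\<close>

lemma barrier_supersolution:
  assumes i: "i \<in> {1..n}" and x: "x \<in> {0..1}" and \<kappa>: "\<kappa> \<le> 1" "\<kappa> \<le> \<beta> / 2" "0 \<le> \<kappa>"
  shows "\<alpha> + \<kappa> * (\<Sum>m=1..n. w m * layer \<alpha> (\<epsilon> m) x)
    \<le> - \<epsilon> i * (\<Sum>m=1..n. barrier_coeff \<epsilon> w i m * (\<alpha> / \<epsilon> m * layer \<alpha> (\<epsilon> m) x))
       + (\<Sum>k=1..n. A i k x * barrier \<epsilon> w k x)"
proof -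
  let ?B = "\<lambda>m. layer \<alpha> (\<epsilon> m) x"
  define Q where "Q m = (\<Sum>k=1..n. A i k x * barrier_coeff \<epsilon> w k m) - \<epsilon> i * barrier_coeff \<epsilon> w i m * (\<alpha> / \<epsilon> m)" for m
  have nn: "0 \<le> ?B m" for m by (rule layer_nonneg)
  have wi: "0 \<le> w i * ?B i" using w[OF i] nn by simp
  have mu1: "1 \<le> mu ^ m" for m using mu_ge_3 by (intro one_le_power) simp
  have fast: "- (lam * b * mu ^ m * (w i * ?B i)) \<le> (Q m - \<kappa> * w m) * ?B m" if m: "m \<in> {1..<i}" for m
  proof -
    have m': "m \<in> {1..n}" using m i by auto
    have "\<kappa> * w m \<le> mu ^ m * w m" using \<kappa> mu1[of m] w[OF m'] by (intro mult_right_mono) auto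
    then have "- (lam * b * mu ^ m * w i) \<le> Q m - \<kappa> * w m"
      using barrier_supersolution_coeff_fast[OF i m' _ x] m unfolding Q_def by auto
    then have 1: "- (lam * b * mu ^ m * w i) * ?B m \<le> (Q m - \<kappa> * w m) * ?B m"
      using nn by (intro mult_right_mono)
    have "lam * b * mu ^ m * w i * ?B m \<le> lam * b * mu ^ m * w i * ?B i"
      using m layer_mono[of \<alpha> "\<epsilon> m" "\<epsilon> i" x] alpha eps_pos[OF m'] eps_mono[OF m' i] x w[OF i]
        lam_pos mu_ge_3 b by (intro mult_left_mono) auto
    then show ?thesis using 1 by (simp add: mult.assoc)
  qed
  have slow: "\<beta> / 2 * mu ^ m * (w m * ?B m) \<le> (Q m - \<kappa> * w m) * ?B m" if m: "m \<in> {i..n}" for m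
  proof -
    have m': "m \<in> {1..n}" using m i by auto
    have "\<kappa> * w m \<le> \<beta> / 2 * mu ^ m * w m"
    proof (rule mult_right_mono)
      have "\<beta> / 2 * 1 \<le> \<beta> / 2 * mu ^ m" using beta mu1 by (intro mult_left_mono) auto
      then show "\<kappa> \<le> \<beta> / 2 * mu ^ m" using \<kappa> by simp
    qed (use w[OF m'] in simp)
    moreover have "\<beta> * mu ^ m * w m \<le> Q m"
      using barrier_supersolution_coeff_slow[OF i m' _ x] m unfolding Q_def by auto
    ultimately have "\<beta> / 2 * mu ^ m * w m \<le> Q m - \<kappa> * w m" by simp
    then have "\<beta> / 2 * mu ^ m * w m * ?B m \<le> (Q m - \<kappa> * w m) * ?B m"
      using nn by (intro mult_right_mono)
    then show ?thesis by (simp add: mult.assoc)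
  qed
  have "(\<Sum>m=1..<i. - (lam * b * mu ^ m * (w i * ?B i))) \<le> (\<Sum>m=1..<i. (Q m - \<kappa> * w m) * ?B m)"
    using fast by (rule sum_mono)
  moreover have "(\<Sum>m=1..<i. - (lam * b * mu ^ m * (w i * ?B i))) = - (lam * b * (\<Sum>m=1..<i. mu ^ m) * (w i * ?B i))"
    by (simp add: sum_negf sum_distrib_left sum_distrib_right mult.assoc)
  moreover have "lam * b * (\<Sum>m=1..<i. mu ^ m) * (w i * ?B i) \<le> \<beta> / 2 * mu ^ i * (w i * ?B i)"
    using lower_powers(1) wi by (rule mult_right_mono)
  moreover have "\<beta> / 2 * mu ^ i * (w i * ?B i) \<le> (Q i - \<kappa> * w i) * ?B i" using slow[of i] i by simp
  moreover have "0 \<le> (\<Sum>m=Suc i..n. (Q m - \<kappa> * w m) * ?B m)"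
  proof (rule sum_nonneg)
    fix m assume m: "m \<in> {Suc i..n}"
    have "0 \<le> \<beta> / 2 * mu ^ m * (w m * ?B m)" using beta mu_ge_3 w[of m] m nn[of m] by simp
    then show "0 \<le> (Q m - \<kappa> * w m) * ?B m" using slow[of m] m by auto
  qed
  ultimately have "0 \<le> (\<Sum>m=1..n. (Q m - \<kappa> * w m) * ?B m)"
    unfolding sum_split_at[OF i] by linarith
  then have 1: "\<kappa> * (\<Sum>m=1..n. w m * ?B m) \<le> (\<Sum>m=1..n. Q m * ?B m)"
    by (simp add: left_diff_distrib sum_subtractf sum_distrib_left mult.assoc)
  have "(\<Sum>k=1..n. A i k x * barrier \<epsilon> w k x)
      = (\<Sum>k=1..n. A i k x) + (\<Sum>k=1..n. \<Sum>m=1..n. A i k x * barrier_coeff \<epsilon> w k m * ?B m)"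
    by (simp add: barrier_def distrib_left sum.distrib sum_distrib_left mult.assoc)
  also have "(\<Sum>k=1..n. \<Sum>m=1..n. A i k x * barrier_coeff \<epsilon> w k m * ?B m)
      = (\<Sum>m=1..n. (\<Sum>k=1..n. A i k x * barrier_coeff \<epsilon> w k m) * ?B m)"
    by (subst sum.swap) (simp add: sum_distrib_right)
  finally have "- \<epsilon> i * (\<Sum>m=1..n. barrier_coeff \<epsilon> w i m * (\<alpha> / \<epsilon> m * ?B m)) + (\<Sum>k=1..n. A i k x * barrier \<epsilon> w k x)
      = (\<Sum>k=1..n. A i k x) + (\<Sum>m=1..n. Q m * ?B m)"
    by (simp add: Q_def left_diff_distrib sum_subtractf sum_distrib_left sum_negf mult.assoc)
  then show ?thesis using 1 rowsum[OF i x] beta by linarith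
qed

text \<open>The source may contain every layer, yet component i inherits only those with m \<ge> i.
  The comparison function is a multiple of \<open>barrier\<close>, which dominates the data by
  \<open>barrier_lower\<close> and \<open>barrier_supersolution\<close> and is simplified by
  \<open>barrier_upper\<close>.\<close>

lemma weighted_bound:
  assumes M: "0 \<le> M"
    and contz: "\<And>i. i \<in> {1..n} \<Longrightarrow> continuous_on {0..1} (z i)"
    and z': "\<And>i x. i \<in> {1..n} \<Longrightarrow> x \<in> {0<..<1} \<Longrightarrow> (z i has_real_derivative z' i x) (at x)"
    and z'': "\<And>i x. i \<in> {1..n} \<Longrightarrow> x \<in> {0<..<1} \<Longrightarrow> (z' i has_real_derivative z'' i x) (at x)"
    and bdry: "\<And>i. i \<in> {1..n} \<Longrightarrow> \<bar>z i 0\<bar> \<le> M * w i" "\<And>i. i \<in> {1..n} \<Longrightarrow> \<bar>z i 1\<bar> \<le> M * w i"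
    and L: "\<And>i x. i \<in> {1..n} \<Longrightarrow> x \<in> {0<..<1} \<Longrightarrow>
      \<bar>- \<epsilon> i * z'' i x + (\<Sum>k=1..n. A i k x * z k x)\<bar> \<le> M * (1 + (\<Sum>m=1..n. w m * layer \<alpha> (\<epsilon> m) x))"
    and ix: "i \<in> {1..n}" "x \<in> {0..1}"
  shows "\<bar>z i x\<bar> \<le> barrier_const * M * (1 + (\<Sum>m=i..n. w m * layer \<alpha> (\<epsilon> m) x))"
proof -
  \<comment> \<open>The summand 1 covers the boundary values, \<open>1 / \<alpha>\<close> the
    constant part of the source, and 1 together with \<open>2 / \<beta>\<close> makes
    \<open>D * \<kappa> \<ge> 1\<close> for the layer part.\<close>
  define D where "D = 1 + 1 / \<alpha> + 2 / \<beta>"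
  have D: "1 \<le> D" "1 \<le> D * \<alpha>" "2 / \<beta> \<le> D"
    using alpha beta by (auto simp: D_def field_simps)
  have "\<bar>z i x\<bar> \<le> D * M * barrier \<epsilon> w i x"
  proof (rule system_bound[where \<psi> = "\<lambda>i x. D * M * barrier \<epsilon> w i x" and n = n and A = A and \<epsilon> = \<epsilon> and z = z
        and z' = z' and z'' = z''
        and \<psi>' = "\<lambda>i x. D * M * (\<Sum>m=1..n. barrier_coeff \<epsilon> w i m * layer' \<alpha> (\<epsilon> m) x)"
        and \<psi>'' = "\<lambda>i x. D * M * (\<Sum>m=1..n. barrier_coeff \<epsilon> w i m * (\<alpha> / \<epsilon> m * layer \<alpha> (\<epsilon> m) x))"])
    fix i x assume i: "i \<in> {1..n}" and x: "x \<in> {0<..<(1::real)}"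
    show "A i k x \<le> 0" if "k \<in> {1..n}" "i \<noteq> k" for k using offdiag i that x by simp
    show "0 < (\<Sum>k=1..n. A i k x)" using rowsum[OF i, of x] x alpha beta by auto
    show "(z i has_real_derivative z' i x) (at x)" "(z' i has_real_derivative z'' i x) (at x)"
      using z' z'' i x by auto
    show "((\<lambda>x. D * M * barrier \<epsilon> w i x) has_real_derivative
        D * M * (\<Sum>m=1..n. barrier_coeff \<epsilon> w i m * layer' \<alpha> (\<epsilon> m) x)) (at x)"
      unfolding barrier_def
      by (auto intro!: derivative_eq_intros has_derivative_layer sum.cong simp: mult_ac)
    show "((\<lambda>x. D * M * (\<Sum>m=1..n. barrier_coeff \<epsilon> w i m * layer' \<alpha> (\<epsilon> m) x)) has_real_derivative
        D * M * (\<Sum>m=1..n. barrier_coeff \<epsilon> w i m * (\<alpha> / \<epsilon> m * layer \<alpha> (\<epsilon> m) x))) (at x)"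
    proof (rule DERIV_cmult, rule DERIV_sum, rule DERIV_cmult, rule has_derivative_layer')
      show "0 \<le> \<alpha>" using alpha by simp
      show "0 \<le> \<epsilon> m" if "m \<in> {1..n}" for m using eps_pos[OF that] by simp
    qed
    define \<kappa> where "\<kappa> = min 1 (\<beta> / 2)"
    define S where "S = (\<Sum>m=1..n. w m * layer \<alpha> (\<epsilon> m) x)"
    have S: "0 \<le> S" unfolding S_def
    proof (intro sum_nonneg mult_nonneg_nonneg layer_nonneg)
      show "0 \<le> w m" if "m \<in> {1..n}" for m using w[OF that] by simp
    qed
    have "1 \<le> D * \<kappa>" using D beta by (auto simp: \<kappa>_def min_def field_simps)
    then have "1 * S \<le> D * \<kappa> * S" using S by (intro mult_right_mono)
    then have "1 + S \<le> D * (\<alpha> + \<kappa> * S)" using D(2) by (simp add: algebra_simps)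
    also have "\<dots> \<le> D * (- \<epsilon> i * (\<Sum>m=1..n. barrier_coeff \<epsilon> w i m * (\<alpha> / \<epsilon> m * layer \<alpha> (\<epsilon> m) x))
       + (\<Sum>k=1..n. A i k x * barrier \<epsilon> w k x))"
      unfolding S_def using i x D(1) beta
      by (intro mult_left_mono barrier_supersolution) (auto simp: \<kappa>_def)
    finally have "M * (1 + S) \<le> M * (D * (- \<epsilon> i * (\<Sum>m=1..n. barrier_coeff \<epsilon> w i m * (\<alpha> / \<epsilon> m * layer \<alpha> (\<epsilon> m) x))
       + (\<Sum>k=1..n. A i k x * barrier \<epsilon> w k x)))" using M by (intro mult_left_mono)
    also have "\<dots> = - \<epsilon> i * (D * M * (\<Sum>m=1..n. barrier_coeff \<epsilon> w i m * (\<alpha> / \<epsilon> m * layer \<alpha> (\<epsilon> m) x)))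
       + (\<Sum>k=1..n. A i k x * (D * M * barrier \<epsilon> w k x))"
      by (simp add: sum_distrib_left algebra_simps)
    finally show "\<bar>- \<epsilon> i * z'' i x + (\<Sum>k=1..n. A i k x * z k x)\<bar>
      \<le> - \<epsilon> i * (D * M * (\<Sum>m=1..n. barrier_coeff \<epsilon> w i m * (\<alpha> / \<epsilon> m * layer \<alpha> (\<epsilon> m) x)))
       + (\<Sum>k=1..n. A i k x * (D * M * barrier \<epsilon> w k x))"
      using L[OF i x] unfolding S_def by linarith
  next
    fix i assume i: "i \<in> {1..n}"
    show "0 \<le> \<epsilon> i" using eps_pos[OF i] by simp
    show "continuous_on {0..1} (\<lambda>x. D * M * barrier \<epsilon> w i x)"
      unfolding barrier_def by (intro continuous_intros continuous_on_layer)
    have end': "M * w i \<le> D * M * barrier \<epsilon> w i y" if y: "y = 0 \<or> y = 1" for y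
    proof -
      have "w i * 1 \<le> w i * layer \<alpha> (\<epsilon> i) y" using y layer_endpoints w[OF i] by (intro mult_left_mono) auto
      also have "\<dots> \<le> barrier \<epsilon> w i y" using y by (intro barrier_lower i) auto
      finally have wb: "w i \<le> barrier \<epsilon> w i y" by simp
      then have "M * w i \<le> M * barrier \<epsilon> w i y" using M by (intro mult_left_mono)
      moreover have "1 * (M * barrier \<epsilon> w i y) \<le> D * (M * barrier \<epsilon> w i y)"
        using D(1) M wb w[OF i] by (intro mult_right_mono) auto
      ultimately show ?thesis by (simp add: mult.assoc)
    qed
    show "\<bar>z i 0\<bar> \<le> D * M * barrier \<epsilon> w i 0" "\<bar>z i 1\<bar> \<le> D * M * barrier \<epsilon> w i 1"
      using end'[of 0] end'[of 1] bdry[OF i] by auto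
  qed (use contz ix in auto)
  also have "\<dots> \<le> D * M * (mu ^ n * (1 + (\<Sum>m=i..n. w m * layer \<alpha> (\<epsilon> m) x)))"
    using M D(1) by (intro mult_left_mono barrier_upper ix) auto
  also have "\<dots> = barrier_const * M * (1 + (\<Sum>m=i..n. w m * layer \<alpha> (\<epsilon> m) x))"
    by (simp add: barrier_const_def D_def mult_ac)
  finally show ?thesis .
qed

end

end

section \<open>Interpolation of derivatives\<close>

text \<open>Both \<open>R - g\<close> and \<open>R + g\<close> are nondecreasing. Unlike the mean
  value theorem with a constant bound, this integrates a bound that varies strongly over the
  interval, as layer functions do.\<close>

lemma abs_diff_le_of_deriv_le:
  fixes g g' R R' :: "real \<Rightarrow> real"
  assumes "x \<le> y"
    and g: "\<And>t. x \<le> t \<Longrightarrow> t \<le> y \<Longrightarrow> (g has_real_derivative g' t) (at t)"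
    and R: "\<And>t. x \<le> t \<Longrightarrow> t \<le> y \<Longrightarrow> (R has_real_derivative R' t) (at t)"
    and le: "\<And>t. x \<le> t \<Longrightarrow> t \<le> y \<Longrightarrow> \<bar>g' t\<bar> \<le> R' t"
  shows "\<bar>g y - g x\<bar> \<le> R y - R x"
proof -
  have "R x - g x \<le> R y - g y"
  proof (rule DERIV_nonneg_imp_nondecreasing[OF \<open>x \<le> y\<close>])
    fix t assume t: "x \<le> t" "t \<le> y"
    have "((\<lambda>t. R t - g t) has_real_derivative R' t - g' t) (at t)" using g R t by (intro DERIV_diff) auto
    moreover have "0 \<le> R' t - g' t" using le[OF t] by auto
    ultimately show "\<exists>d. ((\<lambda>t. R t - g t) has_real_derivative d) (at t) \<and> 0 \<le> d" by blast
  qed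
  moreover have "R x + g x \<le> R y + g y"
  proof (rule DERIV_nonneg_imp_nondecreasing[OF \<open>x \<le> y\<close>])
    fix t assume t: "x \<le> t" "t \<le> y"
    have "((\<lambda>t. R t + g t) has_real_derivative R' t + g' t) (at t)" using g R t by (intro DERIV_add) auto
    moreover have "0 \<le> R' t + g' t" using le[OF t] by auto
    ultimately show "\<exists>d. ((\<lambda>t. R t + g t) has_real_derivative d) (at t) \<and> 0 \<le> d" by blast
  qed
  ultimately show ?thesis by (simp add: abs_le_iff)
qed

lemma exp_minus_le_inverse_square:
  assumes "0 < (t::real)"
  shows "exp (- t) \<le> 2 / t\<^sup>2"
proof -
  have "t\<^sup>2 / 2 \<le> exp t" using exp_lower_Taylor_quadratic[of t] assms by simp
  then have "inverse (exp t) \<le> inverse (t\<^sup>2 / 2)" using assms by (intro le_imp_inverse_le) auto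
  then show ?thesis by (simp add: exp_minus)
qed

text \<open>Of the four exponentials two have a favourable sign. The near one at \<open>x\<close> is
  bounded by the layer itself. The far one has distance at least 1/4 from its end point, so that it
  is at most \<open>32 / s\<^sup>2\<close>; after division by \<open>\<alpha>\<close> and
  multiplication by \<open>s\<close> a term of order \<open>sqrt e\<close> is left.\<close>

lemma layer'_diff_le:
  assumes "0 < \<alpha>" "0 < e" "e \<le> e'" "0 < x" "x \<le> \<xi>" "\<xi> \<le> 3 / 4"
  shows "(layer' \<alpha> e \<xi> - layer' \<alpha> e x) / \<alpha> \<le> 1 / sqrt \<alpha> * (layer \<alpha> e x / sqrt e) + 32 / (\<alpha> * sqrt \<alpha>) * sqrt e'"
proof -
  define s where "s = sqrt (\<alpha> / e)"
  have s: "0 < s" using assms by (simp add: s_def)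
  have s2: "s / \<alpha> = 1 / (sqrt \<alpha> * sqrt e)" "1 / s = sqrt e / sqrt \<alpha>"
    using assms by (auto simp: s_def real_sqrt_divide field_simps)
  have r1: "exp (- ((1 - \<xi>) * s)) \<le> exp (- (s / 4))" using assms s by simp
  have r2: "exp (- (s / 4)) \<le> 32 / s\<^sup>2" using exp_minus_le_inverse_square[of "s / 4"] s by (simp add: power_divide)
  have "layer' \<alpha> e \<xi> - layer' \<alpha> e x
      = s * (exp (- ((1 - \<xi>) * s)) - exp (- (\<xi> * s)) - exp (- ((1 - x) * s)) + exp (- (x * s)))"
    by (simp add: layer'_def s_def algebra_simps)
  also have "\<dots> \<le> s * (32 / s\<^sup>2 + layer \<alpha> e x)"
  proof (rule mult_left_mono)
    have "0 \<le> exp (- (\<xi> * s))" "0 \<le> exp (- ((1 - x) * s))" by auto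
    then show "exp (- ((1 - \<xi>) * s)) - exp (- (\<xi> * s)) - exp (- ((1 - x) * s)) + exp (- (x * s)) \<le> 32 / s\<^sup>2 + layer \<alpha> e x"
      using r1 r2 unfolding layer_def s_def[symmetric] by linarith
  qed (use s in simp)
  also have "\<dots> = 32 * (1 / s) + s * layer \<alpha> e x" using s by (simp add: field_simps power2_eq_square)
  finally have "(layer' \<alpha> e \<xi> - layer' \<alpha> e x) / \<alpha> \<le> (32 * (1 / s) + s * layer \<alpha> e x) / \<alpha>"
    using assms by (intro divide_right_mono) auto
  also have "\<dots> = 32 * (1 / s) / \<alpha> + s / \<alpha> * layer \<alpha> e x" by (simp add: add_divide_distrib)
  also have "\<dots> = 32 / (\<alpha> * sqrt \<alpha>) * sqrt e + 1 / sqrt \<alpha> * (layer \<alpha> e x / sqrt e)"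
    unfolding s2 by simp
  also have "\<dots> \<le> 32 / (\<alpha> * sqrt \<alpha>) * sqrt e' + 1 / sqrt \<alpha> * (layer \<alpha> e x / sqrt e)"
    using assms by (intro add_right_mono mult_left_mono) auto
  finally show ?thesis by (simp add: add.commute)
qed

text \<open>With \<open>E = exp (sqrt \<alpha>)\<close>, the 9 is composed of 8 from the mean value
  point and 1 from the growth of the slow layers. The term 1 is the constant part of the second
  derivative, the term with 32 the far ends of up to n fast layers, and
  \<open>1 / sqrt \<alpha>\<close> their near ends.\<close>

definition interpolation_const :: "nat \<Rightarrow> real \<Rightarrow> real" where
  "interpolation_const n \<alpha> = 9 * exp (sqrt \<alpha>) + 1 + 32 * real n / (\<alpha> * sqrt \<alpha>) + 1 / sqrt \<alpha>"

lemma sqrt_div_le: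
  assumes "0 < a" "0 < c"
  shows "a \<le> c \<Longrightarrow> sqrt a / c \<le> 1 / sqrt c" "c \<le> a \<Longrightarrow> 1 / sqrt c \<le> sqrt a / c"
proof -
  have c: "1 / sqrt c = sqrt c / c" using assms by (simp add: field_simps)
  show "a \<le> c \<Longrightarrow> sqrt a / c \<le> 1 / sqrt c" "c \<le> a \<Longrightarrow> 1 / sqrt c \<le> sqrt a / c"
    unfolding c using assms by (auto intro!: divide_right_mono)
qed

text \<open>For the fast layers \<open>m < i\<close> the increment of \<open>g'\<close> is the integral of \<open>B m / \<epsilon> m\<close>. Stepping towards
  the middle of the interval keeps the far end layer exponentially small there.\<close>

lemma derivative_interpolation_left:
  fixes \<epsilon> :: "nat \<Rightarrow> real"
  assumes \<alpha>: "0 < \<alpha>" and M: "0 \<le> M" and i: "i \<in> {1..n}"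
    and eps: "\<And>m. m \<in> {1..n} \<Longrightarrow> 0 < \<epsilon> m" "\<epsilon> i \<le> 1"
      "\<And>m. m \<in> {1..n} \<Longrightarrow> m \<le> i \<Longrightarrow> \<epsilon> m \<le> \<epsilon> i" "\<And>m. m \<in> {1..n} \<Longrightarrow> i \<le> m \<Longrightarrow> \<epsilon> i \<le> \<epsilon> m"
    and g: "\<And>t. 0 < t \<Longrightarrow> t < 1 \<Longrightarrow> (g has_real_derivative g' t) (at t)"
    and g': "\<And>t. 0 < t \<Longrightarrow> t < 1 \<Longrightarrow> (g' has_real_derivative g'' t) (at t)"
    and g_le: "\<And>t. 0 < t \<Longrightarrow> t < 1 \<Longrightarrow> \<bar>g t\<bar> \<le> M * (\<epsilon> i * (1 + (\<Sum>m=i..n. layer \<alpha> (\<epsilon> m) t / \<epsilon> m)))"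
    and g''_le: "\<And>t. 0 < t \<Longrightarrow> t < 1 \<Longrightarrow> \<bar>g'' t\<bar> \<le> M * (1 + (\<Sum>m=1..n. layer \<alpha> (\<epsilon> m) t / \<epsilon> m))"
    and x: "0 < x" "x \<le> 1 / 2"
  shows "\<bar>g' x\<bar> \<le> interpolation_const n \<alpha> * M *
    (sqrt (\<epsilon> i) + (\<Sum>m=1..n. min (sqrt (\<epsilon> i) / \<epsilon> m) (1 / sqrt (\<epsilon> m)) * layer \<alpha> (\<epsilon> m) x))"
proof -
  let ?B = "\<lambda>m. layer \<alpha> (\<epsilon> m) x"
  define E where "E = exp (sqrt \<alpha>)"
  define mm where "mm m = min (sqrt (\<epsilon> i) / \<epsilon> m) (1 / sqrt (\<epsilon> m))" for m
  \<comment> \<open>A step of order \<open>sqrt (\<epsilon> i)\<close> balances \<open>g\<close>, of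
    order \<open>\<epsilon> i\<close> away from the layers, against \<open>g''\<close>, of order 1.
    The factor 1/4 together with \<open>x \<le> 1 / 2\<close> keeps the step within the left three
    quarters of the interval.\<close>
  define \<delta> where "\<delta> = sqrt (\<epsilon> i) / 4"
  have nn: "0 \<le> ?B m" for m by (rule layer_nonneg)
  have E: "1 \<le> E" using \<alpha> by (simp add: E_def)
  have ei: "0 < \<epsilon> i" "sqrt (\<epsilon> i) \<le> 1" using eps i by auto
  have \<delta>: "0 < \<delta>" "\<delta> \<le> 1 / 4" using ei by (auto simp: \<delta>_def)
  have mm_slow: "mm m = sqrt (\<epsilon> i) / \<epsilon> m" if m: "m \<in> {1..n}" "i \<le> m" for m
    using sqrt_div_le(1)[OF ei(1) eps(1)[OF m(1)] eps(4)[OF m]] by (simp add: mm_def)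
  have mm_fast: "mm m = 1 / sqrt (\<epsilon> m)" if m: "m \<in> {1..n}" "m < i" for m
    using sqrt_div_le(2)[OF ei(1) eps(1)[OF m(1)]] eps(3)[of m] m by (simp add: mm_def)
  have mm_nn: "0 \<le> mm m" if "m \<in> {1..n}" for m using eps(1)[OF that] ei by (simp add: mm_def)
  \<comment> \<open>Layers m \<ge> i decay on a length of at least
    \<open>sqrt (\<epsilon> i)\<close>, so they change only by the factor \<open>E\<close> along the
    step.\<close>
  have near: "layer \<alpha> (\<epsilon> m) t \<le> E * ?B m" if m: "m \<in> {1..n}" "i \<le> m" and t: "x \<le> t" "t \<le> x + \<delta>" for m t
  proof -
    have "\<bar>t - x\<bar> * sqrt (\<alpha> / \<epsilon> m) \<le> sqrt (\<epsilon> m) * sqrt (\<alpha> / \<epsilon> m)"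
    proof (intro mult_right_mono)
      have "sqrt (\<epsilon> i) \<le> sqrt (\<epsilon> m)" using eps(4)[OF m] by simp
      moreover have "\<delta> \<le> sqrt (\<epsilon> i)" using ei by (simp add: \<delta>_def)
      ultimately show "\<bar>t - x\<bar> \<le> sqrt (\<epsilon> m)" using t by linarith
    qed (use \<alpha> eps(1)[OF m(1)] in simp)
    also have "\<dots> = sqrt \<alpha>" using eps(1)[OF m(1)] by (simp add: real_sqrt_divide)
    finally have "exp (\<bar>t - x\<bar> * sqrt (\<alpha> / \<epsilon> m)) \<le> E" by (simp add: E_def)
    then have "exp (\<bar>t - x\<bar> * sqrt (\<alpha> / \<epsilon> m)) * ?B m \<le> E * ?B m" using nn by (rule mult_right_mono)
    then show ?thesis using layer_shift_le[of \<alpha> "\<epsilon> m" t x] \<alpha> eps(1)[OF m(1)] by simp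
  qed
  obtain \<xi> where \<xi>: "x < \<xi>" "\<xi> < x + \<delta>" and mvt: "g (x + \<delta>) - g x = (x + \<delta> - x) * g' \<xi>"
    using MVT2[of x "x + \<delta>" g g'] g x \<delta> by auto
  define S where "S = (\<Sum>m=i..n. ?B m / \<epsilon> m)"
  have S0: "0 \<le> S" unfolding S_def
  proof (intro sum_nonneg divide_nonneg_nonneg nn)
    fix m assume "m \<in> {i..n}"
    then have "m \<in> {1..n}" using i by auto
    then show "0 \<le> \<epsilon> m" using eps(1)[of m] by simp
  qed
  have "(\<Sum>m=i..n. layer \<alpha> (\<epsilon> m) (x + \<delta>) / \<epsilon> m) \<le> (\<Sum>m=i..n. E * (?B m / \<epsilon> m))"
  proof (rule sum_mono)
    fix m assume m: "m \<in> {i..n}"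
    then have m': "m \<in> {1..n}" "i \<le> m" using i by auto
    have "layer \<alpha> (\<epsilon> m) (x + \<delta>) / \<epsilon> m \<le> E * ?B m / \<epsilon> m"
      using near[OF m', of "x + \<delta>"] \<delta> eps(1)[OF m'(1)] by (intro divide_right_mono) auto
    then show "layer \<alpha> (\<epsilon> m) (x + \<delta>) / \<epsilon> m \<le> E * (?B m / \<epsilon> m)" by simp
  qed
  also have "\<dots> = E * S" by (simp add: S_def sum_distrib_left)
  finally have S\<delta>: "(\<Sum>m=i..n. layer \<alpha> (\<epsilon> m) (x + \<delta>) / \<epsilon> m) \<le> E * S" .
  have "\<bar>g (x + \<delta>)\<bar> \<le> M * (\<epsilon> i * (1 + (\<Sum>m=i..n. layer \<alpha> (\<epsilon> m) (x + \<delta>) / \<epsilon> m)))"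
    using x \<delta> by (intro g_le) auto
  also have "\<dots> \<le> M * (\<epsilon> i * (E * (1 + S)))"
  proof (intro mult_left_mono)
    show "1 + (\<Sum>m=i..n. layer \<alpha> (\<epsilon> m) (x + \<delta>) / \<epsilon> m) \<le> E * (1 + S)"
      using S\<delta> E by (simp add: distrib_left)
  qed (use M ei in auto)
  finally have gy: "\<bar>g (x + \<delta>)\<bar> \<le> M * (\<epsilon> i * (E * (1 + S)))" .
  have "\<bar>g x\<bar> \<le> M * (\<epsilon> i * (1 + S))" using g_le[of x] x unfolding S_def by auto
  also have "\<dots> \<le> M * (\<epsilon> i * (E * (1 + S)))"
  proof (intro mult_left_mono)
    show "1 + S \<le> E * (1 + S)" using mult_right_mono[OF E, of "1 + S"] S0 by simp
  qed (use M ei in auto)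
  finally have "\<bar>g (x + \<delta>)\<bar> + \<bar>g x\<bar> \<le> 2 * (M * (\<epsilon> i * (E * (1 + S))))" using gy by linarith
  then have "\<bar>g (x + \<delta>) - g x\<bar> \<le> 2 * (M * (\<epsilon> i * (E * (1 + S))))" by linarith
  then have "\<delta> * \<bar>g' \<xi>\<bar> \<le> 2 * (M * (\<epsilon> i * (E * (1 + S))))" using mvt \<delta> by (simp add: abs_mult)
  also have "\<dots> = \<delta> * (8 * E * M * (sqrt (\<epsilon> i) * (1 + S)))"
  proof -
    have "\<epsilon> i = sqrt (\<epsilon> i) * sqrt (\<epsilon> i)" using ei by simp
    then show ?thesis unfolding \<delta>_def by simp
  qed
  finally have "\<bar>g' \<xi>\<bar> \<le> 8 * E * M * (sqrt (\<epsilon> i) * (1 + S))" using \<delta> by simp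
  also have "sqrt (\<epsilon> i) * (1 + S) = sqrt (\<epsilon> i) + (\<Sum>m=i..n. mm m * ?B m)"
    using i by (auto simp: distrib_left S_def sum_distrib_left mm_slow intro!: sum.cong)
  finally have part1: "\<bar>g' \<xi>\<bar> \<le> M * (8 * E * sqrt (\<epsilon> i) + (\<Sum>m=i..n. 8 * E * (mm m * ?B m)))"
    by (simp add: algebra_simps sum_distrib_left)
  \<comment> \<open>Antiderivative of the majorant of \<open>g''\<close>, layer by layer: a slow
    layer is frozen at \<open>E\<close> times its value at \<open>x\<close>, a fast one is
    integrated exactly to \<open>layer' / \<alpha>\<close>.\<close>
  define r where "r m t = (if i \<le> m then E * (?B m / \<epsilon> m) * t else layer' \<alpha> (\<epsilon> m) t / \<alpha>)" for m t
  define r' where "r' m t = (if i \<le> m then E * (?B m / \<epsilon> m) else layer \<alpha> (\<epsilon> m) t / \<epsilon> m)" for m t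
  have r: "(r m has_real_derivative r' m t) (at t)" if m: "m \<in> {1..n}" for m t
  proof (cases "i \<le> m")
    case True
    then show ?thesis using eps(1)[OF m] unfolding r_def r'_def by (auto intro!: derivative_eq_intros)
  next
    case False
    have "((\<lambda>t. layer' \<alpha> (\<epsilon> m) t / \<alpha>) has_real_derivative \<alpha> / \<epsilon> m * layer \<alpha> (\<epsilon> m) t / \<alpha>) (at t)"
      using \<alpha> eps(1)[OF m] by (intro DERIV_cdivide has_derivative_layer') auto
    then show ?thesis using False \<alpha> unfolding r_def r'_def by simp
  qed
  have "\<bar>g' \<xi> - g' x\<bar> \<le> M * (\<xi> + (\<Sum>m=1..n. r m \<xi>)) - M * (x + (\<Sum>m=1..n. r m x))"
  proof (rule abs_diff_le_of_deriv_le[where g' = g'' and R = "\<lambda>t. M * (t + (\<Sum>m=1..n. r m t))"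
        and R' = "\<lambda>t. M * (1 + (\<Sum>m=1..n. r' m t))"])
    show "x \<le> \<xi>" using \<xi> by simp
    fix t assume t: "x \<le> t" "t \<le> \<xi>"
    then have t01: "0 < t" "t < 1" using x \<delta> \<xi> by auto
    show "(g' has_real_derivative g'' t) (at t)" by (rule g'[OF t01])
    show "((\<lambda>t. M * (t + (\<Sum>m=1..n. r m t))) has_real_derivative M * (1 + (\<Sum>m=1..n. r' m t))) (at t)"
      by (intro DERIV_cmult DERIV_add DERIV_ident DERIV_sum r)
    have "(\<Sum>m=1..n. layer \<alpha> (\<epsilon> m) t / \<epsilon> m) \<le> (\<Sum>m=1..n. r' m t)"
    proof (rule sum_mono)
      fix m assume m: "m \<in> {1..n}"
      show "layer \<alpha> (\<epsilon> m) t / \<epsilon> m \<le> r' m t"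
        using near[OF m, of t] t \<xi> divide_right_mono[of "layer \<alpha> (\<epsilon> m) t" "E * ?B m" "\<epsilon> m"] eps(1)[OF m]
        by (auto simp: r'_def)
    qed
    then have "M * (1 + (\<Sum>m=1..n. layer \<alpha> (\<epsilon> m) t / \<epsilon> m)) \<le> M * (1 + (\<Sum>m=1..n. r' m t))"
      using M by (intro mult_left_mono) auto
    then show "\<bar>g'' t\<bar> \<le> M * (1 + (\<Sum>m=1..n. r' m t))" using g''_le[OF t01] by linarith
  qed
  also have "\<dots> = M * ((\<xi> - x) + (\<Sum>m=1..n. r m \<xi> - r m x))"
    by (simp add: algebra_simps sum_subtractf)
  also have "\<dots> \<le> M * (sqrt (\<epsilon> i) + (\<Sum>m=1..n. (if i \<le> m then E * (mm m * ?B m) else 1 / sqrt \<alpha> * (mm m * ?B m)) + 32 / (\<alpha> * sqrt \<alpha>) * sqrt (\<epsilon> i)))"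
  proof (intro mult_left_mono add_mono sum_mono M)
    show "\<xi> - x \<le> sqrt (\<epsilon> i)" using \<xi> ei unfolding \<delta>_def by simp
    fix m assume m: "m \<in> {1..n}"
    show "r m \<xi> - r m x \<le> (if i \<le> m then E * (mm m * ?B m) else 1 / sqrt \<alpha> * (mm m * ?B m)) + 32 / (\<alpha> * sqrt \<alpha>) * sqrt (\<epsilon> i)"
    proof (cases "i \<le> m")
      case True
      have "r m \<xi> - r m x = E * (?B m / \<epsilon> m) * (\<xi> - x)" using True by (simp add: r_def right_diff_distrib)
      also have "\<dots> \<le> E * (?B m / \<epsilon> m) * sqrt (\<epsilon> i)"
        using \<xi> ei E nn[of m] eps(1)[OF m] by (intro mult_left_mono) (auto simp: \<delta>_def)
      also have "\<dots> = E * (mm m * ?B m)" by (simp add: mm_slow[OF m True])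
      finally have "r m \<xi> - r m x \<le> E * (mm m * ?B m)" .
      moreover have "0 \<le> 32 / (\<alpha> * sqrt \<alpha>) * sqrt (\<epsilon> i)" using \<alpha> ei by simp
      ultimately show ?thesis using True by simp
    next
      case False
      have "r m \<xi> - r m x = (layer' \<alpha> (\<epsilon> m) \<xi> - layer' \<alpha> (\<epsilon> m) x) / \<alpha>"
        using False by (simp add: r_def diff_divide_distrib)
      also have "\<dots> \<le> 1 / sqrt \<alpha> * (?B m / sqrt (\<epsilon> m)) + 32 / (\<alpha> * sqrt \<alpha>) * sqrt (\<epsilon> i)"
        using \<xi> \<delta> x False by (intro layer'_diff_le \<alpha> eps(1,3) m) auto
      finally show ?thesis using False mm_fast[OF m] by simp
    qed
  qed
  also have "\<dots> = M * (sqrt (\<epsilon> i) + 32 * real n / (\<alpha> * sqrt \<alpha>) * sqrt (\<epsilon> i)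
      + (\<Sum>m=1..n. if i \<le> m then E * (mm m * ?B m) else 1 / sqrt \<alpha> * (mm m * ?B m)))"
    by (simp add: sum.distrib)
  finally have part2: "\<bar>g' \<xi> - g' x\<bar> \<le> M * (sqrt (\<epsilon> i) + 32 * real n / (\<alpha> * sqrt \<alpha>) * sqrt (\<epsilon> i)
      + (\<Sum>m=1..n. if i \<le> m then E * (mm m * ?B m) else 1 / sqrt \<alpha> * (mm m * ?B m)))" .
  have "(\<Sum>m=i..n. 8 * E * (mm m * ?B m)) = (\<Sum>m\<in>{m\<in>{1..n}. i \<le> m}. 8 * E * (mm m * ?B m))"
    using i by (intro sum.cong) auto
  also have "\<dots> = (\<Sum>m=1..n. if i \<le> m then 8 * E * (mm m * ?B m) else 0)"
    by (simp only: sum.inter_filter finite_atLeastAtMost)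
  finally have part1': "\<bar>g' \<xi>\<bar> \<le> M * (8 * E * sqrt (\<epsilon> i) + (\<Sum>m=1..n. if i \<le> m then 8 * E * (mm m * ?B m) else 0))"
    using part1 by simp
  let ?K = "interpolation_const n \<alpha>"
  have "\<bar>g' x\<bar> \<le> \<bar>g' \<xi>\<bar> + \<bar>g' \<xi> - g' x\<bar>" by linarith
  also have "\<dots> \<le> M * ((8 * E + 1 + 32 * real n / (\<alpha> * sqrt \<alpha>)) * sqrt (\<epsilon> i)
      + (\<Sum>m=1..n. (if i \<le> m then 8 * E * (mm m * ?B m) else 0) + (if i \<le> m then E * (mm m * ?B m) else 1 / sqrt \<alpha> * (mm m * ?B m))))"
    using add_mono[OF part1' part2] by (simp add: algebra_simps sum.distrib)
  also have "\<dots> \<le> M * (?K * sqrt (\<epsilon> i) + (\<Sum>m=1..n. ?K * (mm m * ?B m)))"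
  proof (intro mult_left_mono add_mono mult_right_mono sum_mono M)
    show "8 * E + 1 + 32 * real n / (\<alpha> * sqrt \<alpha>) \<le> ?K"
      using E \<alpha> by (simp add: interpolation_const_def E_def)
    show "0 \<le> sqrt (\<epsilon> i)" using ei by simp
    fix m assume m: "m \<in> {1..n}"
    have p: "0 \<le> mm m * ?B m" using mm_nn[OF m] nn by simp
    have "0 \<le> 32 * real n / (\<alpha> * sqrt \<alpha>)" "0 \<le> 1 / sqrt \<alpha>" using \<alpha> by auto
    then have "9 * E \<le> ?K" "1 / sqrt \<alpha> \<le> ?K"
      using E unfolding interpolation_const_def E_def[symmetric] by linarith+
    then have "9 * E * (mm m * ?B m) \<le> ?K * (mm m * ?B m)" "1 / sqrt \<alpha> * (mm m * ?B m) \<le> ?K * (mm m * ?B m)"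
      using p by (intro mult_right_mono; simp)+
    then show "(if i \<le> m then 8 * E * (mm m * ?B m) else 0) + (if i \<le> m then E * (mm m * ?B m) else 1 / sqrt \<alpha> * (mm m * ?B m)) \<le> ?K * (mm m * ?B m)"
      by auto
  qed
  also have "\<dots> = ?K * M * (sqrt (\<epsilon> i) + (\<Sum>m=1..n. mm m * ?B m))"
    by (simp add: sum_distrib_left distrib_left mult_ac)
  finally show ?thesis unfolding mm_def .
qed

text \<open>A Landau type inequality: bounds for \<open>g\<close> and \<open>g''\<close> give the
  intermediate bound for \<open>g'\<close>. The minimum equals
  \<open>sqrt (\<epsilon> i) / \<epsilon> m\<close> for m \<ge> i and
  \<open>1 / sqrt (\<epsilon> m)\<close> for m < i. The right half follows by the reflection of x to
  1 - x, under which the layers are invariant.\<close>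

lemma derivative_interpolation:
  fixes \<epsilon> :: "nat \<Rightarrow> real"
  assumes \<alpha>: "0 < \<alpha>" and M: "0 \<le> M" and i: "i \<in> {1..n}"
    and eps: "\<And>m. m \<in> {1..n} \<Longrightarrow> 0 < \<epsilon> m" "\<epsilon> i \<le> 1"
      "\<And>m. m \<in> {1..n} \<Longrightarrow> m \<le> i \<Longrightarrow> \<epsilon> m \<le> \<epsilon> i" "\<And>m. m \<in> {1..n} \<Longrightarrow> i \<le> m \<Longrightarrow> \<epsilon> i \<le> \<epsilon> m"
    and g: "\<And>t. 0 < t \<Longrightarrow> t < 1 \<Longrightarrow> (g has_real_derivative g' t) (at t)"
    and g': "\<And>t. 0 < t \<Longrightarrow> t < 1 \<Longrightarrow> (g' has_real_derivative g'' t) (at t)"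
    and g_le: "\<And>t. 0 < t \<Longrightarrow> t < 1 \<Longrightarrow> \<bar>g t\<bar> \<le> M * (\<epsilon> i * (1 + (\<Sum>m=i..n. layer \<alpha> (\<epsilon> m) t / \<epsilon> m)))"
    and g''_le: "\<And>t. 0 < t \<Longrightarrow> t < 1 \<Longrightarrow> \<bar>g'' t\<bar> \<le> M * (1 + (\<Sum>m=1..n. layer \<alpha> (\<epsilon> m) t / \<epsilon> m))"
    and x: "0 < x" "x < 1"
  shows "\<bar>g' x\<bar> \<le> interpolation_const n \<alpha> * M *
    (sqrt (\<epsilon> i) + (\<Sum>m=1..n. min (sqrt (\<epsilon> i) / \<epsilon> m) (1 / sqrt (\<epsilon> m)) * layer \<alpha> (\<epsilon> m) x))"
proof (cases "x \<le> 1 / 2")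
  case True
  then show ?thesis using derivative_interpolation_left[OF \<alpha> M i eps(1) eps(2) eps(3) eps(4) g g' g_le g''_le x(1)] by blast
next
  case False
  have "\<bar>- g' (1 - (1 - x))\<bar> \<le> interpolation_const n \<alpha> * M *
    (sqrt (\<epsilon> i) + (\<Sum>m=1..n. min (sqrt (\<epsilon> i) / \<epsilon> m) (1 / sqrt (\<epsilon> m)) * layer \<alpha> (\<epsilon> m) (1 - x)))"
  proof (rule derivative_interpolation_left[OF \<alpha> M i, where g = "\<lambda>t. g (1 - t)" and g' = "\<lambda>t. - g' (1 - t)"
        and g'' = "\<lambda>t. g'' (1 - t)"])
    fix t :: real assume t: "0 < t" "t < 1"
    have refl: "((\<lambda>t. 1 - t) has_real_derivative - 1) (at t)" by (auto intro!: derivative_eq_intros)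
    show "((\<lambda>t. g (1 - t)) has_real_derivative - g' (1 - t)) (at t)"
      using DERIV_chain2[OF g refl] t by simp
    show "((\<lambda>t. - g' (1 - t)) has_real_derivative g'' (1 - t)) (at t)"
      using DERIV_minus[OF DERIV_chain2[OF g' refl]] t by simp
    show "\<bar>g (1 - t)\<bar> \<le> M * (\<epsilon> i * (1 + (\<Sum>m=i..n. layer \<alpha> (\<epsilon> m) t / \<epsilon> m)))"
      using g_le[of "1 - t"] t by (simp add: layer_symmetric)
    show "\<bar>g'' (1 - t)\<bar> \<le> M * (1 + (\<Sum>m=1..n. layer \<alpha> (\<epsilon> m) t / \<epsilon> m))"
      using g''_le[of "1 - t"] t by (simp add: layer_symmetric)
  qed (use x False eps in auto)
  then show ?thesis by (simp add: layer_symmetric)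
qed

section \<open>Derivative bounds for the solution\<close>

lemma mvt_real:
  fixes u V :: "real \<Rightarrow> real"
  assumes "a < b" and cont: "continuous_on {a..b} u"
    and u: "\<And>x. a < x \<Longrightarrow> x < b \<Longrightarrow> (u has_real_derivative V x) (at x)"
  obtains \<xi> where "a < \<xi>" "\<xi> < b" "u b - u a = (b - a) * V \<xi>"
proof -
  have "\<exists>l z. a < z \<and> z < b \<and> (u has_real_derivative l) (at z) \<and> u b - u a = (b - a) * l"
    using u by (intro MVT assms) (auto simp: real_differentiable_def)
  then obtain l z where z: "a < z" "z < b" "(u has_real_derivative l) (at z)" "u b - u a = (b - a) * l" by blast
  moreover have "l = V z" using DERIV_unique[OF z(3) u[OF z(1,2)]] .
  ultimately show ?thesis using that by blast
qed

text \<open>On an interval of length \<open>sqrt e\<close> at the end point, the mean value theorem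
  yields a point where the derivative is at most \<open>2 * c / sqrt e\<close>, and from there it
  changes by at most \<open>sqrt e * (d / e)\<close>.\<close>

lemma boundary_derivative_bound:
  fixes u V G :: "real \<Rightarrow> real"
  assumes e: "0 < e" "e \<le> 1"
    and contu: "continuous_on {0..1} u" and contV: "continuous_on {0..1} V"
    and u: "\<And>x. x \<in> {0<..<1} \<Longrightarrow> (u has_real_derivative V x) (at x)"
    and V: "\<And>x. x \<in> {0<..<1} \<Longrightarrow> (V has_real_derivative G x) (at x)"
    and c: "\<And>x. x \<in> {0..1} \<Longrightarrow> \<bar>u x\<bar> \<le> c" and d: "\<And>x. x \<in> {0..1} \<Longrightarrow> \<bar>G x\<bar> \<le> d / e"
  shows "\<bar>V 0\<bar> \<le> (2 * c + d) / sqrt e" "\<bar>V 1\<bar> \<le> (2 * c + d) / sqrt e"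
proof -
  let ?s = "sqrt e"
  have s: "0 < ?s" "?s \<le> 1" "?s * ?s = e" using e by auto
  have d0: "0 \<le> d" using order_trans[OF abs_ge_zero d[of 0]] e by (simp add: zero_le_divide_iff)
  have main: "\<bar>V y\<bar> \<le> (2 * c + d) / ?s"
    if ab: "0 \<le> a" "a + ?s = b" "b \<le> 1" and y: "y = a \<or> y = b" for a b y
  proof -
    have "a < b" using ab s(1) by linarith
    obtain \<xi> where \<xi>: "a < \<xi>" "\<xi> < b" "u b - u a = (b - a) * V \<xi>"
    proof (rule mvt_real[OF \<open>a < b\<close>])
      show "continuous_on {a..b} u" using ab by (intro continuous_on_subset[OF contu]) auto
      show "(u has_real_derivative V x) (at x)" if "a < x" "x < b" for x using u[of x] that ab by auto
    qed blast
    have "?s * \<bar>V \<xi>\<bar> = \<bar>u b - u a\<bar>"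
    proof -
      have "b - a = ?s" using ab by linarith
      then show ?thesis using \<xi>(3) s(1) by (simp add: abs_mult)
    qed
    also have "\<dots> \<le> 2 * c" using c[of a] c[of b] ab s by auto
    finally have 1: "\<bar>V \<xi>\<bar> \<le> 2 * c / ?s" using s by (simp add: field_simps)
    have diff: "\<bar>V q - V p\<bar> \<le> d / ?s" if pq: "a \<le> p" "p < q" "q \<le> b" for p q
    proof -
      obtain \<eta> where \<eta>: "p < \<eta>" "\<eta> < q" "V q - V p = (q - p) * G \<eta>"
      proof (rule mvt_real[OF \<open>p < q\<close>])
        show "continuous_on {p..q} V" using ab pq by (intro continuous_on_subset[OF contV]) auto
        show "(V has_real_derivative G x) (at x)" if "p < x" "x < q" for x using V[of x] that ab pq by auto
      qed blast
      have "\<bar>V q - V p\<bar> = (q - p) * \<bar>G \<eta>\<bar>" using \<eta>(3) pq by (simp add: abs_mult)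
      also have "\<dots> \<le> ?s * (d / e)" using pq ab \<eta> d[of \<eta>] s by (intro mult_mono) auto
      also have "\<dots> = d / ?s" using s e by (simp add: field_simps)
      finally show ?thesis .
    qed
    have "\<bar>V y - V \<xi>\<bar> \<le> d / ?s" using y diff[of a \<xi>] diff[of \<xi> b] \<xi> by (auto simp: abs_minus_commute)
    then have "\<bar>V y\<bar> \<le> 2 * c / ?s + d / ?s" using 1 by linarith
    then show ?thesis by (simp add: add_divide_distrib)
  qed
  show "\<bar>V 0\<bar> \<le> (2 * c + d) / sqrt e" using main[of 0 ?s 0] s by simp
  show "\<bar>V 1\<bar> \<le> (2 * c + d) / sqrt e" using main[of "1 - ?s" 1 1] s by simp
qed

locale smooth_problem = coupled_coefficients n A \<alpha> \<beta> b
  for n A \<alpha> \<beta> b +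
  fixes A1 A2 :: "nat \<Rightarrow> nat \<Rightarrow> real \<Rightarrow> real" and f f1 f2 :: "nat \<Rightarrow> real \<Rightarrow> real" and g0 g1 :: "nat \<Rightarrow> real"
  assumes cont_A: "\<And>i k. i \<in> {1..n} \<Longrightarrow> k \<in> {1..n} \<Longrightarrow> continuous_on {0..1} (A i k)"
    and cont_f: "\<And>i. i \<in> {1..n} \<Longrightarrow> continuous_on {0..1} (f i)"
    and A1: "\<And>i k x. i \<in> {1..n} \<Longrightarrow> k \<in> {1..n} \<Longrightarrow> x \<in> {0<..<1} \<Longrightarrow> (A i k has_real_derivative A1 i k x) (at x)"
    and A2: "\<And>i k x. i \<in> {1..n} \<Longrightarrow> k \<in> {1..n} \<Longrightarrow> x \<in> {0<..<1} \<Longrightarrow> (A1 i k has_real_derivative A2 i k x) (at x)"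
    and f1: "\<And>i x. i \<in> {1..n} \<Longrightarrow> x \<in> {0<..<1} \<Longrightarrow> (f i has_real_derivative f1 i x) (at x)"
    and f2: "\<And>i x. i \<in> {1..n} \<Longrightarrow> x \<in> {0<..<1} \<Longrightarrow> (f1 i has_real_derivative f2 i x) (at x)"
    and bound_A: "\<And>i k x. i \<in> {1..n} \<Longrightarrow> k \<in> {1..n} \<Longrightarrow> x \<in> {0..1} \<Longrightarrow> \<bar>A i k x\<bar> \<le> b"
    and bound_A1: "\<And>i k x. i \<in> {1..n} \<Longrightarrow> k \<in> {1..n} \<Longrightarrow> x \<in> {0..1} \<Longrightarrow> \<bar>A1 i k x\<bar> \<le> b"
    and bound_A2: "\<And>i k x. i \<in> {1..n} \<Longrightarrow> k \<in> {1..n} \<Longrightarrow> x \<in> {0..1} \<Longrightarrow> \<bar>A2 i k x\<bar> \<le> b"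
    and bound_f: "\<And>i x. i \<in> {1..n} \<Longrightarrow> x \<in> {0..1} \<Longrightarrow> \<bar>f i x\<bar> \<le> b"
    and bound_f1: "\<And>i x. i \<in> {1..n} \<Longrightarrow> x \<in> {0..1} \<Longrightarrow> \<bar>f1 i x\<bar> \<le> b"
    and bound_f2: "\<And>i x. i \<in> {1..n} \<Longrightarrow> x \<in> {0..1} \<Longrightarrow> \<bar>f2 i x\<bar> \<le> b"
    and bound_g: "\<And>i. i \<in> {1..n} \<Longrightarrow> \<bar>g0 i\<bar> \<le> b" "\<And>i. i \<in> {1..n} \<Longrightarrow> \<bar>g1 i\<bar> \<le> b"
begin

text \<open>In \<open>solution_const\<close>, \<open>b / \<alpha>\<close> comes from the source and
  \<open>b\<close> from the boundary values. The constants for \<open>u'\<close> and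
  \<open>u''\<close> are \<open>barrier_const\<close> times a bound for the data of the
  differentiated system, which contains the preceding derivatives.\<close>

definition solution_const :: real where "solution_const = b / \<alpha> + b"
definition source_const :: real where "source_const = b + real n * b * solution_const"
definition first_deriv_const :: real where "first_deriv_const = barrier_const * (2 * solution_const + source_const + source_const)"
definition second_deriv_const :: real where "second_deriv_const = barrier_const * (source_const + 2 * b * real n * first_deriv_const)"
definition fourth_deriv_const :: real where "fourth_deriv_const = source_const + 2 * b * real n * first_deriv_const + real n * b * second_deriv_const"

lemma const_nonneg: "0 \<le> solution_const" "0 \<le> source_const" "0 \<le> first_deriv_const" "0 \<le> second_deriv_const" "0 \<le> fourth_deriv_const"
  using alpha b barrier_const_pos by (simp_all add: solution_const_def source_const_def first_deriv_const_def second_deriv_const_def fourth_deriv_const_def)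

lemma abs_sum_le: "\<bar>\<Sum>k=1..n. a k * v k\<bar> \<le> b * (\<Sum>k=1..n. \<bar>v k\<bar>)" if "\<And>k. k \<in> {1..n} \<Longrightarrow> \<bar>a k\<bar> \<le> b" for a v :: "nat \<Rightarrow> real"
proof -
  have "\<bar>\<Sum>k=1..n. a k * v k\<bar> \<le> (\<Sum>k=1..n. \<bar>a k * v k\<bar>)" by (rule sum_abs)
  also have "\<dots> \<le> (\<Sum>k=1..n. b * \<bar>v k\<bar>)"
    using that by (intro sum_mono) (auto simp: abs_mult intro!: mult_right_mono)
  finally show ?thesis by (simp add: sum_distrib_left)
qed

text \<open>A classical solution carries derivatives on the open interval only, but the comparison
  for \<open>u'\<close> needs continuity up to the end points. Reading the equation as a formula for
  \<open>u''\<close> supplies it, and differentiating this formula supplies \<open>P\<close> and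
  \<open>Q\<close>, at the cost of two derivatives of the data.\<close>

lemma solution_bounds:
  assumes params: "ordered_params n \<epsilon>" and sol: "bvp_solution n \<epsilon> A f g0 g1 u"
  shows "\<exists>V G P Q. \<forall>i\<in>{1..n}. continuous_on {0..1} (u i)
    \<and> (\<forall>x\<in>{0<..<1}. (u i has_real_derivative V i x) (at x) \<and> (V i has_real_derivative G i x) (at x)
        \<and> (G i has_real_derivative P i x) (at x) \<and> (P i has_real_derivative Q i x) (at x)
        \<and> - \<epsilon> i * G i x + (\<Sum>k=1..n. A i k x * u k x) = f i x
        \<and> \<bar>G i x\<bar> \<le> second_deriv_const * (1 + (\<Sum>m=i..n. layer \<alpha> (\<epsilon> m) x / \<epsilon> m))
        \<and> \<bar>\<epsilon> i * Q i x\<bar> \<le> fourth_deriv_const * (1 + (\<Sum>m=1..n. layer \<alpha> (\<epsilon> m) x / \<epsilon> m))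
        \<and> \<bar>\<epsilon> i * P i x\<bar> \<le> interpolation_const n \<alpha> * (second_deriv_const + fourth_deriv_const) *
            (sqrt (\<epsilon> i) + (\<Sum>m=1..n. min (sqrt (\<epsilon> i) / \<epsilon> m) (1 / sqrt (\<epsilon> m)) * layer \<alpha> (\<epsilon> m) x)))"
proof -
  have eps: "0 < \<epsilon> i" "\<epsilon> i \<le> 1" if "i \<in> {1..n}" for i using params that by (auto simp: ordered_params_def)
  have emono: "\<epsilon> i \<le> \<epsilon> k" if "i \<in> {1..n}" "k \<in> {1..n}" "i \<le> k" for i k
    using params that by (auto simp: ordered_params_def)
  have contu: "continuous_on {0..1} (u i)" and bdry: "u i 0 = g0 i" "u i 1 = g1 i" if "i \<in> {1..n}" for i
    using sol that by (auto simp: bvp_solution_def)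
  have "\<exists>u' u''. \<forall>x\<in>{0<..<1}. (u i has_real_derivative u' x) (at x) \<and> (u' has_real_derivative u'' x) (at x)
      \<and> - \<epsilon> i * u'' x + (\<Sum>k=1..n. A i k x * u k x) = f i x" if "i \<in> {1..n}" for i
    using sol that by (auto simp: bvp_solution_def)
  then have "\<forall>i\<in>{1..n}. \<exists>u' u''. \<forall>x\<in>{0<..<1}. (u i has_real_derivative u' x) (at x) \<and> (u' has_real_derivative u'' x) (at x)
      \<and> - \<epsilon> i * u'' x + (\<Sum>k=1..n. A i k x * u k x) = f i x" by blast
  from bchoice[OF this] obtain u' where "\<forall>i\<in>{1..n}. \<exists>u''. \<forall>x\<in>{0<..<1}. (u i has_real_derivative u' i x) (at x)
      \<and> (u' i has_real_derivative u'' x) (at x) \<and> - \<epsilon> i * u'' x + (\<Sum>k=1..n. A i k x * u k x) = f i x" by blast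
  from bchoice[OF this] obtain u'' where all: "\<forall>i\<in>{1..n}. \<forall>x\<in>{0<..<1}. (u i has_real_derivative u' i x) (at x)
      \<and> (u' i has_real_derivative u'' i x) (at x) \<and> - \<epsilon> i * u'' i x + (\<Sum>k=1..n. A i k x * u k x) = f i x" by blast
  have u': "(u i has_real_derivative u' i x) (at x)" and u'': "(u' i has_real_derivative u'' i x) (at x)"
    and eq: "- \<epsilon> i * u'' i x + (\<Sum>k=1..n. A i k x * u k x) = f i x" if "i \<in> {1..n}" "x \<in> {0<..<1}" for i x
    using all that by blast+
  \<comment> \<open>This formula makes sense and is continuous on the closed interval, while
    \<open>u''\<close> is given only inside.\<close>
  define G where "G i x = ((\<Sum>k=1..n. A i k x * u k x) - f i x) / \<epsilon> i" for i x
  have G_u'': "u'' i x = G i x" if "i \<in> {1..n}" "x \<in> {0<..<1}" for i x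
    using eq[OF that] eps[OF that(1)] by (simp add: G_def field_simps)
  have contG: "continuous_on {0..1} (G i)" if i: "i \<in> {1..n}" for i
    unfolding G_def
  proof (intro continuous_on_divide continuous_on_diff continuous_on_sum continuous_on_mult continuous_on_const cont_f i)
    show "\<forall>x\<in>{0..1}. \<epsilon> i \<noteq> 0" using eps(1)[OF i] by simp
  qed (use cont_A contu i in auto)
  \<comment> \<open>An antiderivative of \<open>G\<close> on the closed interval differs from
    \<open>u'\<close> by a constant inside, which gives the continuous extension of
    \<open>u'\<close>.\<close>
  have ex_V: "\<exists>V. continuous_on {0..1} V \<and> (\<forall>x\<in>{0<..<1}. V x = u' i x)" if i: "i \<in> {1..n}" for i
  proof -
    obtain F where F: "\<And>x. x \<in> {0..1} \<Longrightarrow> (F has_vector_derivative G i x) (at x within {0..1})"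
      using antiderivative_continuous[OF contG[OF i]] by blast
    have contF: "continuous_on {0..1} F"
      using has_vector_derivative_continuous[OF F] by (simp add: continuous_on_eq_continuous_within)
    have "\<exists>c. \<forall>x\<in>{0<..<1}. F x - u' i x = c"
    proof (rule has_field_derivative_zero_constant)
      fix x :: real assume x: "x \<in> {0<..<1}"
      have "(F has_vector_derivative G i x) (at x)"
        using F[of x] x at_within_Icc_at[of 0 x 1] by auto
      then have "(F has_real_derivative G i x) (at x)" by (simp add: has_real_derivative_iff_has_vector_derivative)
      then have "((\<lambda>x. F x - u' i x) has_real_derivative G i x - u'' i x) (at x)"
        using u''[OF i x] by (rule DERIV_diff)
      then show "((\<lambda>x. F x - u' i x) has_real_derivative 0) (at x within {0<..<1})"
        using G_u''[OF i x] by (simp add: has_field_derivative_at_within)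
    qed simp
    then obtain c where c: "\<And>x. x \<in> {0<..<1} \<Longrightarrow> F x - u' i x = c" by blast
    have "continuous_on {0..1} (\<lambda>x. F x - c)" by (intro continuous_intros contF)
    moreover have "\<forall>x\<in>{0<..<1}. F x - c = u' i x" using c by (simp add: algebra_simps)
    ultimately show ?thesis by blast
  qed
  have "\<exists>V. \<forall>i\<in>{1..n}. continuous_on {0..1} (V i) \<and> (\<forall>x\<in>{0<..<1}. V i x = u' i x)"
    using ex_V by (intro bchoice) blast
  then obtain V where "\<forall>i\<in>{1..n}. continuous_on {0..1} (V i) \<and> (\<forall>x\<in>{0<..<1}. V i x = u' i x)" ..
  then have contV: "\<And>i. i \<in> {1..n} \<Longrightarrow> continuous_on {0..1} (V i)"
    and V_u': "\<And>i x. i \<in> {1..n} \<Longrightarrow> x \<in> {0<..<1} \<Longrightarrow> V i x = u' i x" by blast+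
  have dV: "(u i has_real_derivative V i x) (at x)" if "i \<in> {1..n}" "x \<in> {0<..<1}" for i x
    using u'[OF that] V_u'[OF that] by simp
  have dG: "(V i has_real_derivative G i x) (at x)" if "i \<in> {1..n}" "x \<in> {0<..<1}" for i x
  proof -
    have "(u' i has_real_derivative G i x) (at x)" using u''[OF that] G_u''[OF that] by simp
    then show ?thesis
      by (rule has_field_derivative_transform_within_open[of _ _ _ "{0<..<1}"]) (use V_u' that in auto)
  qed
  define P where "P i x = ((\<Sum>k=1..n. A1 i k x * u k x + A i k x * V k x) - f1 i x) / \<epsilon> i" for i x
  define Q where "Q i x = ((\<Sum>k=1..n. (A2 i k x * u k x + A1 i k x * V k x) + (A1 i k x * V k x + A i k x * G k x)) - f2 i x) / \<epsilon> i" for i x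
  have mulD: "((\<lambda>x. a x * v x) has_real_derivative a' * v x + a x * v') (at x)"
    if "(a has_real_derivative a') (at x)" "(v has_real_derivative v') (at x)" for a v :: "real \<Rightarrow> real" and a' v' x
    using DERIV_mult[OF that] by (simp add: algebra_simps)
  have dP: "(G i has_real_derivative P i x) (at x)" if i: "i \<in> {1..n}" and x: "x \<in> {0<..<1}" for i x
    unfolding G_def P_def
    by (intro DERIV_cdivide DERIV_diff DERIV_sum mulD A1 dV f1 i x)
  have dQ: "(P i has_real_derivative Q i x) (at x)" if i: "i \<in> {1..n}" and x: "x \<in> {0<..<1}" for i x
    unfolding P_def Q_def
    by (intro DERIV_cdivide DERIV_diff DERIV_sum DERIV_add mulD A1 A2 dV dG f2 i x)
  have rs: "0 < (\<Sum>k=1..n. A i k x)" if "i \<in> {1..n}" "x \<in> {0<..<1}" for i x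
    using rowsum[OF that(1), of x] that alpha beta by auto

  \<comment> \<open>A constant is a sufficient comparison function, because every row sum is at
    least \<open>\<alpha>\<close>.\<close>
  have u_le: "\<bar>u i x\<bar> \<le> solution_const" if ix: "i \<in> {1..n}" "x \<in> {0..1}" for i x
  proof (rule system_bound[where \<psi> = "\<lambda>i x. solution_const" and \<psi>' = "\<lambda>i x. 0" and \<psi>'' = "\<lambda>i x. 0" and z = u and z' = V
        and z'' = G and A = A and \<epsilon> = \<epsilon> and n = n and i = i])
    fix i x assume i: "i \<in> {1..n}" and x: "x \<in> {0<..<(1::real)}"
    show "A i k x \<le> 0" if "k \<in> {1..n}" "i \<noteq> k" for k using offdiag i that x by simp
    have "\<bar>- \<epsilon> i * G i x + (\<Sum>k=1..n. A i k x * u k x)\<bar> = \<bar>f i x\<bar>"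
      using eq[OF i x] G_u''[OF i x] by simp
    also have "\<dots> \<le> b" using bound_f[OF i] x by simp
    also have "b = \<alpha> * (b / \<alpha>)" using alpha by simp
    also have "\<dots> \<le> (\<Sum>k=1..n. A i k x) * solution_const"
      using rowsum[OF i, of x] x alpha beta b by (intro mult_mono) (auto simp: solution_const_def)
    finally show "\<bar>- \<epsilon> i * G i x + (\<Sum>k=1..n. A i k x * u k x)\<bar> \<le> - \<epsilon> i * 0 + (\<Sum>k=1..n. A i k x * solution_const)"
      by (simp add: sum_distrib_right)
  next
    fix i assume i: "i \<in> {1..n}"
    have "0 \<le> b / \<alpha>" using alpha b by simp
    then show "\<bar>u i 0\<bar> \<le> solution_const" "\<bar>u i 1\<bar> \<le> solution_const" using bound_g[OF i] bdry[OF i] by (auto simp: solution_const_def)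
    show "0 \<le> \<epsilon> i" using eps(1)[OF i] by simp
  qed (use contu dV dG rs ix in auto)
  have sum_u: "(\<Sum>k=1..n. \<bar>u k x\<bar>) \<le> real n * solution_const" if x: "x \<in> {0..1}" for x
    using sum_bounded_above[of "{1..n}" "\<lambda>k. \<bar>u k x\<bar>" solution_const] u_le x by simp
  have lin_u: "\<bar>\<Sum>k=1..n. a k * u k x\<bar> \<le> real n * b * solution_const" if "\<And>k. k \<in> {1..n} \<Longrightarrow> \<bar>a k\<bar> \<le> b" "x \<in> {0..1}" for a x
    using abs_sum_le[of a "\<lambda>k. u k x"] that mult_left_mono[OF sum_u[OF that(2)] b] by (simp add: mult_ac)

  have G_le: "\<bar>G i x\<bar> \<le> source_const / \<epsilon> i" if i: "i \<in> {1..n}" and x: "x \<in> {0..1}" for i x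
  proof -
    have "\<bar>(\<Sum>k=1..n. A i k x * u k x) - f i x\<bar> \<le> source_const"
      using lin_u[of "\<lambda>k. A i k x" x] bound_A[OF i _ x] bound_f[OF i x] x unfolding source_const_def by (simp add: abs_le_iff)
    then show ?thesis using eps[OF i] by (simp add: G_def abs_divide divide_right_mono)
  qed
  have V_bdry: "\<bar>V i 0\<bar> \<le> (2 * solution_const + source_const) / sqrt (\<epsilon> i)" "\<bar>V i 1\<bar> \<le> (2 * solution_const + source_const) / sqrt (\<epsilon> i)"
    if i: "i \<in> {1..n}" for i
    using boundary_derivative_bound[OF eps[OF i] contu[OF i] contV[OF i] dV[OF i] dG[OF i] u_le[OF i] G_le[OF i]] by auto

  let ?B = "\<lambda>m x. layer \<alpha> (\<epsilon> m) x"
  \<comment> \<open>\<open>u'\<close> solves the system with right-hand side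
    \<open>f' - A' u\<close>, which is bounded without any layers; layers enter only through the
    boundary values of order \<open>1 / sqrt (\<epsilon> i)\<close>.\<close>
  have V_le: "\<bar>V i x\<bar> \<le> first_deriv_const * (1 + (\<Sum>m=i..n. 1 / sqrt (\<epsilon> m) * ?B m x))" if ix: "i \<in> {1..n}" "x \<in> {0..1}" for i x
    unfolding first_deriv_const_def
  proof (rule weighted_bound[OF params, where z = V and z' = G and z'' = P and i = i])
    show "1 \<le> 1 / sqrt (\<epsilon> m)" if "m \<in> {1..n}" for m using eps[OF that] by simp
    show "1 / sqrt (\<epsilon> i) * \<epsilon> i \<le> 1 / sqrt (\<epsilon> k) * \<epsilon> k" if "i \<in> {1..n}" "k \<in> {1..n}" "i \<le> k" for i k
      using emono[OF that] eps(1)[OF that(1)] eps(1)[OF that(2)] by (simp add: real_div_sqrt)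
    show "0 \<le> 2 * solution_const + source_const + source_const" using const_nonneg by simp
  next
    fix i assume i: "i \<in> {1..n}"
    have "(2 * solution_const + source_const) / sqrt (\<epsilon> i) \<le> (2 * solution_const + source_const + source_const) / sqrt (\<epsilon> i)"
      using const_nonneg eps[OF i] by (intro divide_right_mono) auto
    then show "\<bar>V i 0\<bar> \<le> (2 * solution_const + source_const + source_const) * (1 / sqrt (\<epsilon> i))" "\<bar>V i 1\<bar> \<le> (2 * solution_const + source_const + source_const) * (1 / sqrt (\<epsilon> i))"
      using V_bdry[OF i] by auto
  next
    fix i x assume i: "i \<in> {1..n}" and x: "x \<in> {0<..<(1::real)}"
    have "- \<epsilon> i * P i x + (\<Sum>k=1..n. A i k x * V k x) = f1 i x - (\<Sum>k=1..n. A1 i k x * u k x)"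
      using eps[OF i] by (simp add: P_def sum.distrib field_simps)
    moreover have "\<bar>\<dots>\<bar> \<le> source_const"
      using lin_u[of "\<lambda>k. A1 i k x" x] bound_A1[OF i, of _ x] bound_f1[OF i, of x] x unfolding source_const_def by (simp add: abs_le_iff)
    moreover have "0 \<le> (\<Sum>m=1..n. 1 / sqrt (\<epsilon> m) * ?B m x)"
    proof (intro sum_nonneg mult_nonneg_nonneg layer_nonneg)
      show "0 \<le> 1 / sqrt (\<epsilon> m)" if "m \<in> {1..n}" for m using eps(1)[OF that] by simp
    qed
    then have "source_const * 1 \<le> (2 * solution_const + source_const + source_const) * (1 + (\<Sum>m=1..n. 1 / sqrt (\<epsilon> m) * ?B m x))"
      using const_nonneg by (intro mult_mono) auto
    ultimately show "\<bar>- \<epsilon> i * P i x + (\<Sum>k=1..n. A i k x * V k x)\<bar>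
        \<le> (2 * solution_const + source_const + source_const) * (1 + (\<Sum>m=1..n. 1 / sqrt (\<epsilon> m) * ?B m x))" by simp
  qed (use contV dG dP ix in auto)

  have S_nn: "0 \<le> (\<Sum>m=1..n. ?B m x / \<epsilon> m)" for x
  proof (intro sum_nonneg divide_nonneg_nonneg layer_nonneg)
    show "0 \<le> \<epsilon> m" if "m \<in> {1..n}" for m using eps(1)[OF that] by simp
  qed
  \<comment> \<open>Since the parameters are at most 1, the weights
    \<open>1 / sqrt (\<epsilon> m)\<close> may be enlarged to \<open>1 / \<epsilon> m\<close>, so
    that \<open>u'\<close> is admissible as a source in the system for \<open>u''\<close>.\<close>
  have sum_V: "(\<Sum>k=1..n. \<bar>V k x\<bar>) \<le> real n * first_deriv_const * (1 + (\<Sum>m=1..n. ?B m x / \<epsilon> m))" if x: "x \<in> {0..1}" for x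
  proof -
    have "\<bar>V k x\<bar> \<le> first_deriv_const * (1 + (\<Sum>m=1..n. ?B m x / \<epsilon> m))" if k: "k \<in> {1..n}" for k
    proof -
      have "(\<Sum>m=k..n. 1 / sqrt (\<epsilon> m) * ?B m x) \<le> (\<Sum>m=k..n. ?B m x / \<epsilon> m)"
      proof (rule sum_mono)
        fix m assume "m \<in> {k..n}"
        then have m: "m \<in> {1..n}" using k by auto
        have "1 / sqrt (\<epsilon> m) \<le> 1 / \<epsilon> m"
          using eps[OF m] by (intro divide_left_mono) (auto intro!: real_le_rsqrt simp: power2_eq_square mult_le_one)
        then have "1 / sqrt (\<epsilon> m) * ?B m x \<le> 1 / \<epsilon> m * ?B m x" using layer_nonneg by (rule mult_right_mono)
        then show "1 / sqrt (\<epsilon> m) * ?B m x \<le> ?B m x / \<epsilon> m" by simp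
      qed
      also have "\<dots> \<le> (\<Sum>m=1..n. ?B m x / \<epsilon> m)"
      proof (rule sum_mono2)
        fix m assume "m \<in> {1..n} - {k..n}"
        then show "0 \<le> ?B m x / \<epsilon> m" using eps(1)[of m] layer_nonneg[of \<alpha> "\<epsilon> m" x] by simp
      qed (use k in auto)
      finally have "first_deriv_const * (1 + (\<Sum>m=k..n. 1 / sqrt (\<epsilon> m) * ?B m x)) \<le> first_deriv_const * (1 + (\<Sum>m=1..n. ?B m x / \<epsilon> m))"
        using const_nonneg by (intro mult_left_mono) auto
      then show ?thesis using V_le[OF k x] by simp
    qed
    from sum_bounded_above[of "{1..n}" "\<lambda>k. \<bar>V k x\<bar>", OF this] show ?thesis by (simp add: mult.assoc)
  qed
  have lin_V: "\<bar>\<Sum>k=1..n. a k * V k x\<bar> \<le> b * real n * first_deriv_const * (1 + (\<Sum>m=1..n. ?B m x / \<epsilon> m))"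
    if "\<And>k. k \<in> {1..n} \<Longrightarrow> \<bar>a k\<bar> \<le> b" "x \<in> {0..1}" for a x
    using abs_sum_le[of a "\<lambda>k. V k x"] that mult_left_mono[OF sum_V[OF that(2)] b] by (simp add: mult.assoc)
  have rest: "\<bar>f2 i x - (\<Sum>k=1..n. A2 i k x * u k x) - 2 * (\<Sum>k=1..n. A1 i k x * V k x)\<bar>
      \<le> (source_const + 2 * b * real n * first_deriv_const) * (1 + (\<Sum>m=1..n. ?B m x / \<epsilon> m))" if i: "i \<in> {1..n}" and x: "x \<in> {0<..<1}" for i x
  proof -
    let ?S = "1 + (\<Sum>m=1..n. ?B m x / \<epsilon> m)"
    have "\<bar>f2 i x\<bar> \<le> b" using bound_f2[OF i] x by simp
    moreover have "\<bar>\<Sum>k=1..n. A2 i k x * u k x\<bar> \<le> real n * b * solution_const" using bound_A2[OF i] x by (intro lin_u) auto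
    moreover have "\<bar>\<Sum>k=1..n. A1 i k x * V k x\<bar> \<le> b * real n * first_deriv_const * ?S" using bound_A1[OF i] x by (intro lin_V) auto
    moreover have "b + real n * b * solution_const \<le> source_const * ?S"
      using mult_left_mono[of 1 ?S source_const] const_nonneg S_nn[of x] by (simp add: source_const_def)
    moreover have "\<bar>p - q - 2 * r\<bar> \<le> s + 2 * t" if "\<bar>p\<bar> \<le> b" "\<bar>q\<bar> \<le> c" "\<bar>r\<bar> \<le> t" "b + c \<le> s" for p q r s t b c :: real
      using that by linarith
    ultimately have "\<bar>f2 i x - (\<Sum>k=1..n. A2 i k x * u k x) - 2 * (\<Sum>k=1..n. A1 i k x * V k x)\<bar> \<le> source_const * ?S + 2 * (b * real n * first_deriv_const * ?S)"
      by blast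
    also have "\<dots> = (source_const + 2 * b * real n * first_deriv_const) * ?S" by (simp add: algebra_simps)
    finally show ?thesis .
  qed
  \<comment> \<open>\<open>u''\<close> solves the system with right-hand side
    \<open>f'' - A'' u - 2 A' u'\<close>. Its boundary values are of order
    \<open>1 / \<epsilon> i\<close>, directly from the equation.\<close>
  have G_le': "\<bar>G i x\<bar> \<le> second_deriv_const * (1 + (\<Sum>m=i..n. 1 / \<epsilon> m * ?B m x))" if ix: "i \<in> {1..n}" "x \<in> {0..1}" for i x
    unfolding second_deriv_const_def
  proof (rule weighted_bound[OF params, where z = G and z' = P and z'' = Q and i = i])
    show "1 \<le> 1 / \<epsilon> m" if "m \<in> {1..n}" for m using eps[OF that] by simp
    show "1 / \<epsilon> i * \<epsilon> i \<le> 1 / \<epsilon> k * \<epsilon> k" if "i \<in> {1..n}" "k \<in> {1..n}" "i \<le> k" for i k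
      using eps(1)[OF that(1)] eps(1)[OF that(2)] by simp
    show "0 \<le> source_const + 2 * b * real n * first_deriv_const" using const_nonneg b by simp
  next
    fix i assume i: "i \<in> {1..n}"
    have "source_const / \<epsilon> i \<le> (source_const + 2 * b * real n * first_deriv_const) / \<epsilon> i"
      using const_nonneg b eps[OF i] by (intro divide_right_mono) auto
    then show "\<bar>G i 0\<bar> \<le> (source_const + 2 * b * real n * first_deriv_const) * (1 / \<epsilon> i)" "\<bar>G i 1\<bar> \<le> (source_const + 2 * b * real n * first_deriv_const) * (1 / \<epsilon> i)"
      using G_le[OF i, of 0] G_le[OF i, of 1] by auto
  next
    fix i x assume i: "i \<in> {1..n}" and x: "x \<in> {0<..<(1::real)}"
    have "- \<epsilon> i * Q i x + (\<Sum>k=1..n. A i k x * G k x)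
        = f2 i x - (\<Sum>k=1..n. A2 i k x * u k x) - 2 * (\<Sum>k=1..n. A1 i k x * V k x)"
      using eps[OF i] by (simp add: Q_def sum.distrib field_simps flip: sum_distrib_left)
    then show "\<bar>- \<epsilon> i * Q i x + (\<Sum>k=1..n. A i k x * G k x)\<bar>
        \<le> (source_const + 2 * b * real n * first_deriv_const) * (1 + (\<Sum>m=1..n. 1 / \<epsilon> m * ?B m x))" using rest[OF i x] by simp
  qed (use contG dP dQ ix in auto)
  then have G_le'': "\<bar>G i x\<bar> \<le> second_deriv_const * (1 + (\<Sum>m=i..n. ?B m x / \<epsilon> m))" if "i \<in> {1..n}" "x \<in> {0..1}" for i x
    using that by simp
  have Q_le: "\<bar>\<epsilon> i * Q i x\<bar> \<le> fourth_deriv_const * (1 + (\<Sum>m=1..n. ?B m x / \<epsilon> m))" if i: "i \<in> {1..n}" and x: "x \<in> {0<..<1}" for i x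
  proof -
    let ?S = "1 + (\<Sum>m=1..n. ?B m x / \<epsilon> m)"
    have "\<bar>G k x\<bar> \<le> second_deriv_const * ?S" if k: "k \<in> {1..n}" for k
    proof -
      have "(\<Sum>m=k..n. ?B m x / \<epsilon> m) \<le> (\<Sum>m=1..n. ?B m x / \<epsilon> m)"
      proof (rule sum_mono2)
        fix m assume "m \<in> {1..n} - {k..n}"
        then show "0 \<le> ?B m x / \<epsilon> m" using eps(1)[of m] layer_nonneg[of \<alpha> "\<epsilon> m" x] by simp
      qed (use k in auto)
      then have "second_deriv_const * (1 + (\<Sum>m=k..n. ?B m x / \<epsilon> m)) \<le> second_deriv_const * ?S" using const_nonneg by (intro mult_left_mono) auto
      then show ?thesis using G_le''[OF k, of x] x by auto
    qed
    from sum_bounded_above[of "{1..n}" "\<lambda>k. \<bar>G k x\<bar>", OF this]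
    have "(\<Sum>k=1..n. \<bar>G k x\<bar>) \<le> real n * (second_deriv_const * ?S)" by simp
    from mult_left_mono[OF this b] have "b * (\<Sum>k=1..n. \<bar>G k x\<bar>) \<le> real n * b * second_deriv_const * ?S"
      by (simp only: mult_ac)
    moreover have "\<bar>\<Sum>k=1..n. A i k x * G k x\<bar> \<le> b * (\<Sum>k=1..n. \<bar>G k x\<bar>)" using bound_A[OF i] x by (intro abs_sum_le) auto
    moreover have "\<epsilon> i * Q i x = (\<Sum>k=1..n. A i k x * G k x) - (f2 i x - (\<Sum>k=1..n. A2 i k x * u k x) - 2 * (\<Sum>k=1..n. A1 i k x * V k x))"
      using eps[OF i] by (simp add: Q_def sum.distrib field_simps flip: sum_distrib_left)
    ultimately have "\<bar>\<epsilon> i * Q i x\<bar> \<le> real n * b * second_deriv_const * ?S + (source_const + 2 * b * real n * first_deriv_const) * ?S"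
      using rest[OF i x] by linarith
    also have "\<dots> = fourth_deriv_const * ?S" by (simp add: fourth_deriv_const_def algebra_simps)
    finally show ?thesis .
  qed
  have P_le: "\<bar>\<epsilon> i * P i x\<bar> \<le> interpolation_const n \<alpha> * (second_deriv_const + fourth_deriv_const) *
      (sqrt (\<epsilon> i) + (\<Sum>m=1..n. min (sqrt (\<epsilon> i) / \<epsilon> m) (1 / sqrt (\<epsilon> m)) * ?B m x))"
    if i: "i \<in> {1..n}" and x: "x \<in> {0<..<1}" for i x
  proof (rule derivative_interpolation[OF alpha _ i, where g = "\<lambda>x. \<epsilon> i * G i x" and g' = "\<lambda>x. \<epsilon> i * P i x"
        and g'' = "\<lambda>x. \<epsilon> i * Q i x"])
    show "0 \<le> second_deriv_const + fourth_deriv_const" using const_nonneg by simp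
    fix t :: real assume t: "0 < t" "t < 1"
    then have t': "t \<in> {0<..<1}" "t \<in> {0..1}" by auto
    show "((\<lambda>x. \<epsilon> i * G i x) has_real_derivative \<epsilon> i * P i t) (at t)" by (intro DERIV_cmult dP i t')
    show "((\<lambda>x. \<epsilon> i * P i x) has_real_derivative \<epsilon> i * Q i t) (at t)" by (intro DERIV_cmult dQ i t')
    let ?S = "1 + (\<Sum>m=i..n. ?B m t / \<epsilon> m)"
    have S: "0 \<le> ?S"
    proof -
      have "0 \<le> (\<Sum>m=i..n. ?B m t / \<epsilon> m)"
      proof (intro sum_nonneg divide_nonneg_nonneg layer_nonneg)
        show "0 \<le> \<epsilon> m" if "m \<in> {i..n}" for m using eps(1)[of m] that i by simp
      qed
      then show ?thesis by simp
    qed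
    have "\<bar>\<epsilon> i * G i t\<bar> \<le> \<epsilon> i * (second_deriv_const * ?S)" using G_le''[OF i t'(2)] eps(1)[OF i] by (simp add: abs_mult)
    also have "\<dots> \<le> \<epsilon> i * ((second_deriv_const + fourth_deriv_const) * ?S)"
      using S const_nonneg eps(1)[OF i] by (intro mult_left_mono mult_right_mono) auto
    finally show "\<bar>\<epsilon> i * G i t\<bar> \<le> (second_deriv_const + fourth_deriv_const) * (\<epsilon> i * ?S)" by (simp add: mult_ac)
    have "fourth_deriv_const * (1 + (\<Sum>m=1..n. ?B m t / \<epsilon> m)) \<le> (second_deriv_const + fourth_deriv_const) * (1 + (\<Sum>m=1..n. ?B m t / \<epsilon> m))"
      using S_nn[of t] const_nonneg by (intro mult_right_mono) auto
    then show "\<bar>\<epsilon> i * Q i t\<bar> \<le> (second_deriv_const + fourth_deriv_const) * (1 + (\<Sum>m=1..n. ?B m t / \<epsilon> m))" using Q_le[OF i t'(1)] by linarith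
  qed (use eps emono i x in auto)
  show ?thesis
  proof (rule exI[of _ V], rule exI[of _ G], rule exI[of _ P], rule exI[of _ Q], intro ballI conjI)
    fix i x assume i: "i \<in> {1..n}" and x: "x \<in> {0<..<(1::real)}"
    show "- \<epsilon> i * G i x + (\<Sum>k=1..n. A i k x * u k x) = f i x" using eq[OF i x] G_u''[OF i x] by simp
    show "\<bar>G i x\<bar> \<le> second_deriv_const * (1 + (\<Sum>m=i..n. ?B m x / \<epsilon> m))" using G_le''[OF i, of x] x by auto
  qed (use contu dV dG dP dQ Q_le P_le in auto)
qed

end

section \<open>Truncation error\<close>

definition divided_second_diff :: "(real \<Rightarrow> real) \<Rightarrow> real \<Rightarrow> real \<Rightarrow> real \<Rightarrow> real" where
  "divided_second_diff w l c r = ((w r - w c) / (r - c) - (w c - w l) / (c - l)) / (((c - l) + (r - c)) / 2)"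

lemma second_diff_eq_divided:
  "second_diff x (\<lambda>j. w (x j)) j = divided_second_diff w (x (j - 1)) (x j) (x (j + 1))"
  by (simp add: second_diff_def forward_diff_def backward_diff_def divided_second_diff_def)

lemma divided_second_diff_linear:
  "divided_second_diff (\<lambda>y. v y + k * w y) l c r = divided_second_diff v l c r + k * divided_second_diff w l c r"
  by (simp add: divided_second_diff_def add_divide_distrib diff_divide_distrib algebra_simps)

text \<open>Subtracting \<open>k * y\<^sup>2 / 2\<close>, whose divided second difference is
  \<open>k\<close> for any spacing, leaves a function with nonincreasing derivative. Its two chord
  slopes, compared through the mean value theorem, are then ordered.\<close>

lemma divided_second_diff_le:
  assumes lcr: "l < c" "c < r" and cont: "continuous_on {l..r} w"
    and w: "\<And>y. l < y \<Longrightarrow> y < r \<Longrightarrow> (w has_real_derivative w' y) (at y)"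
    and w': "\<And>y. l < y \<Longrightarrow> y < r \<Longrightarrow> (w' has_real_derivative z y) (at y)"
    and z: "\<And>y. l < y \<Longrightarrow> y < r \<Longrightarrow> z y \<le> k"
  shows "divided_second_diff w l c r \<le> k"
proof -
  define q where "q y = w y - k * y\<^sup>2 / 2" for y
  have contq: "continuous_on {l..r} q" unfolding q_def by (intro continuous_intros cont) auto
  have dq: "(q has_real_derivative w' y - k * y) (at y)" if "l < y" "y < r" for y
    unfolding q_def using w[OF that] by (auto intro!: derivative_eq_intros)
  obtain \<xi> where \<xi>: "c < \<xi>" "\<xi> < r" "q r - q c = (r - c) * (w' \<xi> - k * \<xi>)"
    by (rule mvt_real[OF lcr(2) continuous_on_subset[OF contq], of "\<lambda>y. w' y - k * y"]) (use lcr dq in auto)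
  obtain \<eta> where \<eta>: "l < \<eta>" "\<eta> < c" "q c - q l = (c - l) * (w' \<eta> - k * \<eta>)"
    by (rule mvt_real[OF lcr(1) continuous_on_subset[OF contq], of "\<lambda>y. w' y - k * y"]) (use lcr dq in auto)
  have "w' \<xi> - k * \<xi> \<le> w' \<eta> - k * \<eta>"
  proof (rule DERIV_nonpos_imp_nonincreasing[of \<eta> \<xi> "\<lambda>y. w' y - k * y"])
    fix y assume y: "\<eta> \<le> y" "y \<le> \<xi>"
    have "((\<lambda>y. w' y - k * y) has_real_derivative z y - k) (at y)"
      using w'[of y] y \<xi> \<eta> by (auto intro!: derivative_eq_intros)
    moreover have "z y - k \<le> 0" using z[of y] y \<xi> \<eta> by simp
    ultimately show "\<exists>d. ((\<lambda>y. w' y - k * y) has_real_derivative d) (at y) \<and> d \<le> 0" by blast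
  qed (use \<xi> \<eta> in simp)
  then have "(q r - q c) / (r - c) \<le> (q c - q l) / (c - l)" using \<xi> \<eta> lcr by simp
  moreover have "(q r - q c) / (r - c) = (w r - w c) / (r - c) - k * (r + c) / 2"
  proof -
    define X where "X = k * (r + c) / 2"
    have "q r - q c = (w r - w c) - (r - c) * X" by (simp add: q_def X_def power2_eq_square field_simps)
    then have "(q r - q c) / (r - c) = (w r - w c) / (r - c) - X" using lcr by (simp add: diff_divide_distrib)
    then show ?thesis by (simp add: X_def)
  qed
  moreover have "(q c - q l) / (c - l) = (w c - w l) / (c - l) - k * (c + l) / 2"
  proof -
    define X where "X = k * (c + l) / 2"
    have "q c - q l = (w c - w l) - (c - l) * X" by (simp add: q_def X_def power2_eq_square field_simps)
    then have "(q c - q l) / (c - l) = (w c - w l) / (c - l) - X" using lcr by (simp add: diff_divide_distrib)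
    then show ?thesis by (simp add: X_def)
  qed
  ultimately have "(w r - w c) / (r - c) - (w c - w l) / (c - l) \<le> k * (r + c) / 2 - k * (c + l) / 2"
    by linarith
  also have "\<dots> = k * (((c - l) + (r - c)) / 2)" by (simp add: field_simps)
  finally have "(w r - w c) / (r - c) - (w c - w l) / (c - l) \<le> k * (((c - l) + (r - c)) / 2)" .
  then show ?thesis using lcr by (simp add: divided_second_diff_def divide_le_eq)
qed

text \<open>On equal steps the second difference sees only the even part of \<open>w\<close> about
  \<open>c\<close>. As \<open>z = w''\<close> is convex,
  \<open>z (c + t) + z (c - t) \<ge> 2 * z c\<close>, and integrating twice in t yields the
  claim.\<close>

lemma divided_second_diff_ge_uniform:
  assumes lcr: "l < c" "c < r" and h: "r - c = c - l" and cont: "continuous_on {l..r} w"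
    and w: "\<And>y. l < y \<Longrightarrow> y < r \<Longrightarrow> (w has_real_derivative w' y) (at y)"
    and w': "\<And>y. l < y \<Longrightarrow> y < r \<Longrightarrow> (w' has_real_derivative z y) (at y)"
    and z: "\<And>y. l < y \<Longrightarrow> y < r \<Longrightarrow> (z has_real_derivative z' y) (at y)"
    and z': "\<And>y. l < y \<Longrightarrow> y < r \<Longrightarrow> (z' has_real_derivative z'' y) (at y)"
    and nonneg: "\<And>y. l < y \<Longrightarrow> y < r \<Longrightarrow> 0 \<le> z'' y"
  shows "z c \<le> divided_second_diff w l c r"
proof -
  define d where "d = r - c"
  have d: "0 < d" "l = c - d" "r = c + d" using lcr h by (auto simp: d_def)
  have plus: "((\<lambda>t. g (c + t)) has_real_derivative g' (c + t)) (at t)"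
    if "\<And>y. l < y \<Longrightarrow> y < r \<Longrightarrow> (g has_real_derivative g' y) (at y)" "0 \<le> t" "t < d" for g g' :: "real \<Rightarrow> real" and t
  proof -
    have 1: "((\<lambda>t. c + t) has_real_derivative 1) (at t)" by (auto intro!: derivative_eq_intros)
    show ?thesis using DERIV_chain2[OF that(1)[of "c + t"] 1] that d by simp
  qed
  have minus: "((\<lambda>t. g (c - t)) has_real_derivative - g' (c - t)) (at t)"
    if "\<And>y. l < y \<Longrightarrow> y < r \<Longrightarrow> (g has_real_derivative g' y) (at y)" "0 \<le> t" "t < d" for g g' :: "real \<Rightarrow> real" and t
  proof -
    have 1: "((\<lambda>t. c - t) has_real_derivative - 1) (at t)" by (auto intro!: derivative_eq_intros)
    show ?thesis using DERIV_chain2[OF that(1)[of "c - t"] 1] that d by simp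
  qed
  have z'_mono: "z' (c - t) \<le> z' (c + t)" if t: "0 \<le> t" "t < d" for t
    by (rule DERIV_nonneg_imp_nondecreasing) (use t d z' nonneg in \<open>force+\<close>)
  have z_convex: "2 * z c \<le> z (c + t) + z (c - t)" if t: "0 \<le> t" "t < d" for t
  proof -
    have "z (c + 0) + z (c - 0) \<le> z (c + t) + z (c - t)"
    proof (rule DERIV_nonneg_imp_nondecreasing[OF t(1)])
      fix s assume s: "0 \<le> s" "s \<le> t"
      have "((\<lambda>t. z (c + t) + z (c - t)) has_real_derivative z' (c + s) + - z' (c - s)) (at s)"
        by (intro DERIV_add plus minus z) (use s t in auto)
      then show "\<exists>y. ((\<lambda>t. z (c + t) + z (c - t)) has_real_derivative y) (at s) \<and> 0 \<le> y"
        using z'_mono[of s] s t by force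
    qed
    then show ?thesis by simp
  qed
  have slope: "0 \<le> w' (c + t) - w' (c - t) - 2 * t * z c" if t: "0 \<le> t" "t < d" for t
  proof -
    have "w' (c + 0) - w' (c - 0) - 2 * 0 * z c \<le> w' (c + t) - w' (c - t) - 2 * t * z c"
    proof (rule DERIV_nonneg_imp_nondecreasing[OF t(1)])
      fix s assume s: "0 \<le> s" "s \<le> t"
      have "((\<lambda>t. w' (c + t) - w' (c - t) - 2 * t * z c) has_real_derivative z (c + s) - - z (c - s) - 2 * z c) (at s)"
        by (intro DERIV_diff plus minus w') (use s t in \<open>auto intro!: derivative_eq_intros\<close>)
      then show "\<exists>y. ((\<lambda>t. w' (c + t) - w' (c - t) - 2 * t * z c) has_real_derivative y) (at s) \<and> 0 \<le> y"
        using z_convex[of s] s t by force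
    qed
    then show ?thesis by simp
  qed
  \<comment> \<open>The even part minus the parabola with the same second derivative at
    \<open>c\<close>; it is nondecreasing in t, and \<open>\<phi> d \<ge> \<phi> 0\<close> is the
    claim multiplied by \<open>d\<^sup>2\<close>.\<close>
  define \<phi> where "\<phi> t = w (c + t) + w (c - t) - t\<^sup>2 * z c" for t
  have contp: "continuous_on {0..d} (\<lambda>t. w (c + t))"
    by (rule continuous_on_compose2[OF cont]) (use d in \<open>auto intro!: continuous_intros\<close>)
  have contm: "continuous_on {0..d} (\<lambda>t. w (c - t))"
    by (rule continuous_on_compose2[OF cont]) (use d in \<open>auto intro!: continuous_intros\<close>)
  obtain \<xi> where \<xi>: "0 < \<xi>" "\<xi> < d" "\<phi> d - \<phi> 0 = (d - 0) * (w' (c + \<xi>) - w' (c - \<xi>) - 2 * \<xi> * z c)"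
  proof (rule mvt_real[OF d(1), of \<phi> "\<lambda>t. w' (c + t) - w' (c - t) - 2 * t * z c"])
    show "continuous_on {0..d} \<phi>" unfolding \<phi>_def by (intro continuous_intros contp contm)
    fix t assume t: "0 < t" "t < d"
    have "(\<phi> has_real_derivative (w' (c + t) + - w' (c - t)) - 2 * t * z c) (at t)"
      unfolding \<phi>_def by (intro DERIV_diff DERIV_add plus minus w) (use t in \<open>auto intro!: derivative_eq_intros\<close>)
    then show "(\<phi> has_real_derivative w' (c + t) - w' (c - t) - 2 * t * z c) (at t)" by simp
  qed blast
  then have "0 \<le> \<phi> d - \<phi> 0" using slope[of \<xi>] d by simp
  then have "z c * d\<^sup>2 \<le> w r + w l - 2 * w c" using d by (simp add: \<phi>_def mult.commute)
  moreover have "divided_second_diff w l c r = (w r + w l - 2 * w c) / d\<^sup>2"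
  proof -
    have "r - c = d" "c - l = d" using d by auto
    then show ?thesis using d(1) unfolding divided_second_diff_def by (simp add: field_simps power2_eq_square)
  qed
  ultimately show ?thesis using d by (simp add: le_divide_eq)
qed

text \<open>Both \<open>W + u\<close> and \<open>W - u\<close> have nonnegative fourth derivative,
  so the consistency error of \<open>u\<close> is at most that of \<open>W\<close>. Dropping
  \<open>W2 c \<ge> 0\<close> leaves the second difference of \<open>W\<close>, which never exceeds
  the supremum of \<open>W''\<close>. No power of the mesh width times a fourth derivative
  appears.\<close>

lemma truncation_uniform:
  assumes lcr: "l < c" "c < r" and h: "r - c = c - l" and contu: "continuous_on {l..r} u" and contW: "continuous_on {l..r} W"
    and u: "\<And>y. l < y \<Longrightarrow> y < r \<Longrightarrow> (u has_real_derivative V y) (at y) \<and> (V has_real_derivative G y) (at y)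
        \<and> (G has_real_derivative P y) (at y) \<and> (P has_real_derivative Q y) (at y)"
    and W: "\<And>y. l < y \<Longrightarrow> y < r \<Longrightarrow> (W has_real_derivative W1 y) (at y) \<and> (W1 has_real_derivative W2 y) (at y)
        \<and> (W2 has_real_derivative W3 y) (at y) \<and> (W3 has_real_derivative W4 y) (at y)"
    and Q: "\<And>y. l < y \<Longrightarrow> y < r \<Longrightarrow> \<bar>Q y\<bar> \<le> W4 y"
    and W2: "\<And>y. l < y \<Longrightarrow> y < r \<Longrightarrow> W2 y \<le> k" "0 \<le> W2 c"
  shows "\<bar>divided_second_diff u l c r - G c\<bar> \<le> k"
proof -
  have DW: "divided_second_diff W l c r \<le> k"
    by (rule divided_second_diff_le[OF lcr contW, of W1 W2]) (use W W2 in auto)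
  have "W2 c + s * G c \<le> divided_second_diff W l c r + s * divided_second_diff u l c r" if s: "s = 1 \<or> s = -1" for s
    unfolding divided_second_diff_linear[symmetric]
  proof (rule divided_second_diff_ge_uniform[OF lcr h, where z = "\<lambda>y. W2 y + s * G y" and w' = "\<lambda>y. W1 y + s * V y"
        and z' = "\<lambda>y. W3 y + s * P y" and z'' = "\<lambda>y. W4 y + s * Q y"])
    show "continuous_on {l..r} (\<lambda>y. W y + s * u y)" by (intro continuous_intros contu contW)
    fix y assume y: "l < y" "y < r"
    show "0 \<le> W4 y + s * Q y" using Q[OF y] s by auto
  qed (use u W in \<open>auto intro!: DERIV_add DERIV_cmult\<close>)
  from this[of 1] this[of "-1"] show ?thesis using DW W2(2) by (simp add: abs_le_iff)
qed

text \<open>For any spacing the second difference lies between the bounds of \<open>u''\<close> on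
  the interval, so its distance from \<open>u''\<close> at \<open>c\<close> is at most the
  oscillation.\<close>

lemma truncation_oscillation:
  assumes lcr: "l < c" "c < r" and contu: "continuous_on {l..r} u"
    and u: "\<And>y. l < y \<Longrightarrow> y < r \<Longrightarrow> (u has_real_derivative V y) (at y) \<and> (V has_real_derivative G y) (at y)"
    and G: "\<And>y. l < y \<Longrightarrow> y < r \<Longrightarrow> \<bar>G y - G c\<bar> \<le> k"
  shows "\<bar>divided_second_diff u l c r - G c\<bar> \<le> k"
proof -
  have "divided_second_diff u l c r \<le> G c + k"
    by (rule divided_second_diff_le[OF lcr contu, of V G]) (use u G in \<open>auto simp: abs_le_iff algebra_simps\<close>)
  moreover have "divided_second_diff (\<lambda>y. 0 + (-1) * u y) l c r \<le> - G c + k"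
  proof (rule divided_second_diff_le[OF lcr, of _ "\<lambda>y. 0 + (-1) * V y" "\<lambda>y. 0 + (-1) * G y"])
    show "continuous_on {l..r} (\<lambda>y. 0 + (-1) * u y)" by (intro continuous_intros contu)
    fix y assume y: "l < y" "y < r"
    show "((\<lambda>y. 0 + (-1) * u y) has_real_derivative 0 + (-1) * V y) (at y)"
      "((\<lambda>y. 0 + (-1) * V y) has_real_derivative 0 + (-1) * G y) (at y)"
      using u[OF y] by (auto intro!: derivative_eq_intros)
    show "0 + (-1) * G y \<le> - G c + k" using G[OF y] by (auto simp: abs_le_iff)
  qed
  moreover have "divided_second_diff (\<lambda>y. 0) l c r = 0" by (simp add: divided_second_diff_def)
  ultimately show ?thesis
    unfolding divided_second_diff_linear by (simp add: abs_le_iff)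
qed

lemma abs_layer'_le:
  assumes "0 \<le> \<alpha>" "0 \<le> e"
  shows "\<bar>layer' \<alpha> e x\<bar> \<le> sqrt (\<alpha> / e) * layer \<alpha> e x"
proof -
  have "0 \<le> exp (- (x * sqrt (\<alpha> / e)))" "0 \<le> exp (- ((1 - x) * sqrt (\<alpha> / e)))" by auto
  then have "\<bar>exp (- ((1 - x) * sqrt (\<alpha> / e))) - exp (- (x * sqrt (\<alpha> / e)))\<bar> \<le> layer \<alpha> e x"
    unfolding layer_def by linarith
  then show ?thesis using assms unfolding layer'_def abs_mult
    by (simp add: mult_left_mono)
qed

text \<open>Layers \<open>m\<close> with \<open>H \<le> \<Theta> * sqrt (\<epsilon> m)\<close> are resolved by the mesh, the others are negligible near the
  node \<open>c\<close>.\<close>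

locale truncation =
  fixes n :: nat and \<epsilon> :: "nat \<Rightarrow> real" and \<alpha> \<Theta> \<nu> H l c r :: real and i :: nat and K :: real
    and u V G P Q :: "real \<Rightarrow> real"
  assumes \<alpha>: "0 < \<alpha>" and K: "0 \<le> K" and i: "i \<in> {1..n}"
    and eps: "\<And>m. m \<in> {1..n} \<Longrightarrow> 0 < \<epsilon> m"
    and eps_mono: "\<And>i k. i \<in> {1..n} \<Longrightarrow> k \<in> {1..n} \<Longrightarrow> i \<le> k \<Longrightarrow> \<epsilon> i \<le> \<epsilon> k"
    and lcr: "0 \<le> l" "l < c" "c < r" "r \<le> 1" and H: "c - l \<le> H" "r - c \<le> H" "H \<le> \<Theta>"
    and \<nu>: "0 \<le> \<nu>"
    and dichotomy: "\<And>m. m \<in> {1..n} \<Longrightarrow> H \<le> \<Theta> * sqrt (\<epsilon> m) \<or> (\<forall>y\<in>{l..r}. layer \<alpha> (\<epsilon> m) y \<le> \<nu> * \<Theta>\<^sup>2)"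
    and contu: "continuous_on {0..1} u"
    and u: "\<And>y. y \<in> {0<..<1} \<Longrightarrow> (u has_real_derivative V y) (at y) \<and> (V has_real_derivative G y) (at y)
        \<and> (G has_real_derivative P y) (at y) \<and> (P has_real_derivative Q y) (at y)"
    and G: "\<And>y. y \<in> {0<..<1} \<Longrightarrow> \<bar>G y\<bar> \<le> K * (1 + (\<Sum>m=i..n. layer \<alpha> (\<epsilon> m) y / \<epsilon> m))"
    and Q: "\<And>y. y \<in> {0<..<1} \<Longrightarrow> \<bar>\<epsilon> i * Q y\<bar> \<le> K * (1 + (\<Sum>m=1..n. layer \<alpha> (\<epsilon> m) y / \<epsilon> m))"
    and P: "\<And>y. y \<in> {0<..<1} \<Longrightarrow> \<bar>\<epsilon> i * P y\<bar> \<le>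
        K * (sqrt (\<epsilon> i) + (\<Sum>m=1..n. min (sqrt (\<epsilon> i) / \<epsilon> m) (1 / sqrt (\<epsilon> m)) * layer \<alpha> (\<epsilon> m) y))"
begin

definition resolved :: "nat \<Rightarrow> bool" where "resolved m \<longleftrightarrow> H \<le> \<Theta> * sqrt (\<epsilon> m)"

lemma H_pos: "0 < H" using lcr H by auto

lemma unresolved: "m \<in> {1..n} \<Longrightarrow> \<not> resolved m \<Longrightarrow> l \<le> y \<Longrightarrow> y \<le> r \<Longrightarrow> layer \<alpha> (\<epsilon> m) y \<le> \<nu> * \<Theta>\<^sup>2"
  using dichotomy[of m] by (auto simp: resolved_def)

lemma resolved_le: "m \<in> {1..n} \<Longrightarrow> resolved m \<Longrightarrow> H\<^sup>2 / \<epsilon> m \<le> \<Theta>\<^sup>2"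
proof -
  assume m: "m \<in> {1..n}" and "resolved m"
  then have "H\<^sup>2 \<le> (\<Theta> * sqrt (\<epsilon> m))\<^sup>2" using H_pos by (intro power_mono) (auto simp: resolved_def)
  then show ?thesis using eps[OF m] by (simp add: power_mult_distrib divide_le_eq)
qed

lemma layer_2: "m \<in> {1..n} \<Longrightarrow> l \<le> y \<Longrightarrow> y \<le> r \<Longrightarrow> layer \<alpha> (\<epsilon> m) y \<le> 2"
  using layer_le_2[of \<alpha> "\<epsilon> m" y] \<alpha> eps[of m] lcr by auto

lemma sub_unit: "l < y \<Longrightarrow> y < r \<Longrightarrow> y \<in> {0<..<1}" using lcr by auto

lemma contu': "continuous_on {l..r} u" using lcr by (intro continuous_on_subset[OF contu]) auto

text \<open>In the majorant, resolved layers are replaced by the constant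
  \<open>2 / \<epsilon> m\<close>; their part of \<open>W2\<close> is at most of order
  \<open>H\<^sup>2 / \<epsilon> m \<le> \<Theta>\<^sup>2\<close>. Unresolved layers, collected in
  \<open>F\<close>, stay exponentials, and their part \<open>B m / \<alpha>\<close> of
  \<open>W2\<close> is negligible however large \<open>H\<^sup>2 / \<epsilon> m\<close> is.\<close>

lemma truncation_error_uniform:
  assumes h: "r - c = c - l"
  shows "\<bar>\<epsilon> i * (divided_second_diff u l c r - G c)\<bar> \<le> K * (1 + 2 * real n + real n * \<nu> / \<alpha>) * \<Theta>\<^sup>2"
proof -
  let ?B = "\<lambda>m. layer \<alpha> (\<epsilon> m)" and ?B' = "\<lambda>m. layer' \<alpha> (\<epsilon> m)"
  define F where "F = {m \<in> {1..n}. \<not> resolved m}"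
  define \<kappa> where "\<kappa> = 1 + (\<Sum>m\<in>{1..n} - F. 2 / \<epsilon> m)"
  define W W1 W2 W3 W4 where
    "W y = K * (\<kappa> * ((y - c) ^ 4 / 24) + (\<Sum>m\<in>F. \<epsilon> m / \<alpha>\<^sup>2 * ?B m y))" and
    "W1 y = K * (\<kappa> * ((y - c) ^ 3 / 6) + (\<Sum>m\<in>F. \<epsilon> m / \<alpha>\<^sup>2 * ?B' m y))" and
    "W2 y = K * (\<kappa> * ((y - c) ^ 2 / 2) + (\<Sum>m\<in>F. 1 / \<alpha> * ?B m y))" and
    "W3 y = K * (\<kappa> * (y - c) + (\<Sum>m\<in>F. 1 / \<alpha> * ?B' m y))" and
    "W4 y = K * (\<kappa> + (\<Sum>m\<in>F. ?B m y / \<epsilon> m))" for y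
  have F: "F \<subseteq> {1..n}" "finite F" by (auto simp: F_def)
  have dB: "(?B m has_real_derivative ?B' m y) (at y)" for m y by (rule has_derivative_layer)
  have dB': "(?B' m has_real_derivative \<alpha> / \<epsilon> m * ?B m y) (at y)" if "m \<in> F" for m y
    using \<alpha> eps[of m] that F by (intro has_derivative_layer') auto
  have "\<bar>divided_second_diff (\<lambda>y. \<epsilon> i * u y) l c r - \<epsilon> i * G c\<bar> \<le> K * (1 + 2 * real n + real n * \<nu> / \<alpha>) * \<Theta>\<^sup>2"
  proof (rule truncation_uniform[OF lcr(2,3) h, where W = W and ?W1.0 = W1 and ?W2.0 = W2 and ?W3.0 = W3 and ?W4.0 = W4
        and V = "\<lambda>y. \<epsilon> i * V y" and G = "\<lambda>y. \<epsilon> i * G y" and P = "\<lambda>y. \<epsilon> i * P y" and Q = "\<lambda>y. \<epsilon> i * Q y"])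
    show "continuous_on {l..r} (\<lambda>y. \<epsilon> i * u y)" by (intro continuous_intros contu')
    show "continuous_on {l..r} W" unfolding W_def by (intro continuous_intros continuous_on_layer) auto
    show "0 \<le> W2 c" unfolding W2_def using K \<alpha> by (simp add: sum_nonneg layer_nonneg)
    fix y assume y: "l < y" "y < r"
    note y01 = sub_unit[OF y]
    show "((\<lambda>y. \<epsilon> i * u y) has_real_derivative \<epsilon> i * V y) (at y) \<and> ((\<lambda>y. \<epsilon> i * V y) has_real_derivative \<epsilon> i * G y) (at y)
        \<and> ((\<lambda>y. \<epsilon> i * G y) has_real_derivative \<epsilon> i * P y) (at y) \<and> ((\<lambda>y. \<epsilon> i * P y) has_real_derivative \<epsilon> i * Q y) (at y)"
      using u[OF y01] by (auto intro!: DERIV_cmult)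
    have "((\<lambda>y. (y - c) ^ 4 / 24) has_real_derivative (y - c) ^ 3 / 6) (at y)"
      "((\<lambda>y. (y - c) ^ 3 / 6) has_real_derivative (y - c) ^ 2 / 2) (at y)"
      "((\<lambda>y. (y - c) ^ 2 / 2) has_real_derivative (y - c)) (at y)"
      by (auto intro!: derivative_eq_intros)
    note poly = this
    have W1: "(W has_real_derivative W1 y) (at y)" unfolding W_def W1_def
      by (intro DERIV_cmult DERIV_add DERIV_sum poly dB)
    have W3: "(W2 has_real_derivative W3 y) (at y)" unfolding W2_def W3_def
      by (intro DERIV_cmult DERIV_add DERIV_sum poly dB)
    have "(W1 has_real_derivative K * (\<kappa> * ((y - c) ^ 2 / 2) + (\<Sum>m\<in>F. \<epsilon> m / \<alpha>\<^sup>2 * (\<alpha> / \<epsilon> m * ?B m y)))) (at y)"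
      unfolding W1_def by (intro DERIV_cmult DERIV_add DERIV_sum poly dB')
    moreover have "(\<Sum>m\<in>F. \<epsilon> m / \<alpha>\<^sup>2 * (\<alpha> / \<epsilon> m * ?B m y)) = (\<Sum>m\<in>F. 1 / \<alpha> * ?B m y)"
    proof (rule sum.cong)
      fix m assume "m \<in> F"
      then show "\<epsilon> m / \<alpha>\<^sup>2 * (\<alpha> / \<epsilon> m * ?B m y) = 1 / \<alpha> * ?B m y"
        using eps[of m] F \<alpha> by (auto simp: power2_eq_square)
    qed simp
    ultimately have W2: "(W1 has_real_derivative W2 y) (at y)" by (simp add: W2_def)
    have "(W3 has_real_derivative K * (\<kappa> * 1 + (\<Sum>m\<in>F. 1 / \<alpha> * (\<alpha> / \<epsilon> m * ?B m y)))) (at y)"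
      unfolding W3_def by (intro DERIV_cmult DERIV_add DERIV_sum dB') (auto intro!: derivative_eq_intros)
    then have W4: "(W3 has_real_derivative W4 y) (at y)" using \<alpha> by (simp add: W4_def)
    show "(W has_real_derivative W1 y) (at y) \<and> (W1 has_real_derivative W2 y) (at y)
        \<and> (W2 has_real_derivative W3 y) (at y) \<and> (W3 has_real_derivative W4 y) (at y)"
      using W1 W2 W3 W4 by blast
    have "(\<Sum>m=1..n. ?B m y / \<epsilon> m) = (\<Sum>m\<in>{1..n} - F. ?B m y / \<epsilon> m) + (\<Sum>m\<in>F. ?B m y / \<epsilon> m)"
      using F by (intro sum.subset_diff) auto
    also have "(\<Sum>m\<in>{1..n} - F. ?B m y / \<epsilon> m) \<le> (\<Sum>m\<in>{1..n} - F. 2 / \<epsilon> m)"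
    proof (rule sum_mono)
      fix m assume m: "m \<in> {1..n} - F"
      then show "?B m y / \<epsilon> m \<le> 2 / \<epsilon> m" using layer_2[of m y] eps[of m] y by (intro divide_right_mono) auto
    qed
    finally have "K * (1 + (\<Sum>m=1..n. ?B m y / \<epsilon> m)) \<le> W4 y"
      unfolding W4_def \<kappa>_def using K by (intro mult_left_mono) auto
    then show "\<bar>\<epsilon> i * Q y\<bar> \<le> W4 y" using Q[OF y01] by linarith
    have sq: "(y - c)\<^sup>2 \<le> H\<^sup>2" using y H by (auto simp flip: abs_le_square_iff)
    have "\<kappa> * ((y - c)\<^sup>2 / 2) \<le> \<kappa> * H\<^sup>2"
    proof (rule mult_left_mono)
      have "0 \<le> (\<Sum>m\<in>{1..n} - F. 2 / \<epsilon> m)" using eps by (intro sum_nonneg) (auto intro!: divide_nonneg_nonneg less_imp_le)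
      then show "0 \<le> \<kappa>" by (simp add: \<kappa>_def)
      show "(y - c)\<^sup>2 / 2 \<le> H\<^sup>2" using sq zero_le_power2[of "y - c"] by linarith
    qed
    also have "\<kappa> * H\<^sup>2 = H\<^sup>2 + (\<Sum>m\<in>{1..n} - F. 2 / \<epsilon> m * H\<^sup>2)"
      by (simp add: \<kappa>_def distrib_right sum_distrib_right)
    also have "(\<Sum>m\<in>{1..n} - F. 2 / \<epsilon> m * H\<^sup>2) = 2 * (\<Sum>m\<in>{1..n} - F. H\<^sup>2 / \<epsilon> m)"
      by (simp add: sum_distrib_left)
    also have "H\<^sup>2 + 2 * (\<Sum>m\<in>{1..n} - F. H\<^sup>2 / \<epsilon> m) \<le> \<Theta>\<^sup>2 + 2 * (real n * \<Theta>\<^sup>2)"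
    proof (intro add_mono mult_left_mono)
      show "H\<^sup>2 \<le> \<Theta>\<^sup>2" using H H_pos by (intro power_mono) auto
      have "(\<Sum>m\<in>{1..n} - F. H\<^sup>2 / \<epsilon> m) \<le> real (card ({1..n} - F)) * \<Theta>\<^sup>2"
        by (intro sum_bounded_above resolved_le) (auto simp: F_def)
      also have "\<dots> \<le> real n * \<Theta>\<^sup>2"
        using card_mono[of "{1..n}" "{1..n} - F"] by (intro mult_right_mono) auto
      finally show "(\<Sum>m\<in>{1..n} - F. H\<^sup>2 / \<epsilon> m) \<le> real n * \<Theta>\<^sup>2" .
    qed simp
    finally have 1: "\<kappa> * ((y - c)\<^sup>2 / 2) \<le> \<Theta>\<^sup>2 + 2 * (real n * \<Theta>\<^sup>2)" .
    have "(\<Sum>m\<in>F. 1 / \<alpha> * ?B m y) \<le> real (card F) * (1 / \<alpha> * (\<nu> * \<Theta>\<^sup>2))"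
    proof (rule sum_bounded_above)
      fix m assume m: "m \<in> F"
      show "1 / \<alpha> * ?B m y \<le> 1 / \<alpha> * (\<nu> * \<Theta>\<^sup>2)"
        using unresolved[of m y] m y \<alpha> by (intro mult_left_mono) (auto simp: F_def)
    qed
    also have "\<dots> \<le> real n * (1 / \<alpha> * (\<nu> * \<Theta>\<^sup>2))"
      using card_mono[of "{1..n}" F] F \<nu> \<alpha> by (intro mult_right_mono) auto
    finally have "W2 y \<le> K * ((\<Theta>\<^sup>2 + 2 * (real n * \<Theta>\<^sup>2)) + real n * (1 / \<alpha> * (\<nu> * \<Theta>\<^sup>2)))"
      unfolding W2_def using 1 K by (intro mult_left_mono add_mono)
    then show "W2 y \<le> K * (1 + 2 * real n + real n * \<nu> / \<alpha>) * \<Theta>\<^sup>2" by (simp add: algebra_simps)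
  qed
  moreover have "divided_second_diff (\<lambda>y. 0 + \<epsilon> i * u y) l c r = divided_second_diff (\<lambda>y. 0) l c r + \<epsilon> i * divided_second_diff u l c r"
    by (rule divided_second_diff_linear)
  moreover have "divided_second_diff (\<lambda>y. 0) l c r = 0" by (simp add: divided_second_diff_def)
  ultimately show ?thesis by (simp add: right_diff_distrib)
qed

lemma truncation_error_oscillation:
  assumes "\<And>y. l < y \<Longrightarrow> y < r \<Longrightarrow> \<bar>\<epsilon> i * G y - \<epsilon> i * G c\<bar> \<le> k"
  shows "\<bar>\<epsilon> i * (divided_second_diff u l c r - G c)\<bar> \<le> k"
proof -
  have "\<bar>divided_second_diff (\<lambda>y. \<epsilon> i * u y) l c r - \<epsilon> i * G c\<bar> \<le> k"
    by (rule truncation_oscillation[OF lcr(2,3), where V = "\<lambda>y. \<epsilon> i * V y" and G = "\<lambda>y. \<epsilon> i * G y"])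
      (use assms u sub_unit in \<open>auto intro!: continuous_intros contu' DERIV_cmult\<close>)
  moreover have "divided_second_diff (\<lambda>y. 0 + \<epsilon> i * u y) l c r = divided_second_diff (\<lambda>y. 0) l c r + \<epsilon> i * divided_second_diff u l c r"
    by (rule divided_second_diff_linear)
  moreover have "divided_second_diff (\<lambda>y. 0) l c r = 0" by (simp add: divided_second_diff_def)
  ultimately show ?thesis by (simp add: right_diff_distrib)
qed

text \<open>If the step exceeds \<open>sqrt (\<epsilon> i)\<close>, no cancellation is required,
  since \<open>\<epsilon> i * u''\<close> is small by itself: for a resolved layer \<open>\<epsilon>
  i / \<epsilon> m \<le> H\<^sup>2 / \<epsilon> m \<le> \<Theta>\<^sup>2\<close>, and an unresolved
  layer with m \<ge> i is negligible while
  \<open>\<epsilon> i / \<epsilon> m \<le> 1\<close>.\<close>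

lemma truncation_error_coarse:
  assumes coarse: "sqrt (\<epsilon> i) \<le> H"
  shows "\<bar>\<epsilon> i * (divided_second_diff u l c r - G c)\<bar> \<le> 2 * K * (1 + real n * (2 + \<nu>)) * \<Theta>\<^sup>2"
proof (rule truncation_error_oscillation)
  have ei: "0 < \<epsilon> i" by (rule eps[OF i])
  have eH: "\<epsilon> i \<le> H\<^sup>2" using coarse ei by (metis abs_of_pos real_sqrt_abs real_sqrt_le_iff H_pos)
  have H\<Theta>: "H\<^sup>2 \<le> \<Theta>\<^sup>2" using H H_pos by (intro power_mono) auto
  have G_le: "\<bar>\<epsilon> i * G y\<bar> \<le> K * (1 + real n * (2 + \<nu>)) * \<Theta>\<^sup>2" if y: "l < y" "y < r" for y
  proof -
    have "\<bar>\<epsilon> i * G y\<bar> = \<epsilon> i * \<bar>G y\<bar>" using ei by (simp add: abs_mult)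
    also have "\<dots> \<le> \<epsilon> i * (K * (1 + (\<Sum>m=i..n. layer \<alpha> (\<epsilon> m) y / \<epsilon> m)))"
      using G[OF sub_unit[OF y]] ei by (intro mult_left_mono) auto
    also have "\<dots> = K * (\<epsilon> i + (\<Sum>m=i..n. \<epsilon> i / \<epsilon> m * layer \<alpha> (\<epsilon> m) y))"
      by (simp add: sum_distrib_left algebra_simps)
    also have "\<dots> \<le> K * (\<Theta>\<^sup>2 + real n * ((2 + \<nu>) * \<Theta>\<^sup>2))"
    proof (intro mult_left_mono add_mono K)
      show "\<epsilon> i \<le> \<Theta>\<^sup>2" using eH H\<Theta> by linarith
      have "(\<Sum>m=i..n. \<epsilon> i / \<epsilon> m * layer \<alpha> (\<epsilon> m) y) \<le> real (card {i..n}) * ((2 + \<nu>) * \<Theta>\<^sup>2)"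
      proof (rule sum_bounded_above)
        fix m assume "m \<in> {i..n}"
        then have m: "m \<in> {1..n}" "i \<le> m" using i by auto
        have em: "0 < \<epsilon> m" by (rule eps[OF m(1)])
        show "\<epsilon> i / \<epsilon> m * layer \<alpha> (\<epsilon> m) y \<le> (2 + \<nu>) * \<Theta>\<^sup>2"
        proof (cases "resolved m")
          case True
          have "\<epsilon> i / \<epsilon> m \<le> H\<^sup>2 / \<epsilon> m" using eH em by (intro divide_right_mono) auto
          then have "\<epsilon> i / \<epsilon> m \<le> \<Theta>\<^sup>2" using resolved_le[OF m(1) True] by linarith
          then have "\<epsilon> i / \<epsilon> m * layer \<alpha> (\<epsilon> m) y \<le> \<Theta>\<^sup>2 * 2"
            using layer_2[OF m(1), of y] y layer_nonneg by (intro mult_mono) auto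
          also have "\<dots> \<le> (2 + \<nu>) * \<Theta>\<^sup>2" using \<nu> by (simp add: distrib_right)
          finally show ?thesis .
        next
          case False
          have "\<epsilon> i / \<epsilon> m * layer \<alpha> (\<epsilon> m) y \<le> 1 * (\<nu> * \<Theta>\<^sup>2)"
            using unresolved[OF m(1) False, of y] y eps_mono[OF i m] em layer_nonneg by (intro mult_mono) auto
          also have "\<dots> \<le> (2 + \<nu>) * \<Theta>\<^sup>2" by (simp add: distrib_right)
          finally show ?thesis .
        qed
      qed
      also have "\<dots> \<le> real n * ((2 + \<nu>) * \<Theta>\<^sup>2)" using i \<nu> by (intro mult_right_mono) auto
      finally show "(\<Sum>m=i..n. \<epsilon> i / \<epsilon> m * layer \<alpha> (\<epsilon> m) y) \<le> real n * ((2 + \<nu>) * \<Theta>\<^sup>2)" .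
    qed
    also have "\<dots> = K * (1 + real n * (2 + \<nu>)) * \<Theta>\<^sup>2" by (simp add: algebra_simps)
    finally show ?thesis .
  qed
  fix y assume y: "l < y" "y < r"
  show "\<bar>\<epsilon> i * G y - \<epsilon> i * G c\<bar> \<le> 2 * K * (1 + real n * (2 + \<nu>)) * \<Theta>\<^sup>2"
    using G_le[OF y] G_le[OF lcr(2,3)] by linarith
qed

text \<open>The oscillation of \<open>\<epsilon> i * u''\<close> is the integral of the third
  derivative bound over one step. A resolved layer uses the first entry of the minimum and gives
  \<open>H * sqrt (\<epsilon> i) / \<epsilon> m\<close>, hence the factor
  \<open>sqrt (\<epsilon> i) / H\<close>. An unresolved layer uses the second entry and is
  integrated exactly, so that no factor H is left to estimate.\<close>

lemma truncation_error_fine: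
  "\<bar>\<epsilon> i * (divided_second_diff u l c r - G c)\<bar>
     \<le> K * (1 + 2 * real n + 2 * real n * \<nu> / sqrt \<alpha>) * \<Theta>\<^sup>2 * (1 + sqrt (\<epsilon> i) / H)"
proof (rule truncation_error_oscillation)
  let ?B = "\<lambda>m. layer \<alpha> (\<epsilon> m)" and ?B' = "\<lambda>m. layer' \<alpha> (\<epsilon> m)"
  have ei: "0 < \<epsilon> i" by (rule eps[OF i])
  \<comment> \<open>Upper bound of \<open>sqrt (\<epsilon> i) / \<epsilon> m\<close> for every
    resolved layer, as \<open>1 / \<epsilon> m \<le> \<Theta>\<^sup>2 / H\<^sup>2\<close>.\<close>
  define s where "s = sqrt (\<epsilon> i) * \<Theta>\<^sup>2 / H\<^sup>2"
  define \<rho> where "\<rho> m t = (if resolved m then 2 * s * t else sqrt (\<epsilon> m) / \<alpha> * ?B' m t)" for m t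
  define \<rho>' where "\<rho>' m t = (if resolved m then 2 * s else ?B m t / sqrt (\<epsilon> m))" for m t
  define R where "R t = K * (sqrt (\<epsilon> i) * t + (\<Sum>m=1..n. \<rho> m t))" for t
  have s0: "0 \<le> s" using ei by (simp add: s_def)
  have dr: "(\<rho> m has_real_derivative \<rho>' m t) (at t)" if m: "m \<in> {1..n}" for m t
  proof (cases "resolved m")
    case True
    then show ?thesis unfolding \<rho>_def \<rho>'_def by (auto intro!: derivative_eq_intros)
  next
    case False
    have "((\<lambda>t. sqrt (\<epsilon> m) / \<alpha> * ?B' m t) has_real_derivative sqrt (\<epsilon> m) / \<alpha> * (\<alpha> / \<epsilon> m * ?B m t)) (at t)"
      using \<alpha> eps[OF m] by (intro DERIV_cmult has_derivative_layer') auto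
    moreover have "sqrt (\<epsilon> m) / \<alpha> * (\<alpha> / \<epsilon> m * ?B m t) = sqrt (\<epsilon> m) / \<epsilon> m * ?B m t"
      using \<alpha> by simp
    moreover have "sqrt (\<epsilon> m) / \<epsilon> m = 1 / sqrt (\<epsilon> m)" using eps[OF m] by (simp add: field_simps)
    ultimately show ?thesis using False unfolding \<rho>_def \<rho>'_def by simp
  qed
  have bound: "R q - R p \<le> K * (1 + 2 * real n + 2 * real n * \<nu> / sqrt \<alpha>) * \<Theta>\<^sup>2 * (1 + sqrt (\<epsilon> i) / H)"
    if pq: "l < p" "p \<le> q" "q < r" "q - p \<le> H" for p q
  proof -
    have "\<rho> m q - \<rho> m p \<le> 2 * (sqrt (\<epsilon> i) * \<Theta>\<^sup>2 / H) + 2 * \<nu> / sqrt \<alpha> * \<Theta>\<^sup>2" if m: "m \<in> {1..n}" for m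
    proof (cases "resolved m")
      case True
      have "\<rho> m q - \<rho> m p = 2 * s * (q - p)" using True by (simp add: \<rho>_def right_diff_distrib)
      also have "\<dots> \<le> 2 * s * H" using pq s0 by (intro mult_left_mono) auto
      also have "\<dots> = 2 * (sqrt (\<epsilon> i) * \<Theta>\<^sup>2 / H)" using H_pos by (simp add: s_def power2_eq_square)
      moreover have "0 \<le> 2 * \<nu> / sqrt \<alpha> * \<Theta>\<^sup>2" using \<nu> \<alpha> by simp
      ultimately show ?thesis by linarith
    next
      case False
      have B': "\<bar>sqrt (\<epsilon> m) / \<alpha> * ?B' m t\<bar> \<le> \<nu> / sqrt \<alpha> * \<Theta>\<^sup>2" if t: "l \<le> t" "t \<le> r" for t
      proof -
        have "\<bar>sqrt (\<epsilon> m) / \<alpha> * ?B' m t\<bar> = sqrt (\<epsilon> m) / \<alpha> * \<bar>?B' m t\<bar>"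
          using \<alpha> eps[OF m] by (simp add: abs_mult)
        also have "\<dots> \<le> sqrt (\<epsilon> m) / \<alpha> * (sqrt (\<alpha> / \<epsilon> m) * ?B m t)"
          using \<alpha> eps[OF m] by (intro mult_left_mono abs_layer'_le) auto
        also have "\<dots> = sqrt \<alpha> / \<alpha> * ?B m t" using \<alpha> eps[OF m] by (simp add: real_sqrt_divide)
        also have "sqrt \<alpha> / \<alpha> = 1 / sqrt \<alpha>" using \<alpha> by (simp add: field_simps)
        also have "1 / sqrt \<alpha> * ?B m t \<le> 1 / sqrt \<alpha> * (\<nu> * \<Theta>\<^sup>2)"
          using unresolved[OF m False t] \<alpha> by (intro mult_left_mono) auto
        finally show ?thesis by simp
      qed
      have "\<rho> m q - \<rho> m p \<le> 2 * (\<nu> / sqrt \<alpha> * \<Theta>\<^sup>2)"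
      proof -
        have "\<rho> m t = sqrt (\<epsilon> m) / \<alpha> * ?B' m t" for t using False by (simp add: \<rho>_def)
        then show ?thesis using B'[of q] B'[of p] pq by (simp only:) linarith
      qed
      moreover have "0 \<le> 2 * (sqrt (\<epsilon> i) * \<Theta>\<^sup>2 / H)" using ei H_pos by simp
      ultimately show ?thesis by (simp add: mult.assoc)
    qed
    then have "(\<Sum>m=1..n. \<rho> m q - \<rho> m p) \<le> real n * (2 * (sqrt (\<epsilon> i) * \<Theta>\<^sup>2 / H) + 2 * \<nu> / sqrt \<alpha> * \<Theta>\<^sup>2)"
      using sum_bounded_above[of "{1..n}" "\<lambda>m. \<rho> m q - \<rho> m p"] by simp
    moreover have "sqrt (\<epsilon> i) * (q - p) \<le> sqrt (\<epsilon> i) * \<Theta>\<^sup>2 / H"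
    proof -
      have "(q - p) * H \<le> H * H" using pq H_pos by (intro mult_right_mono) auto
      also have "\<dots> \<le> \<Theta> * \<Theta>" using H H_pos by (intro mult_mono) auto
      finally have "q - p \<le> \<Theta>\<^sup>2 / H" using H_pos by (simp add: le_divide_eq power2_eq_square)
      then have "sqrt (\<epsilon> i) * (q - p) \<le> sqrt (\<epsilon> i) * (\<Theta>\<^sup>2 / H)" using ei by (intro mult_left_mono) auto
      then show ?thesis by simp
    qed
    ultimately have le: "sqrt (\<epsilon> i) * (q - p) + (\<Sum>m=1..n. \<rho> m q - \<rho> m p)
       \<le> sqrt (\<epsilon> i) * \<Theta>\<^sup>2 / H + real n * (2 * (sqrt (\<epsilon> i) * \<Theta>\<^sup>2 / H) + 2 * \<nu> / sqrt \<alpha> * \<Theta>\<^sup>2)"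
      by linarith
    also have "\<dots> = (1 + 2 * real n) * (\<Theta>\<^sup>2 * (sqrt (\<epsilon> i) / H)) + 2 * real n * \<nu> / sqrt \<alpha> * \<Theta>\<^sup>2"
      by (simp add: algebra_simps add_divide_distrib)
    also have "\<dots> \<le> (1 + 2 * real n + 2 * real n * \<nu> / sqrt \<alpha>) * \<Theta>\<^sup>2 * (1 + sqrt (\<epsilon> i) / H)"
    proof -
      define a where "a = 1 + 2 * real n"
      define k where "k = 2 * real n * \<nu> / sqrt \<alpha>"
      define t where "t = sqrt (\<epsilon> i) / H"
      define T where "T = \<Theta>\<^sup>2"
      have p: "0 \<le> a" "0 \<le> k" "0 \<le> t" "0 \<le> T" using \<nu> \<alpha> ei H_pos by (auto simp: a_def k_def t_def T_def)
      then have "0 \<le> a * T + k * (T * t)" by simp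
      then have "a * (T * t) + k * T \<le> (a + k) * T * (1 + t)" by (simp add: algebra_simps)
      then show ?thesis by (simp add: a_def k_def t_def T_def)
    qed
    finally have "K * (sqrt (\<epsilon> i) * (q - p) + (\<Sum>m=1..n. \<rho> m q - \<rho> m p))
      \<le> K * ((1 + 2 * real n + 2 * real n * \<nu> / sqrt \<alpha>) * \<Theta>\<^sup>2 * (1 + sqrt (\<epsilon> i) / H))"
      using K by (rule mult_left_mono)
    then show ?thesis by (simp add: R_def sum_subtractf algebra_simps)
  qed
  have diff: "\<bar>\<epsilon> i * G q - \<epsilon> i * G p\<bar> \<le> R q - R p" if pq: "l < p" "p \<le> q" "q < r" for p q
  proof (rule abs_diff_le_of_deriv_le[where g = "\<lambda>t. \<epsilon> i * G t" and g' = "\<lambda>t. \<epsilon> i * P t" and R = R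
        and R' = "\<lambda>t. K * (sqrt (\<epsilon> i) * 1 + (\<Sum>m=1..n. \<rho>' m t))"])
    fix t assume "p \<le> t" "t \<le> q"
    then have t: "l < t" "t < r" using pq by auto
    show "((\<lambda>t. \<epsilon> i * G t) has_real_derivative \<epsilon> i * P t) (at t)" using u[OF sub_unit[OF t]] by (intro DERIV_cmult) auto
    show "(R has_real_derivative K * (sqrt (\<epsilon> i) * 1 + (\<Sum>m=1..n. \<rho>' m t))) (at t)"
      unfolding R_def by (intro DERIV_cmult DERIV_add DERIV_sum DERIV_ident dr)
    have "(\<Sum>m=1..n. min (sqrt (\<epsilon> i) / \<epsilon> m) (1 / sqrt (\<epsilon> m)) * ?B m t) \<le> (\<Sum>m=1..n. \<rho>' m t)"
    proof (rule sum_mono)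
      fix m assume m: "m \<in> {1..n}"
      let ?min = "min (sqrt (\<epsilon> i) / \<epsilon> m) (1 / sqrt (\<epsilon> m))"
      have em: "0 < \<epsilon> m" by (rule eps[OF m])
      show "?min * ?B m t \<le> \<rho>' m t"
      proof (cases "resolved m")
        case True
        have "1 / \<epsilon> m \<le> \<Theta>\<^sup>2 / H\<^sup>2" using resolved_le[OF m True] H_pos em by (simp add: field_simps)
        then have "sqrt (\<epsilon> i) * (1 / \<epsilon> m) \<le> sqrt (\<epsilon> i) * (\<Theta>\<^sup>2 / H\<^sup>2)" using ei by (intro mult_left_mono) auto
        then have "?min \<le> s" by (simp add: s_def)
        then have "?min * ?B m t \<le> s * 2" using layer_2[OF m, of t] t layer_nonneg s0 by (intro mult_mono) auto
        then show ?thesis using True by (simp add: \<rho>'_def)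
      next
        case False
        have "?min * ?B m t \<le> 1 / sqrt (\<epsilon> m) * ?B m t" using layer_nonneg by (intro mult_right_mono) auto
        then show ?thesis using False by (simp add: \<rho>'_def)
      qed
    qed
    then have "K * (sqrt (\<epsilon> i) + (\<Sum>m=1..n. min (sqrt (\<epsilon> i) / \<epsilon> m) (1 / sqrt (\<epsilon> m)) * ?B m t))
        \<le> K * (sqrt (\<epsilon> i) * 1 + (\<Sum>m=1..n. \<rho>' m t))" using K by (intro mult_left_mono) auto
    then show "\<bar>\<epsilon> i * P t\<bar> \<le> K * (sqrt (\<epsilon> i) * 1 + (\<Sum>m=1..n. \<rho>' m t))" using P[OF sub_unit[OF t]] by linarith
  qed (use pq in simp)
  fix y assume y: "l < y" "y < r"
  show "\<bar>\<epsilon> i * G y - \<epsilon> i * G c\<bar>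
      \<le> K * (1 + 2 * real n + 2 * real n * \<nu> / sqrt \<alpha>) * \<Theta>\<^sup>2 * (1 + sqrt (\<epsilon> i) / H)"
  proof (cases "c \<le> y")
    case True
    then show ?thesis using diff[of c y] bound[of c y] y lcr H by auto
  next
    case False
    then show ?thesis using diff[of y c] bound[of y c] y lcr H by (auto simp: abs_minus_commute)
  qed
qed

end

section \<open>The Shishkin mesh\<close>

text \<open>With \<open>\<tau> (n + 1) = 1 / 2\<close> the recursion holds for \<open>i = n\<close> as well, and the middle region has
  width at most \<open>2 * \<tau> (n + 1)\<close>.\<close>

definition transition :: "nat \<Rightarrow> (nat \<Rightarrow> real) \<Rightarrow> real \<Rightarrow> nat \<Rightarrow> nat \<Rightarrow> real" where
  "transition n \<epsilon> \<alpha> N i = (if i = 0 then 0 else if i = n + 1 then 1 / 2 else trans_point n \<epsilon> \<alpha> N i)"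

definition layer_width :: "(nat \<Rightarrow> real) \<Rightarrow> real \<Rightarrow> nat \<Rightarrow> nat \<Rightarrow> real" where
  "layer_width \<epsilon> \<alpha> N m = 2 * sqrt (\<epsilon> m / \<alpha>) * ln (real N)"

lemma transition_rec:
  assumes "i \<in> {1..n}"
  shows "transition n \<epsilon> \<alpha> N i = min (transition n \<epsilon> \<alpha> N (i + 1) / 2) (layer_width \<epsilon> \<alpha> N i)"
proof (cases "i < n")
  case True
  then show ?thesis using assms
    by (simp add: transition_def layer_width_def trans_point.simps[of n \<epsilon> \<alpha> N i])
next
  case False
  then have "i = n" using assms by simp
  then show ?thesis using assms
    by (simp add: transition_def layer_width_def trans_point.simps[of n \<epsilon> \<alpha> N n])
qed

text \<open>At the distance \<open>2 * sqrt (e / \<alpha>) * ln N\<close> an exponential has decayed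
  to N^-2. The factor 2 in the transition parameters is thus the order of convergence.\<close>

lemma layer_le_at_layer_width:
  assumes \<alpha>: "0 < \<alpha>" and e: "0 < e" and N: "1 < N"
    and t: "2 * sqrt (e / \<alpha>) * ln (real N) \<le> t" "t \<le> y" "y \<le> 1 - t"
  shows "layer \<alpha> e y \<le> 2 / (real N)\<^sup>2"
proof -
  let ?s = "sqrt (\<alpha> / e)"
  have s: "0 < ?s" "sqrt (e / \<alpha>) * ?s = 1" using \<alpha> e by (auto simp flip: real_sqrt_mult)
  have key: "exp (- (z * ?s)) \<le> 1 / (real N)\<^sup>2" if z: "t \<le> z" for z
  proof -
    have "2 * ln (real N) = 2 * ln (real N) * (sqrt (e / \<alpha>) * ?s)" using s by simp
    also have "\<dots> = 2 * sqrt (e / \<alpha>) * ln (real N) * ?s" by (simp only: mult_ac)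
    also have "\<dots> \<le> z * ?s" using t z s by (intro mult_right_mono) auto
    finally have "exp (- (z * ?s)) \<le> exp (- (2 * ln (real N)))" by simp
    also have "\<dots> = 1 / (real N)\<^sup>2" using N by (simp add: exp_minus exp_double field_simps flip: ln_realpow)
    finally show ?thesis .
  qed
  show ?thesis using key[of y] key[of "1 - y"] t unfolding layer_def by simp
qed

locale layer_mesh =
  fixes n :: nat and \<epsilon> :: "nat \<Rightarrow> real" and \<alpha> :: real and N :: nat
  assumes n: "1 \<le> n" and \<alpha>: "0 < \<alpha>" and adm: "admissible_N n N"
    and eps: "\<And>i. i \<in> {1..n} \<Longrightarrow> 0 < \<epsilon> i"
    and eps_mono: "\<And>i k. i \<in> {1..n} \<Longrightarrow> k \<in> {1..n} \<Longrightarrow> i \<le> k \<Longrightarrow> \<epsilon> i \<le> \<epsilon> k"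
begin

lemma N: "1 < N" using adm by (simp add: admissible_N_def)

abbreviation "\<tau> \<equiv> transition n \<epsilon> \<alpha> N"
abbreviation "\<omega> \<equiv> layer_width \<epsilon> \<alpha> N"

lemma ln_N_pos: "0 < ln (real N)" using N by simp

lemma ln_N_ge_half: "1 / 2 \<le> ln (real N)"
proof -
  have "1 / 2 \<le> ln (2::real)"
  proof -
    have "exp (1 / 2 :: real) ^ 2 \<le> 2 ^ 2"
      using exp_le by (simp flip: exp_double)
    then have "exp (1 / 2 :: real) \<le> 2" by (rule power2_le_imp_le) simp
    then show ?thesis by (subst ln_ge_iff) auto
  qed
  also have "ln 2 \<le> ln (real N)" using N by simp
  finally show ?thesis .
qed

lemma width_pos: "i \<in> {1..n} \<Longrightarrow> 0 < \<omega> i"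
  using eps \<alpha> ln_N_pos by (simp add: layer_width_def)

lemma width_mono: "i \<in> {1..n} \<Longrightarrow> k \<in> {1..n} \<Longrightarrow> i \<le> k \<Longrightarrow> \<omega> i \<le> \<omega> k"
  unfolding layer_width_def using eps_mono[of i k] \<alpha> ln_N_pos
  by (intro mult_right_mono mult_left_mono) (auto intro!: divide_right_mono)

lemma transition_pos: "i \<in> {1..n + 1} \<Longrightarrow> 0 < \<tau> i"
proof (induction "n + 1 - i" arbitrary: i)
  case 0
  then show ?case by (simp add: transition_def)
next
  case (Suc d)
  then have i: "i \<in> {1..n}" by auto
  have "0 < \<tau> (i + 1)" using Suc i by (intro Suc.hyps) auto
  then show ?case using width_pos[OF i] by (simp add: transition_rec[OF i])
qed

lemma transition_half: "i \<in> {1..n} \<Longrightarrow> \<tau> i \<le> \<tau> (i + 1) / 2"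
  by (simp add: transition_rec)

lemma transition_less_Suc: "i \<in> {0..n} \<Longrightarrow> \<tau> i < \<tau> (i + 1)"
  using transition_pos[of "i + 1"] transition_half[of i]
  by (cases "i = 0") (auto simp: transition_def[of n \<epsilon> \<alpha> N 0])

lemma transition_le_half: "i \<in> {0..n + 1} \<Longrightarrow> \<tau> i \<le> 1 / 2"
proof (induction "n + 1 - i" arbitrary: i)
  case 0
  then show ?case by (simp add: transition_def)
next
  case (Suc d)
  then have i: "i \<in> {0..n}" by auto
  have "\<tau> (i + 1) \<le> 1 / 2" using Suc by (intro Suc.hyps) auto
  then show ?case using transition_less_Suc[OF i] by simp
qed

lemma transition_le_quarter: "i \<in> {0..n} \<Longrightarrow> \<tau> i \<le> 1 / 4"
  using transition_half[of i] transition_le_half[of "i + 1"] by (cases "i = 0") (auto simp: transition_def[of n \<epsilon> \<alpha> N 0])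

text \<open>Starting from \<open>\<tau> m\<close>, each transition point is either half of the next,
  in which case the bound for the next one doubles, or has its own full width
  \<open>\<omega> k \<ge> \<omega> m\<close>. In the latter case the first alternative holds from
  there on, since the transition points increase.\<close>

lemma transition_alternative:
  assumes m: "m \<in> {1..n}" and k: "m < k" "k \<le> n + 1"
  shows "\<omega> m \<le> \<tau> (k - 1) \<or> \<tau> k \<le> 2 ^ (k - m) * \<omega> m"
  using k
proof (induction k)
  case (Suc k)
  show ?case
  proof (cases "m = k")
    case True
    then show ?thesis using transition_rec[OF m, of \<epsilon> \<alpha> N] by (auto simp: min_def split: if_splits)
  next
    case False
    then have k: "m < k" "k \<in> {1..n}" using Suc.prems m by auto
    from Suc.IH consider "\<omega> m \<le> \<tau> (k - 1)" | "\<tau> k \<le> 2 ^ (k - m) * \<omega> m" using k by force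
    then show ?thesis
    proof cases
      case 1
      moreover have "k - 1 \<in> {0..n}" "k - 1 + 1 = k" using k by auto
      ultimately show ?thesis using transition_less_Suc[of "k - 1"] by simp
    next
      case 2
      consider "\<tau> k = \<tau> (k + 1) / 2" | "\<tau> k = \<omega> k"
        using transition_rec[OF k(2), of \<epsilon> \<alpha> N] by (auto simp: min_def split: if_splits)
      then show ?thesis
      proof cases
        case 1
        then have "\<tau> (Suc k) \<le> 2 * (2 ^ (k - m) * \<omega> m)" using 2 by simp
        then show ?thesis using k by (simp add: Suc_diff_le)
      next
        case 2
        then show ?thesis using width_mono[OF m k(2)] k by simp
      qed
    qed
  qed
qed simp

text \<open>One factor \<open>2 ^ (n + 1)\<close> comes from the smallest share
  \<open>N / 2 ^ (n + 1)\<close> of mesh intervals in a strip, another from the powers of 2 in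
  \<open>transition_alternative\<close>, and the last 2 from the layer width. The summand
  \<open>1 / sqrt \<alpha>\<close> serves the bound relative to \<open>sqrt (\<epsilon> m)\<close>,
  the summand 1 the absolute bound.\<close>

definition mesh_scale :: real where
  "mesh_scale = 2 ^ (2 * n + 3) * (1 + 1 / sqrt \<alpha>) * (ln (real N) / real N)"

text \<open>The dichotomy that makes the mesh layer-adapted: on every mesh interval a layer is either
  resolved by the local mesh width or already negligible.\<close>

definition adapted_interval :: "real \<Rightarrow> real \<Rightarrow> bool" where
  "adapted_interval s t \<longleftrightarrow> s < t \<and> t - s \<le> mesh_scale \<and>
     (\<forall>m\<in>{1..n}. t - s \<le> mesh_scale * sqrt (\<epsilon> m) \<or> (\<forall>y\<in>{s..t}. layer \<alpha> (\<epsilon> m) y \<le> 2 / (real N)\<^sup>2))"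

text \<open>The index k names the strip between \<open>\<tau> (k - 1)\<close> and
  \<open>\<tau> k\<close> or its mirror image; k = n + 1 is the middle region. A layer m \<ge> k is
  resolved because \<open>\<tau> k \<le> \<omega> k \<le> \<omega> m\<close>. For m < k, either the
  strip lies beyond the width of layer m, or \<open>\<tau> k\<close> is still comparable with that
  width.\<close>

lemma adapted_intervalI:
  assumes k: "k \<in> {1..n + 1}" and st: "s < t" "t - s \<le> 2 ^ (n + 1) * \<tau> k / real N"
    and loc: "\<tau> (k - 1) \<le> s" "t \<le> 1 - \<tau> (k - 1)"
  shows "adapted_interval s t"
proof -
  let ?L = "ln (real N) / real N"
  have L: "0 < ?L" using ln_N_pos N by simp
  have sa: "0 < 1 / sqrt \<alpha>" using \<alpha> by simp
  have base: "2 ^ (n + 1) * 2 ^ (n + 1) * (1 / sqrt \<alpha> * 2 * ?L) = 2 ^ (2 * n + 3) * (1 / sqrt \<alpha>) * ?L"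
  proof -
    have "2 * n + 3 = (n + 1) + (n + 1) + 1" by simp
    then have "(2::real) ^ (2 * n + 3) = 2 ^ (n + 1) * 2 ^ (n + 1) * 2"
      by (simp only: power_add power_one_right)
    then show ?thesis by (simp only: mult_ac)
  qed
  have "t - s \<le> mesh_scale"
  proof -
    have "2 ^ (n + 1) * \<tau> k \<le> 2 ^ (2 * n + 3) * (1 + 1 / sqrt \<alpha>) * ln (real N)"
    proof -
      have "2 ^ (n + 1) * \<tau> k \<le> 2 ^ (2 * n + 3) * (1 / 2)"
        using transition_le_half[of k] k transition_pos[of k]
        by (intro mult_mono power_increasing) auto
      also have "\<dots> \<le> 2 ^ (2 * n + 3) * ((1 + 1 / sqrt \<alpha>) * ln (real N))"
      proof (intro mult_left_mono)
        have "1 * (1 / 2) \<le> (1 + 1 / sqrt \<alpha>) * ln (real N)" using sa ln_N_ge_half by (intro mult_mono) auto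
        then show "1 / 2 \<le> (1 + 1 / sqrt \<alpha>) * ln (real N)" by simp
      qed simp
      finally show ?thesis by (simp add: mult.assoc)
    qed
    then have "2 ^ (n + 1) * \<tau> k / real N \<le> 2 ^ (2 * n + 3) * (1 + 1 / sqrt \<alpha>) * ln (real N) / real N"
      by (rule divide_right_mono) simp
    then show ?thesis using st(2) by (simp add: mesh_scale_def)
  qed
  moreover have "t - s \<le> mesh_scale * sqrt (\<epsilon> m) \<or> (\<forall>y\<in>{s..t}. layer \<alpha> (\<epsilon> m) y \<le> 2 / (real N)\<^sup>2)" if m: "m \<in> {1..n}" for m
  proof -
    have fine: "t - s \<le> mesh_scale * sqrt (\<epsilon> m)" if tk: "\<tau> k \<le> 2 ^ (n + 1) * \<omega> m"
    proof -
      have "t - s \<le> 2 ^ (n + 1) * (2 ^ (n + 1) * \<omega> m) / real N"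
        using tk by (intro order_trans[OF st(2)] divide_right_mono mult_left_mono) auto
      also have "\<dots> = 2 ^ (n + 1) * 2 ^ (n + 1) * (1 / sqrt \<alpha> * 2 * ?L) * sqrt (\<epsilon> m)"
        by (simp add: layer_width_def real_sqrt_divide mult_ac)
      also have "\<dots> = 2 ^ (2 * n + 3) * (1 / sqrt \<alpha>) * ?L * sqrt (\<epsilon> m)" unfolding base ..
      also have "\<dots> \<le> 2 ^ (2 * n + 3) * (1 + 1 / sqrt \<alpha>) * ?L * sqrt (\<epsilon> m)"
        using L eps[OF m] by (intro mult_right_mono mult_left_mono) auto
      finally show ?thesis by (simp add: mesh_scale_def)
    qed
    show ?thesis
    proof (cases "m < k")
      case True
      from transition_alternative[OF m True] consider "\<omega> m \<le> \<tau> (k - 1)" | "\<tau> k \<le> 2 ^ (k - m) * \<omega> m" using k by force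
      then show ?thesis
      proof cases
        case 1
        have "layer \<alpha> (\<epsilon> m) y \<le> 2 / (real N)\<^sup>2" if "y \<in> {s..t}" for y
          using 1 loc that by (intro layer_le_at_layer_width[OF \<alpha> eps[OF m] N, of "\<tau> (k - 1)"]) (auto simp: layer_width_def)
        then show ?thesis by blast
      next
        case 2
        also have "2 ^ (k - m) * \<omega> m \<le> 2 ^ (n + 1) * \<omega> m"
          using k m width_pos[OF m] by (intro mult_right_mono power_increasing) auto
        finally show ?thesis using fine by blast
      qed
    next
      case False
      then have k': "k \<in> {1..n}" "k \<le> m" using k m by auto
      have "\<tau> k \<le> \<omega> k" by (simp add: transition_rec[OF k'(1)])
      also have "\<dots> \<le> 1 * \<omega> m" using width_mono[OF k'(1) m k'(2)] by simp
      also have "\<dots> \<le> 2 ^ (n + 1) * \<omega> m" using width_pos[OF m] by (intro mult_right_mono one_le_power) auto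
      finally show ?thesis using fine by blast
    qed
  qed
  ultimately show ?thesis using st(1) by (simp add: adapted_interval_def)
qed

end

section \<open>Meshes glued together from uniform pieces\<close>

definition adapted_list :: "(real \<Rightarrow> real \<Rightarrow> bool) \<Rightarrow> nat \<Rightarrow> real list \<Rightarrow> bool" where
  "adapted_list R c xs \<longleftrightarrow> xs \<noteq> [] \<and> (\<forall>j. j + 1 < length xs \<longrightarrow> R (xs ! j) (xs ! (j + 1))) \<and>
     (\<exists>J. finite J \<and> card J \<le> c \<and>
       (\<forall>j. j + 2 < length xs \<and> j + 1 \<notin> J \<longrightarrow> xs ! (j + 2) - xs ! (j + 1) = xs ! (j + 1) - xs ! j))"

lemma last_uniform_points: "0 < M \<Longrightarrow> last (xs @ uniform_points a b M) = b"
  by (simp add: uniform_points_def last_append last_map)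

text \<open>Inside the old list and inside the new piece nothing changes, so the old last point is
  the only additional candidate for unequal neighbouring steps. Hence the exceptional set grows by
  one index for each piece.\<close>

lemma adapted_list_append:
  assumes xs: "adapted_list R c xs" and a: "last xs = a" and M: "0 < M"
    and R: "\<And>k. k < M \<Longrightarrow> R (a + real k * ((b - a) / real M)) (a + real (k + 1) * ((b - a) / real M))"
  shows "adapted_list R (c + 1) (xs @ uniform_points a b M)"
proof -
  let ?ys = "xs @ uniform_points a b M" and ?d = "(b - a) / real M" and ?l = "length xs"
  obtain J where J: "finite J" "card J \<le> c"
    "\<And>j. j + 2 < ?l \<Longrightarrow> j + 1 \<notin> J \<Longrightarrow> xs ! (j + 2) - xs ! (j + 1) = xs ! (j + 1) - xs ! j"
    using xs unfolding adapted_list_def by blast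
  have ne: "xs \<noteq> []" and l: "0 < ?l" using xs by (auto simp: adapted_list_def)
  have len: "length ?ys = ?l + M" by (simp add: uniform_points_def)
  have old: "?ys ! j = xs ! j" if "j < ?l" for j using that by (simp add: nth_append)
  \<comment> \<open>Counting from the junction, k = 0 is the old last point; this makes the new
    piece a complete uniform grid including its left end.\<close>
  have new: "?ys ! (?l - 1 + k) = a + real k * ?d" if "k \<le> M" for k
  proof (cases k)
    case 0
    then show ?thesis using a l ne by (simp add: nth_append last_conv_nth)
  next
    case (Suc k')
    then have "?l - 1 + k = ?l + k'" using l by simp
    then have "?ys ! (?l - 1 + k) = uniform_points a b M ! k'" by (simp only: nth_append_length_plus)
    then show ?thesis using Suc that by (simp add: uniform_points_def del: upt_Suc)
  qed
  show ?thesis unfolding adapted_list_def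
  proof (intro conjI exI[of _ "insert (?l - 1) J"] allI impI)
    fix j assume j: "j + 1 < length ?ys"
    show "R (?ys ! j) (?ys ! (j + 1))"
    proof (cases "j + 1 < ?l")
      case True
      then show ?thesis using xs by (simp add: old adapted_list_def)
    next
      case False
      define k where "k = j - (?l - 1)"
      have k: "j = ?l - 1 + k" "k < M" using False j l len by (auto simp: k_def)
      show ?thesis using R[OF k(2)] new[of k] new[of "k + 1"] k by (simp add: add.assoc)
    qed
  next
    fix j assume j: "j + 2 < length ?ys \<and> j + 1 \<notin> insert (?l - 1) J"
    show "?ys ! (j + 2) - ?ys ! (j + 1) = ?ys ! (j + 1) - ?ys ! j"
    proof (cases "j + 2 < ?l")
      case True
      then show ?thesis using J(3)[OF True] j by (simp add: old)
    next
      case False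
      define k where "k = j - (?l - 1)"
      have k: "j = ?l - 1 + k" "k + 2 \<le> M" using False j l len by (auto simp: k_def)
      define d where "d = ?d"
      have "?ys ! j = a + real k * d" "?ys ! (j + 1) = a + real (k + 1) * d" "?ys ! (j + 2) = a + real (k + 2) * d"
        using new[of k] new[of "k + 1"] new[of "k + 2"] k by (simp_all add: add.assoc d_def)
      then show ?thesis by (simp add: algebra_simps)
    qed
  next
    show "finite (insert (?l - 1) J)" "card (insert (?l - 1) J) \<le> c + 1"
      using J by (auto simp: card_insert_if)
  qed (use ne in auto)
qed

text \<open>\<open>p l\<close> is the break point at which the l-th piece starts. The induction over
  the pieces shifts \<open>p\<close> by one, which is why \<open>p\<close>, the list and the counter
  are generalised.\<close>

lemma adapted_list_concat:
  fixes p :: "nat \<Rightarrow> real"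
  assumes xs: "adapted_list R c xs" and last: "last xs = p 0"
    and M: "\<And>l. l < length ks \<Longrightarrow> 0 < M (ks ! l)"
    and lo: "\<And>l. l < length ks \<Longrightarrow> lo (ks ! l) = p l" and hi: "\<And>l. l < length ks \<Longrightarrow> hi (ks ! l) = p (Suc l)"
    and R: "\<And>i k. i \<in> set ks \<Longrightarrow> k < M i \<Longrightarrow>
      R (lo i + real k * ((hi i - lo i) / real (M i))) (lo i + real (k + 1) * ((hi i - lo i) / real (M i)))"
  shows "adapted_list R (c + length ks) (xs @ concat (map (\<lambda>i. uniform_points (lo i) (hi i) (M i)) ks))
    \<and> last (xs @ concat (map (\<lambda>i. uniform_points (lo i) (hi i) (M i)) ks)) = p (length ks)"
  using assms
proof (induction "ks" arbitrary: xs c p)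
  case (Cons i "ks")
  let ?ys = "xs @ uniform_points (lo i) (hi i) (M i)"
  have Mi: "0 < M i" using Cons.prems(3)[of 0] by simp
  have 1: "adapted_list R (c + 1) ?ys"
    using Cons.prems(2) Cons.prems(4)[of 0] by (intro adapted_list_append Cons.prems(1) Mi Cons.prems(6)) auto
  have 2: "last ?ys = p (Suc 0)" using last_uniform_points[OF Mi] Cons.prems(5)[of 0] by simp
  have "adapted_list R (c + 1 + length ks) (?ys @ concat (map (\<lambda>i. uniform_points (lo i) (hi i) (M i)) ks))
    \<and> last (?ys @ concat (map (\<lambda>i. uniform_points (lo i) (hi i) (M i)) ks)) = p (Suc (length ks))"
  proof (rule Cons.IH[OF 1, of "\<lambda>l. p (Suc l)"])
    fix l assume "l < length ks"
    then show "0 < M (ks ! l)" "lo (ks ! l) = p (Suc l)" "hi (ks ! l) = p (Suc (Suc l))"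
      using Cons.prems(3,4,5)[of "Suc l"] by auto
  qed (use 2 Cons.prems(6) in auto)
  then show ?case by simp
qed simp

context layer_mesh
begin

lemma adapted_subinterval:
  assumes k: "k \<in> {1..n + 1}" and "lo < hi" and w: "(hi - lo) / real M \<le> 2 ^ (n + 1) * \<tau> k / real N"
    and loc: "\<tau> (k - 1) \<le> lo" "hi \<le> 1 - \<tau> (k - 1)" and j: "j < M"
  shows "adapted_interval (lo + real j * ((hi - lo) / real M)) (lo + real (j + 1) * ((hi - lo) / real M))"
proof -
  define d where "d = (hi - lo) / real M"
  have d: "0 < d" "real M * d = hi - lo" using assms by (auto simp: d_def)
  have "real (j + 1) * d \<le> real M * d" using j d by (intro mult_right_mono) auto
  then have "lo + real (j + 1) * d \<le> 1 - \<tau> (k - 1)" using d loc by simp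
  moreover have "\<tau> (k - 1) \<le> lo + real j * d" using loc d by (simp add: add_increasing2)
  ultimately show ?thesis
    using d w unfolding d_def[symmetric]
    by (intro adapted_intervalI[OF k]) (auto simp: algebra_simps)
qed

text \<open>One exceptional index per uniform piece gives 1 + (n - 1) + 1 + (n - 1) + 1 = 2n + 1;
  the first of them is the end point 0.\<close>

lemma shishkin_adapted:
  "adapted_list adapted_interval (2 * n + 1) (shishkin_points n \<epsilon> \<alpha> N) \<and> last (shishkin_points n \<epsilon> \<alpha> N) = 1"
proof -
  define M where "M i = N div 2 ^ (n - i + 2)" for i
  define M0 where "M0 = N div 2 ^ (n + 1)"
  have N0: "0 < real N" using N by simp
  have M0: "real M0 = real N / 2 ^ (n + 1)" using adm by (simp add: M0_def admissible_N_def real_of_nat_div)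
  have Mi: "real (M i) = real N / 2 ^ (n - i + 2)" if "i \<in> {1..<n}" for i
  proof -
    have "2 ^ (n - i + 2) dvd N" using adm that unfolding admissible_N_def by blast
    then show ?thesis unfolding M_def by (simp add: real_of_nat_div del: power_Suc power_add)
  qed
  have Mh: "real (N div 2) = real N / 2" using adm by (simp add: admissible_N_def real_of_nat_div)
  have pos: "0 < M0" "0 < N div 2" using M0 Mh N0 by (auto intro!: gr0I)
  have posi: "0 < M i" if "i \<in> {1..<n}" for i using Mi[OF that] N0 by (auto intro!: gr0I)
  have eq: "shishkin_points n \<epsilon> \<alpha> N =
      (((([0] @ uniform_points 0 (\<tau> 1) M0)
      @ concat (map (\<lambda>i. uniform_points (\<tau> i) (\<tau> (i + 1)) (M i)) [1..<n]))
      @ uniform_points (\<tau> n) (1 - \<tau> n) (N div 2))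
      @ concat (map (\<lambda>i. uniform_points (1 - \<tau> (i + 1)) (1 - \<tau> i) (M i)) (rev [1..<n])))
      @ uniform_points (1 - \<tau> 1) 1 M0"
  proof -
    have tr: "trans_point n \<epsilon> \<alpha> N i = \<tau> i" if "i \<in> {1..n}" for i using that by (simp add: transition_def)
    have 1: "map (\<lambda>i. uniform_points (trans_point n \<epsilon> \<alpha> N i) (trans_point n \<epsilon> \<alpha> N (i + 1)) (N div 2 ^ (n - i + 2))) [1..<n]
      = map (\<lambda>i. uniform_points (\<tau> i) (\<tau> (i + 1)) (M i)) [1..<n]"
      by (rule map_cong) (auto simp: tr M_def)
    have 2: "map (\<lambda>i. uniform_points (1 - trans_point n \<epsilon> \<alpha> N (i + 1)) (1 - trans_point n \<epsilon> \<alpha> N i) (N div 2 ^ (n - i + 2))) (rev [1..<n])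
      = map (\<lambda>i. uniform_points (1 - \<tau> (i + 1)) (1 - \<tau> i) (M i)) (rev [1..<n])"
      by (rule map_cong) (auto simp: tr M_def)
    show ?thesis unfolding shishkin_points_def Let_def 1 2 using n by (simp add: tr M0_def)
  qed
  have reg: "(\<tau> (i + 1) - \<tau> i) / real (M i) \<le> 2 ^ (n + 1) * \<tau> (i + 1) / real N"
    "0 < \<tau> i" "\<tau> i < \<tau> (i + 1)" "\<tau> i \<le> 1 / 4" "\<tau> (i + 1) \<le> 1 / 2" if i: "i \<in> {1..<n}" for i
  proof -
    show p: "0 < \<tau> i" "\<tau> i < \<tau> (i + 1)" "\<tau> i \<le> 1 / 4" "\<tau> (i + 1) \<le> 1 / 2" using transition_pos[of i] transition_less_Suc[of i] transition_le_quarter[of i] transition_le_half[of "i + 1"] i by auto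
    have "(\<tau> (i + 1) - \<tau> i) * 2 ^ (n - i + 2) \<le> \<tau> (i + 1) * 2 ^ (n + 1)"
      using p i by (intro mult_mono power_increasing) auto
    then have "(\<tau> (i + 1) - \<tau> i) * 2 ^ (n - i + 2) / real N \<le> \<tau> (i + 1) * 2 ^ (n + 1) / real N"
      using N0 by (intro divide_right_mono) auto
    then show "(\<tau> (i + 1) - \<tau> i) / real (M i) \<le> 2 ^ (n + 1) * \<tau> (i + 1) / real N"
      using N0 by (simp add: Mi[OF i] mult.commute)
  qed
  have "\<tau> 0 = 0" "\<tau> (n + 1) = 1 / 2" by (simp_all add: transition_def)
  then have s1: "0 < \<tau> 1" "\<tau> 1 \<le> 1 / 4" "0 < \<tau> n" "\<tau> n \<le> 1 / 4" "\<tau> 0 = 0" "\<tau> (n + 1) = 1 / 2"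
    using transition_pos[of 1] transition_pos[of n] transition_le_quarter[of 1] transition_le_quarter[of n] n by auto
  let ?l1 = "[0] @ uniform_points 0 (\<tau> 1) M0"
  let ?l2 = "?l1 @ concat (map (\<lambda>i. uniform_points (\<tau> i) (\<tau> (i + 1)) (M i)) [1..<n])"
  let ?l3 = "?l2 @ uniform_points (\<tau> n) (1 - \<tau> n) (N div 2)"
  let ?l4 = "?l3 @ concat (map (\<lambda>i. uniform_points (1 - \<tau> (i + 1)) (1 - \<tau> i) (M i)) (rev [1..<n]))"
  have "adapted_list adapted_interval 0 [0]" by (auto simp: adapted_list_def)
  then have "adapted_list adapted_interval (0 + 1) ?l1"
  proof (rule adapted_list_append)
    fix k assume "k < M0"
    then show "adapted_interval (0 + real k * ((\<tau> 1 - 0) / real M0)) (0 + real (k + 1) * ((\<tau> 1 - 0) / real M0))"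
      using s1 M0 by (intro adapted_subinterval[of 1]) (auto simp: mult.commute)
  qed (use pos in auto)
  moreover have "last ?l1 = \<tau> 1" using pos by (intro last_uniform_points)
  ultimately have 2: "adapted_list adapted_interval (0 + 1 + length [1..<n]) ?l2 \<and> last ?l2 = \<tau> (Suc (length [1..<n]))"
  proof (intro adapted_list_concat[where p = "\<lambda>l. \<tau> (Suc l)"])
    fix i k assume i: "i \<in> set [1..<n]" and k: "k < M i"
    show "adapted_interval (\<tau> i + real k * ((\<tau> (i + 1) - \<tau> i) / real (M i))) (\<tau> i + real (k + 1) * ((\<tau> (i + 1) - \<tau> i) / real (M i)))"
      using reg[of i] i k by (intro adapted_subinterval[of "i + 1"]) auto
  qed (auto intro!: posi)
  then have "adapted_list adapted_interval n ?l2" "last ?l2 = \<tau> n" using n by simp_all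
  then have "adapted_list adapted_interval (n + 1) ?l3"
  proof (rule adapted_list_append)
    fix k assume "k < N div 2"
    \<comment> \<open>The middle region has width at most 1 and N/2 intervals, so its step is at
      most 2/N; the right side is \<open>2 ^ n / N\<close>, which is at least as large since n \<ge>
      1.\<close>
    moreover have "(1 - \<tau> n - \<tau> n) / real (N div 2) \<le> 2 ^ (n + 1) * \<tau> (n + 1) / real N"
    proof -
      have "2 ^ 1 \<le> (2::real) ^ n" using n by (intro power_increasing) auto
      then have "(1 - \<tau> n - \<tau> n) * 2 \<le> 2 ^ (n + 1) * \<tau> (n + 1)" using s1(3) unfolding s1(6) by simp
      then have "(1 - \<tau> n - \<tau> n) * 2 / real N \<le> 2 ^ (n + 1) * \<tau> (n + 1) / real N" using N0 by (intro divide_right_mono) auto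
      then show ?thesis by (simp add: Mh)
    qed
    ultimately show "adapted_interval (\<tau> n + real k * ((1 - \<tau> n - \<tau> n) / real (N div 2))) (\<tau> n + real (k + 1) * ((1 - \<tau> n - \<tau> n) / real (N div 2)))"
      using s1 by (intro adapted_subinterval[of "n + 1"]) auto
  qed (use pos in auto)
  moreover have "last ?l3 = 1 - \<tau> (n - 0)" by (simp only: last_uniform_points[OF pos(2)] diff_zero)
  ultimately have 4: "adapted_list adapted_interval (n + 1 + length (rev [1..<n])) ?l4 \<and> last ?l4 = 1 - \<tau> (n - length (rev [1..<n]))"
  proof (intro adapted_list_concat[where p = "\<lambda>l. 1 - \<tau> (n - l)"])
    fix i k assume i: "i \<in> set (rev [1..<n])" and k: "k < M i"
    show "adapted_interval (1 - \<tau> (i + 1) + real k * ((1 - \<tau> i - (1 - \<tau> (i + 1))) / real (M i)))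
       (1 - \<tau> (i + 1) + real (k + 1) * ((1 - \<tau> i - (1 - \<tau> (i + 1))) / real (M i)))"
      using reg[of i] i k by (intro adapted_subinterval[of "i + 1"]) auto
  next
    fix l assume l: "l < length (rev [1..<n])"
    then have r: "rev [1..<n] ! l = n - Suc l" by (simp add: rev_nth)
    show "0 < M (rev [1..<n] ! l)" using l unfolding r by (intro posi) auto
    show "1 - \<tau> (rev [1..<n] ! l + 1) = 1 - \<tau> (n - l)" using l unfolding r by (simp add: Suc_diff_Suc)
    show "1 - \<tau> (rev [1..<n] ! l) = 1 - \<tau> (n - Suc l)" unfolding r ..
  qed auto
  then have "adapted_list adapted_interval (2 * n) ?l4" "last ?l4 = 1 - \<tau> 1" using n by (simp_all add: mult_2)
  then have "adapted_list adapted_interval (2 * n + 1) (?l4 @ uniform_points (1 - \<tau> 1) 1 M0)"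
  proof (rule adapted_list_append)
    fix k assume "k < M0"
    then show "adapted_interval (1 - \<tau> 1 + real k * ((1 - (1 - \<tau> 1)) / real M0)) (1 - \<tau> 1 + real (k + 1) * ((1 - (1 - \<tau> 1)) / real M0))"
      using s1 M0 by (intro adapted_subinterval[of 1]) (auto simp: mult.commute)
  qed (use pos in auto)
  moreover have "last (?l4 @ uniform_points (1 - \<tau> 1) 1 M0) = 1" using pos by (intro last_uniform_points)
  ultimately show ?thesis unfolding eq by blast
qed

lemma shishkin_mesh_adapted:
  defines "x \<equiv> shishkin_mesh n \<epsilon> \<alpha> N"
  obtains J where "finite J" "card J \<le> 2 * n + 1" "x 0 = 0" "x N = 1"
    "\<And>j. j < N \<Longrightarrow> adapted_interval (x j) (x (j + 1))"
    "\<And>j. j \<in> {1..N - 1} \<Longrightarrow> j \<notin> J \<Longrightarrow> x (j + 1) - x j = x j - x (j - 1)"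
proof -
  let ?p = "shishkin_points n \<epsilon> \<alpha> N"
  have len: "length ?p = N + 1" using n adm by (rule length_shishkin_points)
  have ad: "adapted_list adapted_interval (2 * n + 1) ?p" and last: "last ?p = 1"
    using conjunct1[OF shishkin_adapted] conjunct2[OF shishkin_adapted] .
  have a: "\<forall>j. j + 1 < length ?p \<longrightarrow> adapted_interval (?p ! j) (?p ! (j + 1))"
    using ad unfolding adapted_list_def by (elim conjE)
  have "\<exists>J. finite J \<and> card J \<le> 2 * n + 1 \<and>
      (\<forall>j. j + 2 < length ?p \<and> j + 1 \<notin> J \<longrightarrow> ?p ! (j + 2) - ?p ! (j + 1) = ?p ! (j + 1) - ?p ! j)"
    using ad unfolding adapted_list_def by (elim conjE)
  then obtain J where J: "finite J" "card J \<le> 2 * n + 1"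
    and J3: "\<forall>j. j + 2 < length ?p \<and> j + 1 \<notin> J \<longrightarrow> ?p ! (j + 2) - ?p ! (j + 1) = ?p ! (j + 1) - ?p ! j"
    by (elim conjE exE)
  show ?thesis
  proof (rule that[OF J(1,2)])
    have x: "x j = ?p ! j" for j unfolding x_def shishkin_mesh_def ..
    show "x 0 = 0" unfolding x shishkin_points_def Let_def by (simp only: append_Cons nth_Cons_0)
    have "?p \<noteq> []" using len by auto
    from last_conv_nth[OF this] show "x N = 1" unfolding x last len by simp
    show "adapted_interval (x j) (x (j + 1))" if "j < N" for j
      unfolding x by (rule a[rule_format]) (use that len in simp)
    show "x (j + 1) - x j = x j - x (j - 1)" if j: "j \<in> {1..N - 1}" "j \<notin> J" for j
    proof -
      have e: "j - 1 + 2 = j + 1" "j - 1 + 1 = j" using j by auto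
      have "j - 1 + 2 < length ?p \<and> j - 1 + 1 \<notin> J" unfolding e len using j by auto
      from J3[rule_format, OF this] show ?thesis unfolding x e .
    qed
  qed
qed

end

section \<open>Discrete comparison and barriers\<close>

text \<open>The exponential bounds the factor by which a layer can grow across one interval that
  resolves it, as \<open>mesh_scale * sqrt \<alpha>\<close> is at most this exponent. The 2 stems
  from the bound \<open>2 / N\<^sup>2\<close>.\<close>

definition negligible_const :: "nat \<Rightarrow> real \<Rightarrow> real" where
  "negligible_const n \<alpha> = 2 * exp (2 ^ (2 * n + 3) * (1 + 1 / sqrt \<alpha>) * sqrt \<alpha>)"

context layer_mesh
begin

lemma mesh_scale_le: "mesh_scale \<le> 2 ^ (2 * n + 3) * (1 + 1 / sqrt \<alpha>)"
proof -
  have "ln (real N) / real N \<le> 1" using ln_bound[of "real N"] N by (simp add: divide_le_eq)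
  then have "2 ^ (2 * n + 3) * (1 + 1 / sqrt \<alpha>) * (ln (real N) / real N) \<le> 2 ^ (2 * n + 3) * (1 + 1 / sqrt \<alpha>) * 1"
    using \<alpha> by (intro mult_left_mono) auto
  then show ?thesis by (simp add: mesh_scale_def)
qed

lemma mesh_scale_ge: "1 / real N \<le> mesh_scale"
proof -
  have "(2::real) \<le> 2 ^ (2 * n + 3)" using power_increasing[of 1 "2 * n + 3" "2::real"] by simp
  moreover have "1 \<le> 1 + 1 / sqrt \<alpha>" using \<alpha> by simp
  ultimately have "2 * 1 \<le> 2 ^ (2 * n + 3) * (1 + 1 / sqrt \<alpha>)" by (intro mult_mono) auto
  then have "2 \<le> 2 ^ (2 * n + 3) * (1 + 1 / sqrt \<alpha>)" by simp
  from mult_mono[OF this ln_N_ge_half] have "1 \<le> 2 ^ (2 * n + 3) * (1 + 1 / sqrt \<alpha>) * ln (real N)"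
    using \<alpha> by (simp add: mult_nonneg_nonneg)
  then have "1 / real N \<le> 2 ^ (2 * n + 3) * (1 + 1 / sqrt \<alpha>) * ln (real N) / real N"
    by (intro divide_right_mono) auto
  then show ?thesis by (simp add: mesh_scale_def)
qed

text \<open>The intervals on the two sides of a node may fall under different alternatives. If a
  layer is negligible on one side and resolved on the other, it is negligible at the common node and
  grows only by a bounded factor across the resolved side, so it is negligible on both.\<close>

lemma adapted_pair:
  assumes lc: "adapted_interval l c" and cr: "adapted_interval c r" and m: "m \<in> {1..n}"
  shows "max (c - l) (r - c) \<le> mesh_scale * sqrt (\<epsilon> m) \<or>
    (\<forall>y\<in>{l..r}. layer \<alpha> (\<epsilon> m) y \<le> negligible_const n \<alpha> * mesh_scale\<^sup>2)"
proof -
  let ?B = "layer \<alpha> (\<epsilon> m)"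
  define E where "E = exp (2 ^ (2 * n + 3) * (1 + 1 / sqrt \<alpha>) * sqrt \<alpha>)"
  have E: "1 \<le> E" using \<alpha> by (simp add: E_def)
  have N2: "1 / (real N)\<^sup>2 \<le> mesh_scale\<^sup>2"
    using power_mono[OF mesh_scale_ge, of 2] by (simp add: power_divide)
  have final: "E * (2 / (real N)\<^sup>2) \<le> negligible_const n \<alpha> * mesh_scale\<^sup>2"
  proof -
    have "negligible_const n \<alpha> = 2 * E" by (simp add: negligible_const_def E_def)
    then show ?thesis using mult_left_mono[OF N2, of "2 * E"] E by (simp add: mult_ac)
  qed
  have near: "?B y \<le> E * (2 / (real N)\<^sup>2)" if y: "\<bar>y - c\<bar> \<le> mesh_scale * sqrt (\<epsilon> m)" and Bc: "?B c \<le> 2 / (real N)\<^sup>2" for y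
  proof -
    have "\<bar>y - c\<bar> * sqrt (\<alpha> / \<epsilon> m) \<le> mesh_scale * sqrt (\<epsilon> m) * sqrt (\<alpha> / \<epsilon> m)"
      using y \<alpha> eps[OF m] by (intro mult_right_mono) auto
    also have "\<dots> = mesh_scale * sqrt \<alpha>" using eps[OF m] by (simp add: real_sqrt_divide)
    also have "\<dots> \<le> 2 ^ (2 * n + 3) * (1 + 1 / sqrt \<alpha>) * sqrt \<alpha>"
      using \<alpha> by (intro mult_right_mono mesh_scale_le) auto
    finally have "exp (\<bar>y - c\<bar> * sqrt (\<alpha> / \<epsilon> m)) \<le> E" by (simp add: E_def)
    then have "exp (\<bar>y - c\<bar> * sqrt (\<alpha> / \<epsilon> m)) * ?B c \<le> E * (2 / (real N)\<^sup>2)"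
      using Bc layer_nonneg E by (intro mult_mono) auto
    then show ?thesis using layer_shift_le[of \<alpha> "\<epsilon> m" y c] \<alpha> eps[OF m] by simp
  qed
  have small: "?B y \<le> E * (2 / (real N)\<^sup>2)" if "?B y \<le> 2 / (real N)\<^sup>2" for y
    using that mult_right_mono[OF E, of "2 / (real N)\<^sup>2"] by simp
  have lcr: "l < c" "c < r" using lc cr by (auto simp: adapted_interval_def)
  consider (fine) "c - l \<le> mesh_scale * sqrt (\<epsilon> m)" "r - c \<le> mesh_scale * sqrt (\<epsilon> m)"
    | (right) "c - l \<le> mesh_scale * sqrt (\<epsilon> m)" "\<forall>y\<in>{c..r}. ?B y \<le> 2 / (real N)\<^sup>2"
    | (left) "\<forall>y\<in>{l..c}. ?B y \<le> 2 / (real N)\<^sup>2" "r - c \<le> mesh_scale * sqrt (\<epsilon> m)"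
    | (both) "\<forall>y\<in>{l..c}. ?B y \<le> 2 / (real N)\<^sup>2" "\<forall>y\<in>{c..r}. ?B y \<le> 2 / (real N)\<^sup>2"
    using lc cr m unfolding adapted_interval_def by blast
  then show ?thesis
  proof cases
    case fine
    then show ?thesis by simp
  next
    case right
    have "?B y \<le> E * (2 / (real N)\<^sup>2)" if "y \<in> {l..r}" for y
      using right that lcr near[of y] small[of y] by (cases "y \<le> c") auto
    then show ?thesis using final by (meson order_trans)
  next
    case left
    have "?B y \<le> E * (2 / (real N)\<^sup>2)" if "y \<in> {l..r}" for y
      using left that lcr near[of y] small[of y] by (cases "y \<le> c") auto
    then show ?thesis using final by (meson order_trans)
  next
    case both
    have "?B y \<le> E * (2 / (real N)\<^sup>2)" if "y \<in> {l..r}" for y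
      using both that lcr small[of y] by (cases "y \<le> c") auto
    then show ?thesis using final by (meson order_trans)
  qed
qed

end

section \<open>Second differences and scalar discrete comparison\<close>

lemma second_diff_linear:
  "second_diff x (\<lambda>j. v j + k * w j) j = second_diff x v j + k * second_diff x w j"
  by (simp add: second_diff_def forward_diff_def backward_diff_def add_divide_distrib diff_divide_distrib algebra_simps)

lemma second_diff_const: "second_diff x (\<lambda>j. k) j = 0"
  by (simp add: second_diff_def forward_diff_def backward_diff_def)

lemma second_diff_sum:
  "finite J \<Longrightarrow> second_diff x (\<lambda>j. \<Sum>k\<in>J. v k j) j = (\<Sum>k\<in>J. second_diff x (v k) j)"
proof (induction J rule: finite_induct)
  case (insert k J)
  have "second_diff x (\<lambda>j. \<Sum>k\<in>insert k J. v k j) j = second_diff x (\<lambda>j. v k j + 1 * (\<Sum>k\<in>J. v k j)) j"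
    using insert by simp
  then show ?case using insert by (simp only: second_diff_linear) simp
qed (simp add: second_diff_const)

lemma discrete_comparison:
  assumes x: "\<And>j. j < N \<Longrightarrow> x j < x (j + 1)" and e: "0 \<le> e" and a: "\<And>j. j \<in> {1..N - 1} \<Longrightarrow> 0 < a j"
    and bdry: "0 \<le> z 0" "0 \<le> z N"
    and L: "\<And>j. j \<in> {1..N - 1} \<Longrightarrow> 0 \<le> - e * second_diff x z j + a j * z j"
    and j: "j \<le> N"
  shows "0 \<le> z j"
proof (rule ccontr)
  assume neg: "\<not> 0 \<le> z j"
  obtain k where k: "k \<in> {0..N}" "\<And>l. l \<in> {0..N} \<Longrightarrow> z k \<le> z l"
    using ex_is_arg_min_if_finite[of "{0..N}" z] by (auto simp: is_arg_min_linorder)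
  have zk: "z k < 0" using k(2)[of j] j neg by simp
  have "k \<noteq> 0" "k \<noteq> N" using zk bdry by (metis not_le)+
  then have k': "k \<in> {1..N - 1}" using k(1) by simp
  have h: "0 < x (k + 1) - x k" "0 < x k - x (k - 1)" using x[of k] x[of "k - 1"] k' by auto
  have "k + 1 \<in> {0..N}" using k' by auto
  then have "0 \<le> forward_diff x z k" unfolding forward_diff_def
    using k(2)[of "k + 1"] h by (intro divide_nonneg_pos) auto
  moreover have "backward_diff x z k \<le> 0" unfolding backward_diff_def
    using k(2)[of "k - 1"] k' h by (intro divide_nonpos_pos) auto
  ultimately have "0 \<le> second_diff x z k" unfolding second_diff_def using h by (intro divide_nonneg_pos) auto
  then have "- e * second_diff x z k \<le> 0" using e by simp
  moreover have "a k * z k < 0" using a[OF k'] zk by (simp add: mult_pos_neg)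
  ultimately show False using L[OF k'] by linarith
qed

text \<open>Discrete counterpart of \<open>exp (- \<rho> * \<bar>x - x J\<bar>)\<close>. Its kink at \<open>x J\<close> absorbs the merely first order
  truncation error at a node where the mesh width changes.\<close>

definition discrete_exp :: "real \<Rightarrow> (nat \<Rightarrow> real) \<Rightarrow> nat \<Rightarrow> nat \<Rightarrow> real" where
  "discrete_exp \<rho> x J j = (\<Prod>l\<in>{min J j<..max J j}. 1 / (1 + \<rho> * (x l - x (l - 1))))"

lemma discrete_exp_same: "discrete_exp \<rho> x J J = 1"
  by (simp add: discrete_exp_def)

lemma discrete_exp_right:
  assumes "J \<le> j"
  shows "discrete_exp \<rho> x J (j + 1) = discrete_exp \<rho> x J j / (1 + \<rho> * (x (j + 1) - x j))"
proof -
  have "{min J (j + 1)<..max J (j + 1)} = insert (j + 1) {min J j<..max J j}" using assms by auto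
  then show ?thesis using assms by (simp add: discrete_exp_def)
qed

lemma discrete_exp_left:
  assumes "j < J"
  shows "discrete_exp \<rho> x J j = discrete_exp \<rho> x J (j + 1) / (1 + \<rho> * (x (j + 1) - x j))"
proof -
  have "{min J j<..max J j} = insert (j + 1) {min J (j + 1)<..max J (j + 1)}" using assms by auto
  then show ?thesis using assms by (simp add: discrete_exp_def)
qed

context
  fixes N :: nat and x :: "nat \<Rightarrow> real" and \<rho> :: real
  assumes x: "\<And>j. j < N \<Longrightarrow> x j < x (j + 1)" and \<rho>: "0 < \<rho>"
begin

lemma discrete_exp_bounds:
  assumes "J \<le> N" "j \<le> N"
  shows "0 < discrete_exp \<rho> x J j" "discrete_exp \<rho> x J j \<le> 1"
proof -
  have f: "0 < 1 / (1 + \<rho> * (x l - x (l - 1)))" "1 / (1 + \<rho> * (x l - x (l - 1))) \<le> 1"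
    if "l \<in> {min J j<..max J j}" for l
  proof -
    have "x (l - 1) < x l" using x[of "l - 1"] that assms by auto
    then have "0 < \<rho> * (x l - x (l - 1))" using \<rho> by simp
    then show "0 < 1 / (1 + \<rho> * (x l - x (l - 1)))" "1 / (1 + \<rho> * (x l - x (l - 1))) \<le> 1" by auto
  qed
  show "0 < discrete_exp \<rho> x J j" unfolding discrete_exp_def using f(1) by (intro prod_pos) blast
  show "discrete_exp \<rho> x J j \<le> 1" unfolding discrete_exp_def
    using f by (intro prod_le_1) (auto intro: less_imp_le)
qed

text \<open>Every difference quotient is exactly \<open>\<rho>\<close> or \<open>- \<rho>\<close>
  times the value at the node farther from \<open>J\<close>. The jump of the slopes is therefore
  \<open>\<rho>\<^sup>2\<close> times one step times a value not exceeding the one at j, and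
  division by the mean of the two steps gives at most the factor 2 on any mesh.\<close>

lemma second_diff_discrete_exp_le:
  assumes J: "J \<le> N" and j: "j \<in> {1..N - 1}" "j \<noteq> J"
  shows "second_diff x (discrete_exp \<rho> x J) j \<le> 2 * \<rho>\<^sup>2 * discrete_exp \<rho> x J j"
proof -
  define \<psi> where "\<psi> = discrete_exp \<rho> x J"
  define h where "h = x j - x (j - 1)"
  define k where "k = x (j + 1) - x j"
  have hk: "0 < h" "0 < k" using x[of "j - 1"] x[of j] j by (auto simp: h_def k_def)
  have p: "0 < \<psi> j" "0 < \<psi> (j - 1)" "0 < \<psi> (j + 1)" using discrete_exp_bounds(1)[OF J] j by (auto simp: \<psi>_def)
  have sd: "second_diff x \<psi> j = ((\<psi> (j + 1) - \<psi> j) / k - (\<psi> j - \<psi> (j - 1)) / h) / ((h + k) / 2)"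
    by (simp add: second_diff_def forward_diff_def backward_diff_def h_def k_def)
  have main: "second_diff x \<psi> j \<le> 2 * \<rho>\<^sup>2 * \<psi> j"
    if d: "(\<psi> (j + 1) - \<psi> j) / k - (\<psi> j - \<psi> (j - 1)) / h = \<rho>\<^sup>2 * (t * q)" and t: "0 < t" "t \<le> h + k" and q: "0 \<le> q" "q \<le> \<psi> j" for t q
  proof -
    have "\<rho>\<^sup>2 * (t * q) \<le> \<rho>\<^sup>2 * ((h + k) * \<psi> j)"
      using t q by (intro mult_left_mono mult_mono) auto
    then have "second_diff x \<psi> j \<le> \<rho>\<^sup>2 * ((h + k) * \<psi> j) / ((h + k) / 2)"
      unfolding sd d using hk by (intro divide_right_mono) auto
    also have "\<dots> = 2 * \<rho>\<^sup>2 * \<psi> j" using hk by simp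
    finally show ?thesis .
  qed
  show ?thesis unfolding \<psi>_def[symmetric]
  proof (cases "J < j")
    case True
    have r1: "0 < 1 + \<rho> * k" "0 < 1 + \<rho> * h" using hk \<rho> by (auto intro: add_pos_pos)
    have "\<psi> (j + 1) = \<psi> j / (1 + \<rho> * k)" using discrete_exp_right[of J j \<rho> x] True by (simp add: \<psi>_def k_def)
    then have 1: "\<psi> j = \<psi> (j + 1) * (1 + \<rho> * k)" using r1 by simp
    have "\<psi> j = \<psi> (j - 1) / (1 + \<rho> * h)" using discrete_exp_right[of J "j - 1" \<rho> x] True by (simp add: \<psi>_def h_def)
    then have 2: "\<psi> (j - 1) = \<psi> j * (1 + \<rho> * h)" using r1 by simp
    have "\<psi> (j + 1) - \<psi> j = k * (- \<rho> * \<psi> (j + 1))" "\<psi> j - \<psi> (j - 1) = h * (- \<rho> * \<psi> j)"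
      using 1 2 by (simp_all add: algebra_simps)
    then have "(\<psi> (j + 1) - \<psi> j) / k = - \<rho> * \<psi> (j + 1)" "(\<psi> j - \<psi> (j - 1)) / h = - \<rho> * \<psi> j"
      using hk by simp_all
    then have "(\<psi> (j + 1) - \<psi> j) / k - (\<psi> j - \<psi> (j - 1)) / h = \<rho> * (\<psi> j - \<psi> (j + 1))"
      by (simp add: algebra_simps)
    also have "\<rho> * (\<psi> j - \<psi> (j + 1)) = \<rho>\<^sup>2 * (k * \<psi> (j + 1))" using 1 by (simp add: algebra_simps power2_eq_square)
    finally show "second_diff x \<psi> j \<le> 2 * \<rho>\<^sup>2 * \<psi> j"
    proof (rule main)
      show "\<psi> (j + 1) \<le> \<psi> j" using 1 p hk \<rho> by (simp add: distrib_left)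
    qed (use hk p in auto)
  next
    case False
    then have jJ: "j < J" using j by simp
    have r1: "0 < 1 + \<rho> * k" "0 < 1 + \<rho> * h" using hk \<rho> by (auto intro: add_pos_pos)
    have "\<psi> j = \<psi> (j + 1) / (1 + \<rho> * k)" using discrete_exp_left[OF jJ, of \<rho> x] by (simp add: \<psi>_def k_def)
    then have 1: "\<psi> (j + 1) = \<psi> j * (1 + \<rho> * k)" using r1 by simp
    have "\<psi> (j - 1) = \<psi> j / (1 + \<rho> * h)" using discrete_exp_left[of "j - 1" J \<rho> x] jJ j by (simp add: \<psi>_def h_def)
    then have 2: "\<psi> j = \<psi> (j - 1) * (1 + \<rho> * h)" using r1 by simp
    have "\<psi> (j + 1) - \<psi> j = k * (\<rho> * \<psi> j)" "\<psi> j - \<psi> (j - 1) = h * (\<rho> * \<psi> (j - 1))"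
      using 1 2 by (simp_all add: algebra_simps)
    then have "(\<psi> (j + 1) - \<psi> j) / k = \<rho> * \<psi> j" "(\<psi> j - \<psi> (j - 1)) / h = \<rho> * \<psi> (j - 1)"
      using hk by simp_all
    then have "(\<psi> (j + 1) - \<psi> j) / k - (\<psi> j - \<psi> (j - 1)) / h = \<rho> * (\<psi> j - \<psi> (j - 1))"
      by (simp add: algebra_simps)
    also have "\<rho> * (\<psi> j - \<psi> (j - 1)) = \<rho>\<^sup>2 * (h * \<psi> (j - 1))" using 2 by (simp add: algebra_simps power2_eq_square)
    finally show "second_diff x \<psi> j \<le> 2 * \<rho>\<^sup>2 * \<psi> j"
    proof (rule main)
      show "\<psi> (j - 1) \<le> \<psi> j" using 2 p hk \<rho> by (simp add: distrib_left)
    qed (use hk p in auto)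
  qed
qed

text \<open>The slope drops from \<open>\<rho> / (1 + \<rho> * h)\<close> to
  \<open>- \<rho> / (1 + \<rho> * k)\<close> at the peak. Division by a step turns this drop into a
  strongly negative second difference of order \<open>\<rho> / H\<close>.\<close>

lemma second_diff_discrete_exp_kink:
  assumes J: "J \<in> {1..N - 1}" and H: "x J - x (J - 1) \<le> H" "x (J + 1) - x J \<le> H"
  shows "second_diff x (discrete_exp \<rho> x J) J \<le> - (2 * \<rho> / ((1 + \<rho> * H) * H))"
proof -
  define \<psi> where "\<psi> = discrete_exp \<rho> x J"
  define h where "h = x J - x (J - 1)"
  define k where "k = x (J + 1) - x J"
  have hk: "0 < h" "0 < k" "h \<le> H" "k \<le> H" using x[of "J - 1"] x[of J] J H by (auto simp: h_def k_def)
  have r1: "0 < 1 + \<rho> * k" "0 < 1 + \<rho> * h" "0 < 1 + \<rho> * H" using hk \<rho> by (auto intro!: add_pos_pos)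
  have \<psi>J: "\<psi> J = 1" by (simp add: \<psi>_def discrete_exp_same)
  have 1: "\<psi> (J + 1) = 1 / (1 + \<rho> * k)" using discrete_exp_right[of J J \<rho> x] \<psi>J by (simp add: \<psi>_def k_def)
  have 2: "\<psi> (J - 1) = 1 / (1 + \<rho> * h)" using discrete_exp_left[of "J - 1" J \<rho> x] J \<psi>J by (simp add: \<psi>_def h_def)
  have sd: "second_diff x \<psi> J = ((\<psi> (J + 1) - \<psi> J) / k - (\<psi> J - \<psi> (J - 1)) / h) / ((h + k) / 2)"
    by (simp add: second_diff_def forward_diff_def backward_diff_def h_def k_def)
  have neg: "(- p - q) / t = - ((p + q) / t)" for p q t :: real by (simp add: minus_divide_left)
  have right: "(\<psi> (J + 1) - \<psi> J) / k = - (\<rho> / (1 + \<rho> * k))" 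
  proof -
    have "1 / (1 + \<rho> * k) - 1 = - (\<rho> * k / (1 + \<rho> * k))" using r1 by (simp add: field_simps)
    then show ?thesis unfolding 1 \<psi>J using hk by simp
  qed
  have left: "(\<psi> J - \<psi> (J - 1)) / h = \<rho> / (1 + \<rho> * h)" 
  proof -
    have "1 - 1 / (1 + \<rho> * h) = \<rho> * h / (1 + \<rho> * h)" using r1 by (simp add: field_simps)
    then show ?thesis unfolding 2 \<psi>J using hk by simp
  qed
  have "second_diff x \<psi> J = - ((\<rho> / (1 + \<rho> * k) + \<rho> / (1 + \<rho> * h)) / ((h + k) / 2))"
    unfolding sd right left neg ..
  also have "\<dots> \<le> - (2 * \<rho> / ((1 + \<rho> * H) * H))"
  proof -
    have "\<rho> / (1 + \<rho> * H) \<le> \<rho> / (1 + \<rho> * k)" "\<rho> / (1 + \<rho> * H) \<le> \<rho> / (1 + \<rho> * h)"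
      using hk \<rho> r1 by (auto intro!: divide_left_mono mult_pos_pos)
    then have "2 * (\<rho> / (1 + \<rho> * H)) \<le> \<rho> / (1 + \<rho> * k) + \<rho> / (1 + \<rho> * h)" by linarith
    moreover have "(h + k) / 2 \<le> H" using hk by simp
    ultimately have "2 * (\<rho> / (1 + \<rho> * H)) / H \<le> (\<rho> / (1 + \<rho> * k) + \<rho> / (1 + \<rho> * h)) / ((h + k) / 2)"
      using hk \<rho> r1 by (intro frac_le) auto
    then show ?thesis by simp
  qed
  finally show ?thesis by (simp add: \<psi>_def)
qed

text \<open>\<open>\<rho>\<close> satisfies \<open>2 * e * \<rho>\<^sup>2 = \<alpha>\<close>, so
  that away from its peak no exponential makes a negative contribution. The constant
  \<open>\<eta> / \<alpha>\<close> covers the part \<open>\<eta>\<close> of the right-hand side. At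
  a node of \<open>J\<close> with \<open>H \<le> sqrt e\<close>, the kink contributes at least
  \<open>sqrt e / H\<close> divided by \<open>q\<close>, because
  \<open>\<rho> * H \<le> sqrt (\<alpha> / 2)\<close>; \<open>q\<close> is the factor that
  normalises this to the excess of T.\<close>

lemma discrete_barrier:
  assumes \<alpha>: "0 < \<alpha>" and e: "0 < e" and \<rho>_eq: "\<rho> = sqrt (\<alpha> / 2) / sqrt e" and \<eta>: "0 \<le> \<eta>"
    and J: "finite J" "J \<subseteq> {1..N - 1}"
    and a: "\<alpha> \<le> a" and j: "j \<in> {1..N - 1}"
    and H: "H = max (x j - x (j - 1)) (x (j + 1) - x j)"
    and T: "T \<le> \<eta> \<or> (j \<in> J \<and> H \<le> sqrt e \<and> T \<le> \<eta> * (1 + sqrt e / H))"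
  defines "q \<equiv> (1 + sqrt (\<alpha> / 2)) / (2 * sqrt (\<alpha> / 2))"
  defines "\<Psi> \<equiv> \<lambda>j. \<eta> / \<alpha> + \<eta> * q * (\<Sum>k\<in>J. discrete_exp \<rho> x k j)"
  shows "T \<le> - e * second_diff x \<Psi> j + a * \<Psi> j"
proof -
  define \<gamma> where "\<gamma> = sqrt (\<alpha> / 2)"
  have \<gamma>: "0 < \<gamma>" "\<gamma>\<^sup>2 = \<alpha> / 2" using \<alpha> by (auto simp: \<gamma>_def)
  have q: "0 < q" using \<gamma> by (simp add: q_def \<gamma>_def[symmetric] add_pos_pos)
  have \<rho>2: "e * (2 * \<rho>\<^sup>2) = \<alpha>" using e \<gamma> by (simp add: \<rho>_eq \<gamma>_def[symmetric] power_divide)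
  have "j < N" using j by auto
  then have hpos: "0 < H" using x[of j] unfolding H by (simp add: less_max_iff_disj)
  let ?D = "\<lambda>k. - e * second_diff x (discrete_exp \<rho> x k) j + a * discrete_exp \<rho> x k j"
  have pos: "0 \<le> discrete_exp \<rho> x k j" if "k \<in> J" for k
    using discrete_exp_bounds(1)[of k j] that J j by force
  have D0: "0 \<le> ?D k" if k: "k \<in> J" for k
  proof (cases "j = k")
    case False
    have "k \<in> {1..N - 1}" using k J by blast
    then have kN: "k \<le> N" by auto
    have "e * second_diff x (discrete_exp \<rho> x k) j \<le> e * (2 * \<rho>\<^sup>2 * discrete_exp \<rho> x k j)"
      using second_diff_discrete_exp_le[OF kN j False] e by (intro mult_left_mono) auto
    also have "\<dots> = \<alpha> * discrete_exp \<rho> x k j" using \<rho>2 by (simp add: mult.assoc[symmetric])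
    also have "\<dots> \<le> a * discrete_exp \<rho> x k j" using a pos[OF k] by (rule mult_right_mono)
    finally show ?thesis by simp
  next
    case True
    have "second_diff x (discrete_exp \<rho> x j) j \<le> - (2 * \<rho> / ((1 + \<rho> * H) * H))"
      using H by (intro second_diff_discrete_exp_kink j) auto
    also have "\<dots> \<le> 0" using hpos \<rho> by (simp add: add_pos_pos less_imp_le)
    finally have "0 \<le> - e * second_diff x (discrete_exp \<rho> x j) j" using e by (simp add: mult_nonneg_nonpos)
    moreover have "0 \<le> a * discrete_exp \<rho> x k j" using pos[OF k] a \<alpha> by simp
    ultimately show ?thesis using True by simp
  qed
  have lin: "second_diff x \<Psi> j = \<eta> * q * (\<Sum>k\<in>J. second_diff x (discrete_exp \<rho> x k) j)"
    unfolding \<Psi>_def second_diff_linear second_diff_const second_diff_sum[OF J(1)] by simp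
  have eq: "- e * second_diff x \<Psi> j + a * \<Psi> j = a * (\<eta> / \<alpha>) + \<eta> * q * (\<Sum>k\<in>J. ?D k)"
    unfolding lin by (simp add: \<Psi>_def sum.distrib sum_subtractf sum_distrib_left sum_negf algebra_simps)
  have "\<alpha> * (\<eta> / \<alpha>) \<le> a * (\<eta> / \<alpha>)" using a \<alpha> \<eta> by (intro mult_right_mono) auto
  then have base: "\<eta> \<le> a * (\<eta> / \<alpha>)" using \<alpha> by simp
  from T show ?thesis
  proof
    assume "T \<le> \<eta>"
    moreover have "0 \<le> \<eta> * q * (\<Sum>k\<in>J. ?D k)" using D0 q \<eta> by (intro mult_nonneg_nonneg sum_nonneg) auto
    ultimately show ?thesis unfolding eq using base by linarith
  next
    assume jJ: "j \<in> J \<and> H \<le> sqrt e \<and> T \<le> \<eta> * (1 + sqrt e / H)"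
    then have HJ: "H \<le> sqrt e" by simp
    have "q * ?D j \<le> q * (\<Sum>k\<in>J. ?D k)"
      using D0 jJ J q by (intro mult_left_mono member_le_sum) auto
    moreover have "sqrt e / H \<le> q * ?D j"
    proof -
      have "second_diff x (discrete_exp \<rho> x j) j \<le> - (2 * \<rho> / ((1 + \<rho> * H) * H))"
        using H by (intro second_diff_discrete_exp_kink j) auto
      then have "e * (2 * \<rho> / ((1 + \<rho> * H) * H)) \<le> e * (- second_diff x (discrete_exp \<rho> x j) j)"
        using e by (intro mult_left_mono) auto
      moreover have "0 \<le> a * discrete_exp \<rho> x j j" using a \<alpha> by (simp add: discrete_exp_same)
      ultimately have 1: "e * (2 * \<rho> / ((1 + \<rho> * H) * H)) \<le> ?D j" by linarith
      have "\<rho> * H \<le> \<rho> * sqrt e" using HJ \<rho> by (intro mult_left_mono) auto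
      also have "\<dots> = \<gamma>" using e by (simp add: \<rho>_eq \<gamma>_def)
      finally have \<rho>H: "\<rho> * H \<le> \<gamma>" .
      have "e * (2 * \<rho> / ((1 + \<gamma>) * H)) \<le> e * (2 * \<rho> / ((1 + \<rho> * H) * H))"
        using \<rho>H e \<rho> hpos by (intro mult_left_mono divide_left_mono mult_right_mono mult_pos_pos) (auto intro!: add_pos_pos simp: \<gamma>(1))
      \<comment> \<open>Here \<open>e * \<rho> = sqrt e * \<gamma>\<close>, and
        \<open>q = (1 + \<gamma>) / (2 * \<gamma>)\<close> cancels all that remains.\<close>
      moreover have "q * (e * (2 * \<rho> / ((1 + \<gamma>) * H))) = sqrt e / H"
      proof -
        have "e * \<rho> = sqrt e * \<gamma>" using e by (simp add: \<rho>_eq \<gamma>_def[symmetric] field_simps)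
        define g where "g = 1 + \<gamma>"
        have g: "0 < g" using \<gamma>(1) by (simp add: g_def)
        have "q * (e * (2 * \<rho> / (g * H))) = g / (2 * \<gamma>) * (2 * (e * \<rho>) / (g * H))"
          by (simp add: q_def \<gamma>_def[symmetric] g_def mult_ac)
        also have "\<dots> = sqrt e / H" unfolding \<open>e * \<rho> = sqrt e * \<gamma>\<close> using g \<gamma>(1) hpos by (simp add: field_simps)
        finally show ?thesis by (simp add: g_def)
      qed
      ultimately show ?thesis using mult_left_mono[OF order_trans[OF _ 1], of "e * (2 * \<rho> / ((1 + \<gamma>) * H))" q] q by simp
    qed
    ultimately have "\<eta> * (sqrt e / H) \<le> \<eta> * (q * (\<Sum>k\<in>J. ?D k))" using \<eta> by (intro mult_left_mono) auto
    then show ?thesis unfolding eq using base jJ by (simp add: distrib_left mult.assoc)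
  qed
qed

end

section \<open>Error estimate\<close>

context smooth_problem
begin

text \<open>\<open>b / \<alpha>\<close> inverts 1 minus the contraction factor
  \<open>1 - \<alpha> / b\<close> of the coupling; the bracket bounds the barrier per unit of
  truncation error, each of at most 2n + 1 discrete exponentials being at most 1.\<close>

definition stability_const :: real where
  "stability_const = b / \<alpha> * (1 / \<alpha> + (1 + sqrt (\<alpha> / 2)) / (2 * sqrt (\<alpha> / 2)) * (2 * real n + 1))"

definition derivative_const :: real where
  "derivative_const = (second_deriv_const + fourth_deriv_const) * (1 + interpolation_const n \<alpha>)"

definition truncation_const :: real where
  "truncation_const = derivative_const *
     ((1 + 2 * real n + real n * negligible_const n \<alpha> / \<alpha>) + 2 * (1 + real n * (2 + negligible_const n \<alpha>))
       + (1 + 2 * real n + 2 * real n * negligible_const n \<alpha> / sqrt \<alpha>))"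

definition error_const :: real where
  "error_const = stability_const * truncation_const * (2 ^ (2 * n + 3) * (1 + 1 / sqrt \<alpha>))\<^sup>2"

lemma interpolation_const_nonneg: "0 \<le> interpolation_const n \<alpha>"
  using alpha by (simp add: interpolation_const_def)

lemma negligible_const_nonneg: "0 \<le> negligible_const n \<alpha>"
  by (simp add: negligible_const_def)

lemma derivative_const_ge:
  "0 \<le> derivative_const" "second_deriv_const \<le> derivative_const" "fourth_deriv_const \<le> derivative_const"
  "interpolation_const n \<alpha> * (second_deriv_const + fourth_deriv_const) \<le> derivative_const"
proof -
  have "0 \<le> (second_deriv_const + fourth_deriv_const) * interpolation_const n \<alpha>" using const_nonneg interpolation_const_nonneg by simp
  moreover have eq: "derivative_const = second_deriv_const + fourth_deriv_const + (second_deriv_const + fourth_deriv_const) * interpolation_const n \<alpha>"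
    by (simp add: derivative_const_def distrib_left)
  ultimately show "0 \<le> derivative_const" "second_deriv_const \<le> derivative_const" "fourth_deriv_const \<le> derivative_const"
    "interpolation_const n \<alpha> * (second_deriv_const + fourth_deriv_const) \<le> derivative_const"
    using const_nonneg unfolding eq mult.commute[of _ "second_deriv_const + fourth_deriv_const"] by linarith+
qed

lemma truncation_const_ge:
  "0 \<le> truncation_const"
  "derivative_const * (1 + 2 * real n + real n * negligible_const n \<alpha> / \<alpha>) \<le> truncation_const"
  "2 * derivative_const * (1 + real n * (2 + negligible_const n \<alpha>)) \<le> truncation_const"
  "derivative_const * (1 + 2 * real n + 2 * real n * negligible_const n \<alpha> / sqrt \<alpha>) \<le> truncation_const"
proof -
  define p where "p = derivative_const * (1 + 2 * real n + real n * negligible_const n \<alpha> / \<alpha>)"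
  define q where "q = 2 * derivative_const * (1 + real n * (2 + negligible_const n \<alpha>))"
  define r where "r = derivative_const * (1 + 2 * real n + 2 * real n * negligible_const n \<alpha> / sqrt \<alpha>)"
  have "0 \<le> p" "0 \<le> q" "0 \<le> r"
    using derivative_const_ge(1) negligible_const_nonneg alpha by (simp_all add: p_def q_def r_def)
  moreover have "truncation_const = p + q + r"
    by (simp add: truncation_const_def p_def q_def r_def algebra_simps)
  ultimately show "0 \<le> truncation_const" "derivative_const * (1 + 2 * real n + real n * negligible_const n \<alpha> / \<alpha>) \<le> truncation_const"
    "2 * derivative_const * (1 + real n * (2 + negligible_const n \<alpha>)) \<le> truncation_const"
    "derivative_const * (1 + 2 * real n + 2 * real n * negligible_const n \<alpha> / sqrt \<alpha>) \<le> truncation_const"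
    unfolding p_def[symmetric] q_def[symmetric] r_def[symmetric] by linarith+
qed

text \<open>The three truncation estimates with a common constant: the full order holds at nodes
  with equal steps and at coarse nodes, the weaker bound at every node. The weaker bound is required
  only where the steps differ and are both below \<open>sqrt (\<epsilon> i)\<close>, which is
  exactly where the kink is effective.\<close>

lemma truncation_bound:
  assumes mesh: "layer_mesh n \<epsilon> \<alpha> N" and i: "i \<in> {1..n}"
    and lc: "layer_mesh.adapted_interval n \<epsilon> \<alpha> N l c" and cr: "layer_mesh.adapted_interval n \<epsilon> \<alpha> N c r"
    and lr: "0 \<le> l" "r \<le> 1" and contu: "continuous_on {0..1} u"
    and deriv: "\<And>x. x \<in> {0<..<1} \<Longrightarrow> (u has_real_derivative V x) (at x) \<and> (V has_real_derivative G x) (at x)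
        \<and> (G has_real_derivative P x) (at x) \<and> (P has_real_derivative Q x) (at x)"
    and G: "\<And>x. x \<in> {0<..<1} \<Longrightarrow> \<bar>G x\<bar> \<le> second_deriv_const * (1 + (\<Sum>m=i..n. layer \<alpha> (\<epsilon> m) x / \<epsilon> m))"
    and Q: "\<And>x. x \<in> {0<..<1} \<Longrightarrow> \<bar>\<epsilon> i * Q x\<bar> \<le> fourth_deriv_const * (1 + (\<Sum>m=1..n. layer \<alpha> (\<epsilon> m) x / \<epsilon> m))"
    and P: "\<And>x. x \<in> {0<..<1} \<Longrightarrow> \<bar>\<epsilon> i * P x\<bar> \<le> interpolation_const n \<alpha> * (second_deriv_const + fourth_deriv_const) *
            (sqrt (\<epsilon> i) + (\<Sum>m=1..n. min (sqrt (\<epsilon> i) / \<epsilon> m) (1 / sqrt (\<epsilon> m)) * layer \<alpha> (\<epsilon> m) x))"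
  defines "H \<equiv> max (c - l) (r - c)" and "T \<equiv> \<bar>\<epsilon> i * (divided_second_diff u l c r - G c)\<bar>"
    and "\<eta> \<equiv> truncation_const * (layer_mesh.mesh_scale n \<alpha> N)\<^sup>2"
  shows "r - c = c - l \<or> sqrt (\<epsilon> i) \<le> H \<Longrightarrow> T \<le> \<eta>" "T \<le> \<eta> * (1 + sqrt (\<epsilon> i) / H)"
proof -
  interpret layer_mesh n \<epsilon> \<alpha> N by (rule mesh)
  let ?\<nu> = "negligible_const n \<alpha>"
  have lcr: "l < c" "c < r" using lc cr by (auto simp: adapted_interval_def)
  have nn: "0 \<le> (\<Sum>m=k..n. layer \<alpha> (\<epsilon> m) x / \<epsilon> m)" if "1 \<le> k" for k x
  proof (intro sum_nonneg divide_nonneg_nonneg layer_nonneg)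
    show "0 \<le> \<epsilon> m" if "m \<in> {k..n}" for m using eps[of m] that \<open>1 \<le> k\<close> by simp
  qed
  interpret truncation n \<epsilon> \<alpha> mesh_scale ?\<nu> H l c r i derivative_const u V G P Q
  proof
    show "0 < \<alpha>" by (rule alpha)
    show "0 \<le> derivative_const" by (rule derivative_const_ge)
    show "0 \<le> ?\<nu>" by (rule negligible_const_nonneg)
    show "c - l \<le> H" "r - c \<le> H" by (simp_all add: H_def)
    show "H \<le> mesh_scale" using lc cr by (simp add: H_def adapted_interval_def)
    show "H \<le> mesh_scale * sqrt (\<epsilon> m) \<or> (\<forall>y\<in>{l..r}. layer \<alpha> (\<epsilon> m) y \<le> ?\<nu> * mesh_scale\<^sup>2)" if "m \<in> {1..n}" for m
      unfolding H_def by (rule adapted_pair[OF lc cr that])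
    fix y :: real assume y: "y \<in> {0<..<1}"
    show "\<bar>G y\<bar> \<le> derivative_const * (1 + (\<Sum>m=i..n. layer \<alpha> (\<epsilon> m) y / \<epsilon> m))"
      using i nn[of i y] derivative_const_ge by (intro order_trans[OF G[OF y]] mult_right_mono) auto
    show "\<bar>\<epsilon> i * Q y\<bar> \<le> derivative_const * (1 + (\<Sum>m=1..n. layer \<alpha> (\<epsilon> m) y / \<epsilon> m))"
      using nn[of 1 y] derivative_const_ge by (intro order_trans[OF Q[OF y]] mult_right_mono) auto
    have "0 \<le> (\<Sum>m=1..n. min (sqrt (\<epsilon> i) / \<epsilon> m) (1 / sqrt (\<epsilon> m)) * layer \<alpha> (\<epsilon> m) y)"
    proof (intro sum_nonneg mult_nonneg_nonneg layer_nonneg)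
      show "0 \<le> min (sqrt (\<epsilon> i) / \<epsilon> m) (1 / sqrt (\<epsilon> m))" if "m \<in> {1..n}" for m
        using eps[OF that] eps[OF i] by simp
    qed
    moreover have "0 \<le> sqrt (\<epsilon> i)" using eps[OF i] by simp
    ultimately show "\<bar>\<epsilon> i * P y\<bar> \<le> derivative_const *
        (sqrt (\<epsilon> i) + (\<Sum>m=1..n. min (sqrt (\<epsilon> i) / \<epsilon> m) (1 / sqrt (\<epsilon> m)) * layer \<alpha> (\<epsilon> m) y))"
      using derivative_const_ge by (intro order_trans[OF P[OF y]] mult_right_mono) auto
  qed (use i eps eps_mono lcr lr contu deriv in auto)
  have sq: "0 \<le> mesh_scale\<^sup>2" by simp
  show "T \<le> \<eta>" if "r - c = c - l \<or> sqrt (\<epsilon> i) \<le> H"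
    using that
  proof
    assume "r - c = c - l"
    then show ?thesis unfolding T_def \<eta>_def
      by (intro order_trans[OF truncation_error_uniform] mult_right_mono[OF truncation_const_ge(2) sq])
  next
    assume "sqrt (\<epsilon> i) \<le> H"
    then show ?thesis unfolding T_def \<eta>_def
      by (intro order_trans[OF truncation_error_coarse] mult_right_mono[OF truncation_const_ge(3) sq])
  qed
  show "T \<le> \<eta> * (1 + sqrt (\<epsilon> i) / H)" unfolding T_def \<eta>_def
    using eps[OF i] H_pos
    by (intro order_trans[OF truncation_error_fine] mult_right_mono truncation_const_ge(4)) auto
qed

text \<open>The barrier for row i depends on \<open>\<epsilon> i\<close> through its decay rate, so
  the rows are treated one at a time, with the other components moved to the right side and bounded
  by the maximal error \<open>E\<close>. Dominance leaves them the weight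
  \<open>a - \<alpha>\<close> against the diagonal entry \<open>a\<close>, a ratio of at most
  \<open>1 - \<alpha> / b\<close>. The maximum over all rows is then a contraction inequality for
  \<open>E\<close>.\<close>

lemma error_bound:
  assumes n: "1 \<le> n" and params: "ordered_params n \<epsilon>" and adm: "admissible_N n N"
    and sol: "bvp_solution n \<epsilon> A f g0 g1 u"
    and scheme: "scheme_solution n \<epsilon> A f g0 g1 N (shishkin_mesh n \<epsilon> \<alpha> N) U"
    and ij: "i \<in> {1..n}" "j \<le> N"
  shows "\<bar>U i j - u i (shishkin_mesh n \<epsilon> \<alpha> N j)\<bar> \<le> error_const * (ln (real N) / real N)\<^sup>2"
proof -
  define x where "x = shishkin_mesh n \<epsilon> \<alpha> N"
  interpret layer_mesh n \<epsilon> \<alpha> N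
    by unfold_locales (use n alpha adm params in \<open>auto simp: ordered_params_def\<close>)
  define \<eta> where "\<eta> = truncation_const * mesh_scale\<^sup>2"
  have \<eta>: "0 \<le> \<eta>" using truncation_const_ge by (simp add: \<eta>_def)
  obtain J where J: "finite J" "card J \<le> 2 * n + 1" and x01: "x 0 = 0" "x N = 1"
    and xa: "\<And>j. j < N \<Longrightarrow> adapted_interval (x j) (x (j + 1))"
    and xJ: "\<And>j. j \<in> {1..N - 1} \<Longrightarrow> j \<notin> J \<Longrightarrow> x (j + 1) - x j = x j - x (j - 1)"
    using shishkin_mesh_adapted unfolding x_def by metis
  have x_less: "x j < x (j + 1)" if "j < N" for j using xa[OF that] by (simp add: adapted_interval_def)
  have x_mono: "x k \<le> x l" if "k \<le> l" "l \<le> N" for k l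
    using that(1) that(2)
  proof (induction l rule: dec_induct)
    case (step l)
    then show ?case using x_less[of l] by simp
  qed simp
  have x_in: "x j \<in> {0<..<1}" if "j \<in> {1..N - 1}" for j
  proof -
    have "x 0 < x 1" "x (N - 1) < x N" using x_less[of 0] x_less[of "N - 1"] that by auto
    moreover have "1 \<le> j" "j \<le> N - 1" "N - 1 \<le> N" "j \<le> N" using that by auto
    ultimately show ?thesis using x_mono[of 1 j] x_mono[of j "N - 1"] x01 by simp
  qed
  obtain V G P Q where bounds: "\<forall>i\<in>{1..n}. continuous_on {0..1} (u i)
    \<and> (\<forall>x\<in>{0<..<1}. (u i has_real_derivative V i x) (at x) \<and> (V i has_real_derivative G i x) (at x)
        \<and> (G i has_real_derivative P i x) (at x) \<and> (P i has_real_derivative Q i x) (at x)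
        \<and> - \<epsilon> i * G i x + (\<Sum>k=1..n. A i k x * u k x) = f i x
        \<and> \<bar>G i x\<bar> \<le> second_deriv_const * (1 + (\<Sum>m=i..n. layer \<alpha> (\<epsilon> m) x / \<epsilon> m))
        \<and> \<bar>\<epsilon> i * Q i x\<bar> \<le> fourth_deriv_const * (1 + (\<Sum>m=1..n. layer \<alpha> (\<epsilon> m) x / \<epsilon> m))
        \<and> \<bar>\<epsilon> i * P i x\<bar> \<le> interpolation_const n \<alpha> * (second_deriv_const + fourth_deriv_const) *
            (sqrt (\<epsilon> i) + (\<Sum>m=1..n. min (sqrt (\<epsilon> i) / \<epsilon> m) (1 / sqrt (\<epsilon> m)) * layer \<alpha> (\<epsilon> m) x)))"
    using solution_bounds[OF params sol] by (elim exE)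
  \<comment> \<open>Only interior nodes can carry a discrete exponential; the index set from the
    mesh also counts the end point 0.\<close>
  define J' where "J' = J \<inter> {1..N - 1}"
  have J': "finite J'" "J' \<subseteq> {1..N - 1}" "card J' \<le> 2 * n + 1"
    using J card_mono[of J J'] by (auto simp: J'_def)
  define T where "T i j = \<epsilon> i * (second_diff x (\<lambda>j. u i (x j)) j - G i (x j))" for i j
  define H where "H j = max (x j - x (j - 1)) (x (j + 1) - x j)" for j
  have T_le: "\<bar>T i j\<bar> \<le> \<eta> \<or> (j \<in> J' \<and> H j \<le> sqrt (\<epsilon> i) \<and> \<bar>T i j\<bar> \<le> \<eta> * (1 + sqrt (\<epsilon> i) / H j))"
    if i: "i \<in> {1..n}" and j: "j \<in> {1..N - 1}" for i j
  proof -
    have "adapted_interval (x (j - 1)) (x (j - 1 + 1))" using j by (intro xa) auto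
    then have lc: "adapted_interval (x (j - 1)) (x j)" using j by simp
    have cr: "adapted_interval (x j) (x (j + 1))" using j by (intro xa) auto
    have lr: "0 \<le> x (j - 1)" "x (j + 1) \<le> 1" using x_mono[of 0 "j - 1"] x_mono[of "j + 1" N] x01 j by auto
    have tb: "x (j + 1) - x j = x j - x (j - 1) \<or> sqrt (\<epsilon> i) \<le> H j \<Longrightarrow> \<bar>T i j\<bar> \<le> \<eta>"
      "\<bar>T i j\<bar> \<le> \<eta> * (1 + sqrt (\<epsilon> i) / H j)"
      unfolding T_def H_def \<eta>_def second_diff_eq_divided
      using truncation_bound[OF layer_mesh_axioms i lc cr lr, of "u i" "V i" "G i" "P i" "Q i"] bounds i
      by blast+
    show ?thesis
    \<comment> \<open>Equal steps or a coarse step give the full order; otherwise the node is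
      exceptional and \<open>H j < sqrt (\<epsilon> i)\<close>, the second alternative of the
      barrier lemma.\<close>
    proof (cases "j \<notin> J \<or> sqrt (\<epsilon> i) \<le> H j")
      case True
      then show ?thesis using tb(1) xJ[OF j] by blast
    next
      case False
      then show ?thesis using tb(2) j by (auto simp: J'_def)
    qed
  qed
  define err where "err i j = U i j - u i (x j)" for i j
  have err_bdry: "err i 0 = 0" "err i N = 0" if "i \<in> {1..n}" for i
    using sol scheme that x01 unfolding bvp_solution_def scheme_solution_def err_def x_def[symmetric] by auto
  have err_eq: "- \<epsilon> i * second_diff x (err i) j + (\<Sum>k=1..n. A i k (x j) * err k j) = T i j"
    if i: "i \<in> {1..n}" and j: "j \<in> {1..N - 1}" for i j
  proof -
    have s: "- \<epsilon> i * second_diff x (U i) j + (\<Sum>k=1..n. A i k (x j) * U k j) = f i (x j)"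
      using scheme i j unfolding scheme_solution_def x_def[symmetric] by blast
    have c: "- \<epsilon> i * G i (x j) + (\<Sum>k=1..n. A i k (x j) * u k (x j)) = f i (x j)"
      using bounds i x_in[OF j] by blast
    have "err i = (\<lambda>j. U i j + (- 1) * u i (x j))" by (simp add: err_def fun_eq_iff)
    then have sd: "second_diff x (err i) j = second_diff x (U i) j - second_diff x (\<lambda>j. u i (x j)) j"
      using second_diff_linear[of x "U i" "- 1" "\<lambda>j. u i (x j)" j] by simp
    have sum: "(\<Sum>k=1..n. A i k (x j) * err k j) = (\<Sum>k=1..n. A i k (x j) * U k j) - (\<Sum>k=1..n. A i k (x j) * u k (x j))"
      by (simp add: err_def right_diff_distrib sum_subtractf)
    show ?thesis using s c unfolding sd sum T_def by (simp add: algebra_simps)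
  qed
  define E where "E = Max ((\<lambda>(i, j). \<bar>err i j\<bar>) ` ({1..n} \<times> {0..N}))"
  have err_le: "\<bar>err i j\<bar> \<le> E" if "i \<in> {1..n}" "j \<le> N" for i j
    unfolding E_def using that by (intro Max_ge) force+
  have E0: "0 \<le> E" using order_trans[OF abs_ge_zero err_le[OF ij]] .
  have b_ge: "\<alpha> \<le> A i i y" "A i i y \<le> b" if "i \<in> {1..n}" "y \<in> {0..1}" for i y
  proof -
    have "(\<Sum>k=1..n. A i k y) = A i i y + (\<Sum>k\<in>{1..n}-{i}. A i k y)" using that by (intro sum.remove) auto
    moreover have "(\<Sum>k\<in>{1..n}-{i}. A i k y) \<le> 0" using offdiag that by (intro sum_nonpos) auto
    ultimately show "\<alpha> \<le> A i i y" using rowsum[OF that] beta by linarith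
    show "A i i y \<le> b" using diag that by simp
  qed
  have b_pos: "0 < b" using b_ge[of 1 0] n alpha by auto
  define D where "D = 1 / \<alpha> + (1 + sqrt (\<alpha> / 2)) / (2 * sqrt (\<alpha> / 2)) * (2 * real n + 1)"
  have step: "\<bar>err i j\<bar> \<le> (1 - \<alpha> / b) * E + \<eta> * D" if i: "i \<in> {1..n}" and j: "j \<le> N" for i j
  proof -
    define \<rho> where "\<rho> = sqrt (\<alpha> / 2) / sqrt (\<epsilon> i)"
    define q where "q = (1 + sqrt (\<alpha> / 2)) / (2 * sqrt (\<alpha> / 2))"
    define \<Psi> where "\<Psi> j = \<eta> / \<alpha> + \<eta> * q * (\<Sum>k\<in>J'. discrete_exp \<rho> x k j)" for j
    have ei: "0 < \<epsilon> i" by (rule eps[OF i])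
    have \<rho>: "0 < \<rho>" using alpha ei by (simp add: \<rho>_def)
    have q: "0 \<le> q" using alpha by (simp add: q_def)
    have de: "0 \<le> discrete_exp \<rho> x k l" "discrete_exp \<rho> x k l \<le> 1" if "k \<in> J'" "l \<le> N" for k l
    proof -
      have "k \<le> N" using that J' by force
      then show "0 \<le> discrete_exp \<rho> x k l" "discrete_exp \<rho> x k l \<le> 1"
        using discrete_exp_bounds[of N x \<rho> k l, OF x_less \<rho>] that by (auto intro: less_imp_le)
    qed
    have \<Psi>0: "0 \<le> \<Psi> l" if "l \<le> N" for l
      unfolding \<Psi>_def using \<eta> q alpha de that by (intro add_nonneg_nonneg mult_nonneg_nonneg sum_nonneg) auto
    have \<Psi>D: "\<Psi> l \<le> \<eta> * D" if "l \<le> N" for l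
    proof -
      have "(\<Sum>k\<in>J'. discrete_exp \<rho> x k l) \<le> real (card J') * 1" using de that by (intro sum_bounded_above) auto
      also have "\<dots> \<le> 2 * real n + 1" using J'(3) by linarith
      finally have "\<eta> * q * (\<Sum>k\<in>J'. discrete_exp \<rho> x k l) \<le> \<eta> * q * (2 * real n + 1)"
        using \<eta> q by (intro mult_left_mono) auto
      then show ?thesis unfolding \<Psi>_def D_def q_def[symmetric] by (simp add: algebra_simps)
    qed
    \<comment> \<open>Constant comparison function for the coupling terms:
      \<open>a * \<theta>\<close> dominates \<open>(a - \<alpha>) * E\<close> for every diagonal
      value \<open>a \<le> b\<close>.\<close>
    define \<theta> where "\<theta> = (1 - \<alpha> / b) * E"
    have ab: "\<alpha> \<le> b" using b_ge[of i 0] i by auto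
    have \<theta>: "0 \<le> \<theta>" using E0 ab b_pos by (simp add: \<theta>_def)
    have "0 \<le> \<theta> + \<Psi> j + s * err i j" if s: "s = 1 \<or> s = -1" for s
    proof (rule discrete_comparison[where x = x and e = "\<epsilon> i" and a = "\<lambda>j. A i i (x j)" and N = N
          and z = "\<lambda>j. \<theta> + \<Psi> j + s * err i j"])
      show "0 \<le> \<theta> + \<Psi> 0 + s * err i 0" "0 \<le> \<theta> + \<Psi> N + s * err i N"
        using \<theta> \<Psi>0 err_bdry[OF i] by auto
      fix l assume l: "l \<in> {1..N - 1}"
      then have xl: "x l \<in> {0..1}" "l \<le> N" using x_in[OF l] by auto
      define a where "a = A i i (x l)"
      have a: "\<alpha> \<le> a" "a \<le> b" using b_ge[OF i xl(1)] by (auto simp: a_def)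
      show "0 < A i i (x l)" using a alpha by (simp add: a_def)
      have barrier: "\<bar>T i l\<bar> \<le> - \<epsilon> i * second_diff x \<Psi> l + a * \<Psi> l"
        unfolding \<Psi>_def q_def
        by (rule discrete_barrier[where N = N and x = x and H = "H l" and J = J', OF x_less \<rho> alpha ei \<rho>_def \<eta> J'(1,2) a(1) l])
          (use T_le[OF i l] in \<open>auto simp: H_def\<close>)
      have "(\<Sum>k=1..n. A i k (x l) * err k l) = a * err i l + (\<Sum>k\<in>{1..n}-{i}. A i k (x l) * err k l)"
        unfolding a_def using i by (intro sum.remove) auto
      moreover have "\<bar>\<Sum>k\<in>{1..n}-{i}. A i k (x l) * err k l\<bar> \<le> (a - \<alpha>) * E"
      proof -
        have "\<bar>\<Sum>k\<in>{1..n}-{i}. A i k (x l) * err k l\<bar> \<le> (\<Sum>k\<in>{1..n}-{i}. \<bar>A i k (x l) * err k l\<bar>)" by (rule sum_abs)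
        also have "\<dots> \<le> (\<Sum>k\<in>{1..n}-{i}. - A i k (x l) * E)"
        proof (rule sum_mono)
          fix k assume k: "k \<in> {1..n} - {i}"
          have "\<bar>A i k (x l)\<bar> = - A i k (x l)" using offdiag[OF i _ _ xl(1), of k] k by auto
          then show "\<bar>A i k (x l) * err k l\<bar> \<le> - A i k (x l) * E"
            using err_le[of k l] k xl offdiag[OF i _ _ xl(1), of k] unfolding abs_mult by (intro mult_mono) auto
        qed
        also have "\<dots> = - (\<Sum>k\<in>{1..n}-{i}. A i k (x l)) * E" by (simp add: sum_distrib_right sum_negf)
        also have "\<dots> \<le> (a - \<alpha>) * E"
        proof (rule mult_right_mono[OF _ E0])
          have "(\<Sum>k=1..n. A i k (x l)) = a + (\<Sum>k\<in>{1..n}-{i}. A i k (x l))"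
            unfolding a_def using i by (intro sum.remove) auto
          then show "- (\<Sum>k\<in>{1..n}-{i}. A i k (x l)) \<le> a - \<alpha>" using rowsum[OF i xl(1)] beta by linarith
        qed
        finally show ?thesis .
      qed
      ultimately have "\<bar>- \<epsilon> i * second_diff x (err i) l + a * err i l\<bar> \<le> \<bar>T i l\<bar> + (a - \<alpha>) * E"
        using err_eq[OF i l] by linarith
      moreover have "(a - \<alpha>) * E \<le> a * \<theta>"
      proof -
        have "\<alpha> / b * a \<le> \<alpha> / b * b" using a alpha b_pos by (intro mult_left_mono) auto
        then have "a - \<alpha> \<le> a * (1 - \<alpha> / b)" using b_pos by (simp add: right_diff_distrib mult.commute)
        then show ?thesis unfolding \<theta>_def mult.assoc[symmetric] using E0 by (rule mult_right_mono)
      qed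
      ultimately have le: "\<bar>- \<epsilon> i * second_diff x (err i) l + a * err i l\<bar> \<le> (- \<epsilon> i * second_diff x \<Psi> l + a * \<Psi> l) + a * \<theta>"
        using barrier by linarith
      have "second_diff x (\<lambda>j. \<theta> + \<Psi> j + s * err i j) l = second_diff x \<Psi> l + s * second_diff x (err i) l"
        using second_diff_linear[of x "\<lambda>j. \<theta> + \<Psi> j" s "err i" l] second_diff_linear[of x "\<lambda>j. \<theta>" 1 \<Psi> l]
        by (simp add: second_diff_const)
      then have "- \<epsilon> i * second_diff x (\<lambda>j. \<theta> + \<Psi> j + s * err i j) l + a * (\<theta> + \<Psi> l + s * err i l)
        = ((- \<epsilon> i * second_diff x \<Psi> l + a * \<Psi> l) + a * \<theta>) + s * (- \<epsilon> i * second_diff x (err i) l + a * err i l)"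
        by (simp add: algebra_simps)
      then show "0 \<le> - \<epsilon> i * second_diff x (\<lambda>j. \<theta> + \<Psi> j + s * err i j) l + A i i (x l) * (\<theta> + \<Psi> l + s * err i l)"
        using le s unfolding a_def[symmetric] by (auto simp: abs_le_iff)
    qed (use x_less ei j in auto)
    from this[of 1] this[of "-1"] have "\<bar>err i j\<bar> \<le> \<theta> + \<Psi> j" by (simp add: abs_le_iff)
    then show ?thesis using \<Psi>D[OF j] by (simp add: \<theta>_def)
  qed
  \<comment> \<open>The maximum is attained by one of the errors, so \<open>step\<close> applies to
    \<open>E\<close> itself, and the contraction term can be moved to the left.\<close>
  have "E \<le> (1 - \<alpha> / b) * E + \<eta> * D"
    unfolding E_def[symmetric]
  proof -
    have "E \<in> (\<lambda>(i, j). \<bar>err i j\<bar>) ` ({1..n} \<times> {0..N})"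
      unfolding E_def using n by (intro Max_in) auto
    then show "E \<le> (1 - \<alpha> / b) * E + \<eta> * D" using step by auto
  qed
  then have "\<alpha> / b * E \<le> \<eta> * D" by (simp add: algebra_simps)
  then have "E \<le> b / \<alpha> * (\<eta> * D)" using b_pos alpha by (simp add: field_simps)
  also have "\<dots> = error_const * (ln (real N) / real N)\<^sup>2"
  proof -
    have "mesh_scale\<^sup>2 = (2 ^ (2 * n + 3) * (1 + 1 / sqrt \<alpha>))\<^sup>2 * (ln (real N) / real N)\<^sup>2"
      unfolding mesh_scale_def by (rule power_mult_distrib)
    then show ?thesis
      unfolding error_const_def stability_const_def D_def \<eta>_def by (simp only: mult_ac)
  qed
  finally show ?thesis using err_le[OF ij] unfolding err_def x_def by linarith
qed

end

section \<open>From the given data to uniform constants\<close>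

lemma Cm_unit_2D:
  assumes "Cm_unit 2 g"
  shows "\<exists>g1 g2 M. continuous_on {0..1} g
    \<and> (\<forall>x\<in>{0<..<1}. (g has_real_derivative g1 x) (at x) \<and> (g1 has_real_derivative g2 x) (at x))
    \<and> (\<forall>x\<in>{0..1}. \<bar>g x\<bar> \<le> M \<and> \<bar>g1 x\<bar> \<le> M \<and> \<bar>g2 x\<bar> \<le> M)"
proof -
  obtain D where D0: "\<And>x. x \<in> {0..1} \<Longrightarrow> D 0 x = g x"
    and D: "\<And>k x. k < 2 \<Longrightarrow> x \<in> {0..1} \<Longrightarrow> (D k has_real_derivative D (Suc k) x) (at x within {0..1})"
    and contD: "\<And>k. k \<le> 2 \<Longrightarrow> continuous_on {0..1} (D k)"
    using assms unfolding Cm_unit_def by blast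
  have at: "(D k has_real_derivative D (Suc k) x) (at x)" if "k < 2" "x \<in> {0<..<1}" for k x
    using D[OF that(1), of x] that(2) at_within_Icc_at[of 0 x 1] by simp
  have "\<exists>M. \<forall>x\<in>{0..1}. \<bar>D k x\<bar> \<le> M" if "k \<le> 2" for k
    using compact_imp_bounded[OF compact_continuous_image[OF contD[OF that]]] by (auto simp: bounded_iff)
  then obtain M where M: "\<And>k x. k \<le> 2 \<Longrightarrow> x \<in> {0..1} \<Longrightarrow> \<bar>D k x\<bar> \<le> M k" by metis
  have "continuous_on {0..1} g" using contD[of 0] D0 continuous_on_cong[of "{0..1}" "{0..1}" "D 0" g] by simp
  moreover have "(g has_real_derivative D 1 x) (at x)" if x: "x \<in> {0<..<1}" for x
    by (rule has_field_derivative_transform_within_open[of "D 0" _ _ "{0<..<1}"])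
      (use at[of 0 x] D0 x in auto)
  moreover have "(D 1 has_real_derivative D 2 x) (at x)" if "x \<in> {0<..<1}" for x
    using at[of 1 x] that by (simp add: numeral_2_eq_2)
  moreover have "\<bar>g x\<bar> \<le> max (M 0) (max (M 1) (M 2)) \<and> \<bar>D 1 x\<bar> \<le> max (M 0) (max (M 1) (M 2)) \<and> \<bar>D 2 x\<bar> \<le> max (M 0) (max (M 1) (M 2))"
    if "x \<in> {0..1}" for x
    using M[of 0 x] M[of 1 x] M[of 2 x] D0[OF that] that by auto
  ultimately show ?thesis by blast
qed

text \<open>Compactness supplies the constants: the continuous row sums attain their minima, which
  exceed \<open>\<alpha>\<close>, and the least excess over the finitely many rows is
  \<open>\<beta>\<close>. The bound \<open>b\<close> dominates finitely many bounds for the data and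
  their derivatives. None of these depends on the perturbation parameters or on N.\<close>

lemma smooth_problem_exists:
  assumes n: "1 \<le> n" and A: "\<And>i k. i \<in> {1..n} \<Longrightarrow> k \<in> {1..n} \<Longrightarrow> Cm_unit 2 (A i k)"
    and f: "\<And>i. i \<in> {1..n} \<Longrightarrow> Cm_unit 2 (f i)"
    and offdiag: "\<And>x i k. x \<in> {0..1} \<Longrightarrow> i \<in> {1..n} \<Longrightarrow> k \<in> {1..n} \<Longrightarrow> i \<noteq> k \<Longrightarrow> A i k x \<le> 0"
    and \<alpha>: "0 < \<alpha>" and rowsum: "\<And>x i. x \<in> {0..1} \<Longrightarrow> i \<in> {1..n} \<Longrightarrow> \<alpha> < (\<Sum>k=1..n. A i k x)"
  shows "\<exists>\<beta> b A1 A2 f1 f2. smooth_problem n A \<alpha> \<beta> b A1 A2 f f1 f2 g0 g1"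
proof -
  \<comment> \<open>The triple \<open>t\<close> holds the two derivatives and a common bound.
    Choosing it as a function of \<open>g\<close>, with smoothness as a premise, serves all entries
    of \<open>A\<close> and \<open>f\<close> with a single choice function.\<close>
  have "\<forall>g. \<exists>t. Cm_unit 2 g \<longrightarrow> continuous_on {0..1} g
    \<and> (\<forall>x\<in>{0<..<1}. (g has_real_derivative fst t x) (at x) \<and> (fst t has_real_derivative fst (snd t) x) (at x))
    \<and> (\<forall>x\<in>{0..1}. \<bar>g x\<bar> \<le> snd (snd t) \<and> \<bar>fst t x\<bar> \<le> snd (snd t) \<and> \<bar>fst (snd t) x\<bar> \<le> snd (snd t))"
    using Cm_unit_2D by auto
  from choice[OF this] obtain d where d: "\<And>g. Cm_unit 2 g \<Longrightarrow> continuous_on {0..1} g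
    \<and> (\<forall>x\<in>{0<..<1}. (g has_real_derivative fst (d g) x) (at x) \<and> (fst (d g) has_real_derivative fst (snd (d g)) x) (at x))
    \<and> (\<forall>x\<in>{0..1}. \<bar>g x\<bar> \<le> snd (snd (d g)) \<and> \<bar>fst (d g) x\<bar> \<le> snd (snd (d g)) \<and> \<bar>fst (snd (d g)) x\<bar> \<le> snd (snd (d g)))"
    by blast
  define S where "S = {0} \<union> (\<lambda>(i, k). snd (snd (d (A i k)))) ` ({1..n} \<times> {1..n}) \<union> (\<lambda>i. snd (snd (d (f i)))) ` {1..n}
      \<union> (\<lambda>i. \<bar>g0 i\<bar>) ` {1..n} \<union> (\<lambda>i. \<bar>g1 i\<bar>) ` {1..n}"
  have "finite S" by (simp add: S_def)
  then obtain b where b: "\<And>s. s \<in> S \<Longrightarrow> s \<le> b" using bdd_above_finite unfolding bdd_above_def by blast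
  have bA: "snd (snd (d (A i k))) \<le> b" if "i \<in> {1..n}" "k \<in> {1..n}" for i k using that by (intro b) (force simp: S_def)
  have bf: "snd (snd (d (f i))) \<le> b" "\<bar>g0 i\<bar> \<le> b" "\<bar>g1 i\<bar> \<le> b" if "i \<in> {1..n}" for i
    using that by (auto intro!: b simp: S_def)
  have "\<forall>i\<in>{1..n}. \<exists>m. \<alpha> < m \<and> (\<forall>x\<in>{0..1}. m \<le> (\<Sum>k=1..n. A i k x))"
  proof
    fix i assume i: "i \<in> {1..n}"
    have cont: "continuous_on {0..1} (\<lambda>x. \<Sum>k=1..n. A i k x)" using d A i by (intro continuous_on_sum) blast
    have "\<exists>y\<in>{0..1}. \<forall>x\<in>{0..1}. (\<Sum>k=1..n. A i k y) \<le> (\<Sum>k=1..n. A i k x)"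
      by (rule continuous_attains_inf[OF _ _ cont]) auto
    then obtain y where "y \<in> {0..1}" "\<forall>x\<in>{0..1}. (\<Sum>k=1..n. A i k y) \<le> (\<Sum>k=1..n. A i k x)" ..
    then show "\<exists>m. \<alpha> < m \<and> (\<forall>x\<in>{0..1}. m \<le> (\<Sum>k=1..n. A i k x))" using rowsum[of y i] i by blast
  qed
  from bchoice[OF this] obtain m where "\<forall>i\<in>{1..n}. \<alpha> < m i \<and> (\<forall>x\<in>{0..1}. m i \<le> (\<Sum>k=1..n. A i k x))" ..
  then have m: "\<And>i. i \<in> {1..n} \<Longrightarrow> \<alpha> < m i" "\<And>i x. i \<in> {1..n} \<Longrightarrow> x \<in> {0..1} \<Longrightarrow> m i \<le> (\<Sum>k=1..n. A i k x)"
    by blast+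
  define \<beta> where "\<beta> = Min ((\<lambda>i. m i - \<alpha>) ` {1..n})"
  have \<beta>: "0 < \<beta>" unfolding \<beta>_def using n m(1) by (subst Min_gr_iff) auto
  have \<beta>m: "\<alpha> + \<beta> \<le> m i" if "i \<in> {1..n}" for i
  proof -
    have "\<beta> \<le> m i - \<alpha>" unfolding \<beta>_def using that by (intro Min_le) auto
    then show ?thesis by simp
  qed
  have "smooth_problem n A \<alpha> \<beta> b (\<lambda>i k. fst (d (A i k))) (\<lambda>i k. fst (snd (d (A i k)))) f
      (\<lambda>i. fst (d (f i))) (\<lambda>i. fst (snd (d (f i)))) g0 g1"
  proof
    show "0 < \<alpha>" by fact
    show "0 < \<beta>" by fact
    show "0 \<le> b" by (rule b) (simp add: S_def)
    fix i assume i: "i \<in> {1..n}"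
    note df = d[OF f[OF i]]
    show "continuous_on {0..1} (f i)" using df by blast
    show "\<bar>g0 i\<bar> \<le> b" "\<bar>g1 i\<bar> \<le> b" using bf[OF i] by auto
    {
      fix x :: real assume x: "x \<in> {0..1}"
      show "\<alpha> + \<beta> \<le> (\<Sum>k=1..n. A i k x)" using \<beta>m[OF i] m(2)[OF i x] by linarith
      show "\<bar>f i x\<bar> \<le> b" "\<bar>fst (d (f i)) x\<bar> \<le> b" "\<bar>fst (snd (d (f i))) x\<bar> \<le> b"
        using df x bf(1)[OF i] by (meson order_trans)+
      have "\<bar>A i i x\<bar> \<le> b" using d[OF A[OF i i]] x bA[OF i i] by (meson order_trans)
      then show "A i i x \<le> b" by simp
    }
    {
      fix x :: real assume x: "x \<in> {0<..<1}"
      show "(f i has_real_derivative fst (d (f i)) x) (at x)"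
        "(fst (d (f i)) has_real_derivative fst (snd (d (f i))) x) (at x)" using df x by blast+
    }
    fix k assume k: "k \<in> {1..n}"
    note dA = d[OF A[OF i k]]
    show "continuous_on {0..1} (A i k)" using dA by blast
    {
      fix x :: real assume x: "x \<in> {0..1}"
      show "A i k x \<le> 0" if "i \<noteq> k" using offdiag[OF x i k that] .
      show "\<bar>A i k x\<bar> \<le> b" "\<bar>fst (d (A i k)) x\<bar> \<le> b" "\<bar>fst (snd (d (A i k))) x\<bar> \<le> b"
        using dA x bA[OF i k] by (meson order_trans)+
    }
    fix x :: real assume x: "x \<in> {0<..<1}"
    show "(A i k has_real_derivative fst (d (A i k)) x) (at x)"
      "(fst (d (A i k)) has_real_derivative fst (snd (d (A i k))) x) (at x)" using dA x by blast+
  qed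
  then show ?thesis by blast
qed

theorem mainTheorem2:
  fixes n :: nat
  assumes "n \<ge> 1"
  shows "\<exists>m :: nat.
    \<forall>(A :: nat \<Rightarrow> nat \<Rightarrow> real \<Rightarrow> real) (f :: nat \<Rightarrow> real \<Rightarrow> real) (\<alpha> :: real)
     (g0 :: nat \<Rightarrow> real) (g1 :: nat \<Rightarrow> real).
      (\<forall>i\<in>{1..n}. \<forall>k\<in>{1..n}. Cm_unit m (A i k)) \<and>
      (\<forall>i\<in>{1..n}. Cm_unit m (f i)) \<and>
      (\<forall>x\<in>{0..1}. \<forall>i\<in>{1..n}. A i i x > (\<Sum>k\<in>{1..n} - {i}. \<bar>A i k x\<bar>)) \<and>
      (\<forall>x\<in>{0..1}. \<forall>i\<in>{1..n}. \<forall>k\<in>{1..n}. i \<noteq> k \<longrightarrow> A i k x \<le> 0) \<and>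
      0 < \<alpha> \<and> (\<forall>x\<in>{0..1}. \<forall>i\<in>{1..n}. \<alpha> < (\<Sum>k=1..n. A i k x))
      \<longrightarrow>
      (\<exists>C > 0. \<forall>(\<epsilon> :: nat \<Rightarrow> real) (N :: nat) (u :: nat \<Rightarrow> real \<Rightarrow> real) (U :: nat \<Rightarrow> nat \<Rightarrow> real).
        0 < \<epsilon> 1 \<and> strict_mono_on {1..n} \<epsilon> \<and> \<epsilon> n \<le> 1 \<and>
        (MAX i\<in>{1..n}. sqrt (\<epsilon> i)) \<le> sqrt \<alpha> / 4 \<and>
        admissible_N n N \<and>
        bvp_solution n \<epsilon> A f g0 g1 u \<and>
        scheme_solution n \<epsilon> A f g0 g1 N (shishkin_mesh n \<epsilon> \<alpha> N) U
        \<longrightarrow>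
        (MAX i\<in>{1..n}. MAX j\<in>{0..N}. \<bar>U i j - u i (shishkin_mesh n \<epsilon> \<alpha> N j)\<bar>)
          \<le> C * (inverse (real N) * ln (real N))\<^sup>2)"
\<comment> \<open>Two continuous derivatives of the data suffice: they make \<open>u''\<close>, as
  given by the equation, twice differentiable.\<close>
proof (rule exI[of _ 2], intro allI impI)
  fix A :: "nat \<Rightarrow> nat \<Rightarrow> real \<Rightarrow> real" and f :: "nat \<Rightarrow> real \<Rightarrow> real" and \<alpha> :: real and g0 g1 :: "nat \<Rightarrow> real"
  assume hyp: "(\<forall>i\<in>{1..n}. \<forall>k\<in>{1..n}. Cm_unit 2 (A i k)) \<and>
      (\<forall>i\<in>{1..n}. Cm_unit 2 (f i)) \<and>
      (\<forall>x\<in>{0..1}. \<forall>i\<in>{1..n}. A i i x > (\<Sum>k\<in>{1..n} - {i}. \<bar>A i k x\<bar>)) \<and>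
      (\<forall>x\<in>{0..1}. \<forall>i\<in>{1..n}. \<forall>k\<in>{1..n}. i \<noteq> k \<longrightarrow> A i k x \<le> 0) \<and>
      0 < \<alpha> \<and> (\<forall>x\<in>{0..1}. \<forall>i\<in>{1..n}. \<alpha> < (\<Sum>k=1..n. A i k x))"
  have "\<exists>\<beta> b A1 A2 f1 f2. smooth_problem n A \<alpha> \<beta> b A1 A2 f f1 f2 g0 g1"
    by (rule smooth_problem_exists) (use assms hyp in blast)+
  then obtain \<beta> b A1 A2 f1 f2 where "smooth_problem n A \<alpha> \<beta> b A1 A2 f f1 f2 g0 g1" by (elim exE)
  then interpret smooth_problem n A \<alpha> \<beta> b A1 A2 f f1 f2 g0 g1 .
  \<comment> \<open>The absolute value and the 1 make the constant visibly positive;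
    \<open>error_const\<close> is fixed before the perturbation parameters, N, u and U are
    introduced.\<close>
  let ?C = "\<bar>error_const\<bar> + 1"
  show "\<exists>C > 0. \<forall>(\<epsilon> :: nat \<Rightarrow> real) (N :: nat) (u :: nat \<Rightarrow> real \<Rightarrow> real) (U :: nat \<Rightarrow> nat \<Rightarrow> real).
        0 < \<epsilon> 1 \<and> strict_mono_on {1..n} \<epsilon> \<and> \<epsilon> n \<le> 1 \<and>
        (MAX i\<in>{1..n}. sqrt (\<epsilon> i)) \<le> sqrt \<alpha> / 4 \<and>
        admissible_N n N \<and>
        bvp_solution n \<epsilon> A f g0 g1 u \<and>
        scheme_solution n \<epsilon> A f g0 g1 N (shishkin_mesh n \<epsilon> \<alpha> N) U
        \<longrightarrow>
        (MAX i\<in>{1..n}. MAX j\<in>{0..N}. \<bar>U i j - u i (shishkin_mesh n \<epsilon> \<alpha> N j)\<bar>)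
          \<le> C * (inverse (real N) * ln (real N))\<^sup>2"
  proof (intro exI[of _ ?C] conjI allI impI)
    fix \<epsilon> N u U
    assume h: "0 < \<epsilon> 1 \<and> strict_mono_on {1..n} \<epsilon> \<and> \<epsilon> n \<le> 1 \<and>
        (MAX i\<in>{1..n}. sqrt (\<epsilon> i)) \<le> sqrt \<alpha> / 4 \<and>
        admissible_N n N \<and>
        bvp_solution n \<epsilon> A f g0 g1 u \<and>
        scheme_solution n \<epsilon> A f g0 g1 N (shishkin_mesh n \<epsilon> \<alpha> N) U"
    have mono: "\<epsilon> i \<le> \<epsilon> k" if "i \<in> {1..n}" "k \<in> {1..n}" "i \<le> k" for i k
      using strict_mono_on_leD[of "{1..n}" \<epsilon> i k] h that by blast
    have params: "ordered_params n \<epsilon>" unfolding ordered_params_def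
    proof (intro conjI ballI impI)
      fix i assume i: "i \<in> {1..n}"
      have "\<epsilon> 1 \<le> \<epsilon> i" "\<epsilon> i \<le> \<epsilon> n" using mono[of 1 i] mono[of i n] i by auto
      then show "0 < \<epsilon> i" "\<epsilon> i \<le> 1" using h by auto
    qed (use mono in auto)
    have "\<bar>U i j - u i (shishkin_mesh n \<epsilon> \<alpha> N j)\<bar> \<le> ?C * (inverse (real N) * ln (real N))\<^sup>2"
      if "i \<in> {1..n}" "j \<in> {0..N}" for i j
    proof -
      have "\<bar>U i j - u i (shishkin_mesh n \<epsilon> \<alpha> N j)\<bar> \<le> error_const * (ln (real N) / real N)\<^sup>2"
        using h that by (intro error_bound assms params) auto
      also have "\<dots> \<le> ?C * (ln (real N) / real N)\<^sup>2" by (intro mult_right_mono) auto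
      finally show ?thesis by (simp add: divide_inverse mult.commute)
    qed
    then show "(MAX i\<in>{1..n}. MAX j\<in>{0..N}. \<bar>U i j - u i (shishkin_mesh n \<epsilon> \<alpha> N j)\<bar>)
          \<le> ?C * (inverse (real N) * ln (real N))\<^sup>2"
      using assms by (intro Max.boundedI) auto
  qed simp
qed

end
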